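(* Let $E$ be a graded division algebra with center $T$, with a unitary graded involution $\tau$, and let $R=T^\tau$. If $E\ne T$ and $T$ is totally ramified over $R$, then $\Sigma_\tau(E)=E^*$, so $\operatorname{SK}_1(E,\tau)=1$.
   Context: A graded division ring is a ring $E=\bigoplus_{\gamma\in\Gamma}E_\gamma$ graded by a torsion-free abelian group $\Gamma$ in which every nonzero homogeneous element is invertible; $\Gamma_E=\{\gamma\mid E_\gamma\ne0\}$ (a group), and the unit group $E^*$ is the set of nonzero homogeneous elements. $E$ is assumed finite-dimensional over its center $T=Z(E)$, a graded field (commutative graded division ring). $\operatorname{Nrd}_E\colon E^*\to T^*$ is the restriction of the reduced norm of the quotient division ring $E\otimes_Tq(T)$, $q(T)$ the quotient field of $T$. A graded involution $\tau$ is an antiautomorphism of $E$ with $\tau^2=\mathrm{id}$ and $\tau(E_\gamma)=E_\gamma$ for all $\gamma$; it is unitary if $\tau|_T\ne\mathrm{id}$. $R=T^\tau$ is then a graded subfield of $T$ with $[T:R]=2=[T_0:R_0]\,|\Gamma_T:\Gamma_R|$; "$T$ totally ramified over $R$" means $|\Gamma_T:\Gamma_R|=2$. $\Sigma_\tau(E)=\langle a\in E^*\mid\tau(a)=a\rangle$ and $\operatorname{SK}_1(E,\tau)=\{a\in E^*\mid\operatorname{Nrd}_E(a)\in R^*\}/\Sigma_\tau(E)$. *)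

theory Defs
  imports "HOL-Algebra.Algebra" "HOL-Combinatorics.Permutations"
begin

section \<open>Graded division rings\<close>

text \<open>The grade group is a torsion-free abelian group, written multiplicatively as in
  HOL-Algebra.\<close>

locale graded_ring = ring E + grp: comm_group \<Gamma>
  for E :: "('a, 'm) ring_scheme" (structure) and \<Gamma> :: "('g, 'n) monoid_scheme"
    and grad :: "'g \<Rightarrow> 'a set" +
  assumes torsion_free:
      "\<lbrakk>\<gamma> \<in> carrier \<Gamma>; 0 < (k::nat); \<gamma> [^]\<^bsub>\<Gamma>\<^esub> k = \<one>\<^bsub>\<Gamma>\<^esub>\<rbrakk> \<Longrightarrow> \<gamma> = \<one>\<^bsub>\<Gamma>\<^esub>"
    and grad_subgroup: "\<gamma> \<in> carrier \<Gamma> \<Longrightarrow> additive_subgroup (grad \<gamma>) E"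
    and grad_mult:
      "\<lbrakk>\<gamma> \<in> carrier \<Gamma>; \<delta> \<in> carrier \<Gamma>; x \<in> grad \<gamma>; y \<in> grad \<delta>\<rbrakk>
        \<Longrightarrow> x \<otimes>\<^bsub>E\<^esub> y \<in> grad (\<gamma> \<otimes>\<^bsub>\<Gamma>\<^esub> \<delta>)"
    and direct_sum:
      "x \<in> carrier E \<Longrightarrow>
        \<exists>!f. f \<in> (\<Pi>\<^sub>E \<gamma>\<in>carrier \<Gamma>. grad \<gamma>)
          \<and> finite {\<gamma> \<in> carrier \<Gamma>. f \<gamma> \<noteq> \<zero>\<^bsub>E\<^esub>}
          \<and> x = finsum E f {\<gamma> \<in> carrier \<Gamma>. f \<gamma> \<noteq> \<zero>\<^bsub>E\<^esub>}"

locale graded_division_ring = graded_ring +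
  assumes one_not_zero: "\<one>\<^bsub>E\<^esub> \<noteq> \<zero>\<^bsub>E\<^esub>"
    and homogeneous_unit:
      "\<lbrakk>\<gamma> \<in> carrier \<Gamma>; x \<in> grad \<gamma>; x \<noteq> \<zero>\<^bsub>E\<^esub>\<rbrakk> \<Longrightarrow> x \<in> Units E"

text \<open>The set of degrees of a graded subset, e.g. $\Gamma_T$ for $T$ the center.\<close>

definition grade_set ::
    "('a, 'm) ring_scheme \<Rightarrow> ('g, 'n) monoid_scheme \<Rightarrow> ('g \<Rightarrow> 'a set) \<Rightarrow> 'a set \<Rightarrow> 'g set" where
  "grade_set E \<Gamma> grad S = {\<gamma> \<in> carrier \<Gamma>. S \<inter> grad \<gamma> \<noteq> {\<zero>\<^bsub>E\<^esub>}}"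

definition ring_center :: "('a, 'm) ring_scheme \<Rightarrow> 'a set" where
  "ring_center E = {z \<in> carrier E. \<forall>x \<in> carrier E. z \<otimes>\<^bsub>E\<^esub> x = x \<otimes>\<^bsub>E\<^esub> z}"

definition module_basis :: "('a, 'm) ring_scheme \<Rightarrow> 'a set \<Rightarrow> 'a set \<Rightarrow> bool" where
  "module_basis E T B \<longleftrightarrow>
     finite B \<and> B \<subseteq> carrier E \<and>
     (\<forall>x \<in> carrier E. \<exists>!c. c \<in> B \<rightarrow>\<^sub>E T \<and> x = (\<Oplus>\<^bsub>E\<^esub>b\<in>B. c b \<otimes>\<^bsub>E\<^esub> b))"

text \<open>As usual for graded vector spaces, the dimension is the cardinality of a homogeneous
  basis.\<close>

definition graded_fin_dim ::
    "('a, 'm) ring_scheme \<Rightarrow> ('g, 'n) monoid_scheme \<Rightarrow> ('g \<Rightarrow> 'a set) \<Rightarrow> 'a set \<Rightarrow> bool" where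
  "graded_fin_dim E \<Gamma> grad T \<longleftrightarrow>
     (\<exists>B. module_basis E T B \<and> B \<subseteq> (\<Union>\<gamma>\<in>carrier \<Gamma>. grad \<gamma>))"


section \<open>The quotient division ring\<close>

text \<open>
  $E \otimes_T q(T)$ for $T = Z(E)$, realised as the ring of fractions $a/s$ with
  $a \in E$ and $s \in T \setminus \{0\}$.  The equivalence relation needs no auxiliary factor,
  since for a graded division ring the nonzero elements of $T$ are not zero divisors in $E$.
\<close>

definition frac ::
    "('a, 'm) ring_scheme \<Rightarrow> 'a \<Rightarrow> 'a \<Rightarrow> ('a \<times> 'a) set" where
  "frac E a s =
     {(b, t). b \<in> carrier E \<and> t \<in> ring_center E - {\<zero>\<^bsub>E\<^esub>} \<and> a \<otimes>\<^bsub>E\<^esub> t = b \<otimes>\<^bsub>E\<^esub> s}"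

definition quot_ring :: "('a, 'm) ring_scheme \<Rightarrow> ('a \<times> 'a) set ring" where
  "quot_ring E =
     \<lparr>carrier = {frac E a s | a s. a \<in> carrier E \<and> s \<in> ring_center E - {\<zero>\<^bsub>E\<^esub>}},
      monoid.mult = (\<lambda>p q. \<Union>(a, s)\<in>p. \<Union>(b, t)\<in>q. frac E (a \<otimes>\<^bsub>E\<^esub> b) (s \<otimes>\<^bsub>E\<^esub> t)),
      one = frac E \<one>\<^bsub>E\<^esub> \<one>\<^bsub>E\<^esub>,
      ring.zero = frac E \<zero>\<^bsub>E\<^esub> \<one>\<^bsub>E\<^esub>,
      add = (\<lambda>p q. \<Union>(a, s)\<in>p. \<Union>(b, t)\<in>q.
               frac E (a \<otimes>\<^bsub>E\<^esub> t \<oplus>\<^bsub>E\<^esub> b \<otimes>\<^bsub>E\<^esub> s) (s \<otimes>\<^bsub>E\<^esub> t))\<rparr>"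


section \<open>Matrices over a field and the reduced norm\<close>

definition mat_ring :: "('l, 'm) ring_scheme \<Rightarrow> nat \<Rightarrow> (nat \<times> nat \<Rightarrow> 'l) ring" where
  "mat_ring L n =
     \<lparr>carrier = {..<n} \<times> {..<n} \<rightarrow>\<^sub>E carrier L,
      monoid.mult = (\<lambda>A B. \<lambda>(i, j) \<in> {..<n} \<times> {..<n}. \<Oplus>\<^bsub>L\<^esub>k\<in>{..<n}. A (i, k) \<otimes>\<^bsub>L\<^esub> B (k, j)),
      one = (\<lambda>(i, j) \<in> {..<n} \<times> {..<n}. if i = j then \<one>\<^bsub>L\<^esub> else \<zero>\<^bsub>L\<^esub>),
      ring.zero = (\<lambda>(i, j) \<in> {..<n} \<times> {..<n}. \<zero>\<^bsub>L\<^esub>),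
      add = (\<lambda>A B. \<lambda>(i, j) \<in> {..<n} \<times> {..<n}. A (i, j) \<oplus>\<^bsub>L\<^esub> B (i, j))\<rparr>"

definition scalar_mat :: "('l, 'm) ring_scheme \<Rightarrow> nat \<Rightarrow> 'l \<Rightarrow> (nat \<times> nat \<Rightarrow> 'l)" where
  "scalar_mat L n c = (\<lambda>(i, j) \<in> {..<n} \<times> {..<n}. if i = j then c else \<zero>\<^bsub>L\<^esub>)"

definition mat_det :: "('l, 'm) ring_scheme \<Rightarrow> nat \<Rightarrow> (nat \<times> nat \<Rightarrow> 'l) \<Rightarrow> 'l" where
  "mat_det L n A =
     (\<Oplus>\<^bsub>L\<^esub>p\<in>{p. p permutes {..<n}}.
        if evenperm p then (\<Otimes>\<^bsub>L\<^esub>i\<in>{..<n}. A (i, p i))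
        else \<ominus>\<^bsub>L\<^esub> (\<Otimes>\<^bsub>L\<^esub>i\<in>{..<n}. A (i, p i)))"

text \<open>
  A splitting of a finite-dimensional algebra $D$ over its center $K$: a field extension
  \<open>\<iota>: K \<rightarrow> L\<close> and a $K$-algebra homomorphism \<open>\<phi>: D \<rightarrow> M\<^sub>n(L)\<close> whose $L$-linear extension
  \<open>D \<otimes>\<^sub>K L \<rightarrow> M\<^sub>n(L)\<close> is an isomorphism.  The last condition says that a $K$-basis $B$ of $D$,
  which is an $L$-basis of \<open>D \<otimes>\<^sub>K L\<close>, is sent to an $L$-basis of \<open>M\<^sub>n(L)\<close>.
\<close>

definition splitting ::
    "('d, 'm) ring_scheme \<Rightarrow> 'l ring \<Rightarrow> ('d \<Rightarrow> 'l) \<Rightarrow> nat \<Rightarrow> ('d \<Rightarrow> nat \<times> nat \<Rightarrow> 'l) \<Rightarrow> bool" where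
  "splitting D L \<iota> n \<phi> \<longleftrightarrow>
     field L \<and>
     \<iota> \<in> ring_hom (D\<lparr>carrier := ring_center D\<rparr>) L \<and>
     \<phi> \<in> ring_hom D (mat_ring L n) \<and>
     (\<forall>z \<in> ring_center D. \<phi> z = scalar_mat L n (\<iota> z)) \<and>
     (\<exists>B. module_basis D (ring_center D) B \<and>
        (\<forall>A \<in> carrier (mat_ring L n).
           \<exists>!c. c \<in> B \<rightarrow>\<^sub>E carrier L \<and>
             A = (\<Oplus>\<^bsub>mat_ring L n\<^esub>b\<in>B. scalar_mat L n (c b) \<otimes>\<^bsub>mat_ring L n\<^esub> \<phi> b)))"

text \<open>
  The reduced norm of $a$ is the element of the center which becomes the determinant of $a$
  in a splitting; it does not depend on the splitting.  Elements of the splitting fields are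
  taken from the type of the elements of $D$: this suffices for a division ring $D$,
  which is split by each of its maximal subfields.
\<close>

definition reduced_norm :: "('d, 'm) ring_scheme \<Rightarrow> 'd \<Rightarrow> 'd" where
  "reduced_norm D a =
     (THE c. c \<in> ring_center D \<and>
        (\<exists>(L :: 'd ring) \<iota> n \<phi>. splitting D L \<iota> n \<phi> \<and> mat_det L n (\<phi> a) = \<iota> c))"

text \<open>
  The restriction to $E^*$ of the reduced norm of the quotient division ring; its values lie
  in (the image in the quotient ring of) $T$.  As the grade group is torsion-free, $E^*$, the
  unit group of $E$, consists of the nonzero homogeneous elements.
\<close>

definition Nrd :: "('a, 'm) ring_scheme \<Rightarrow> 'a \<Rightarrow> 'a" where
  "Nrd E a =
     (THE t. t \<in> ring_center E \<and>
        frac E t \<one>\<^bsub>E\<^esub> = reduced_norm (quot_ring E) (frac E a \<one>\<^bsub>E\<^esub>))"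


section \<open>Unitary graded involutions and unitary SK1\<close>

locale graded_involution = graded_ring +
  fixes \<tau> :: "'a \<Rightarrow> 'a"
  assumes inv_closed: "x \<in> carrier E \<Longrightarrow> \<tau> x \<in> carrier E"
    and inv_add: "\<lbrakk>x \<in> carrier E; y \<in> carrier E\<rbrakk> \<Longrightarrow> \<tau> (x \<oplus>\<^bsub>E\<^esub> y) = \<tau> x \<oplus>\<^bsub>E\<^esub> \<tau> y"
    and inv_mult: "\<lbrakk>x \<in> carrier E; y \<in> carrier E\<rbrakk> \<Longrightarrow> \<tau> (x \<otimes>\<^bsub>E\<^esub> y) = \<tau> y \<otimes>\<^bsub>E\<^esub> \<tau> x"
    and inv_one: "\<tau> \<one>\<^bsub>E\<^esub> = \<one>\<^bsub>E\<^esub>"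
    and inv_inv: "x \<in> carrier E \<Longrightarrow> \<tau> (\<tau> x) = x"
    and inv_graded: "\<gamma> \<in> carrier \<Gamma> \<Longrightarrow> \<tau> ` grad \<gamma> = grad \<gamma>"

locale unitary_graded_involution = graded_involution +
  assumes unitary: "\<exists>z \<in> ring_center E. \<tau> z \<noteq> z"

definition fixed_center :: "('a, 'm) ring_scheme \<Rightarrow> ('a \<Rightarrow> 'a) \<Rightarrow> 'a set" where
  "fixed_center E \<tau> = {z \<in> ring_center E. \<tau> z = z}"

text \<open>$T$ is totally ramified over $R = T^\tau$: $|\Gamma_T : \Gamma_R| = 2$.\<close>

definition center_totally_ramified ::
    "('a, 'm) ring_scheme \<Rightarrow> ('g, 'n) monoid_scheme \<Rightarrow> ('g \<Rightarrow> 'a set) \<Rightarrow> ('a \<Rightarrow> 'a) \<Rightarrow> bool" where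
  "center_totally_ramified E \<Gamma> grad \<tau> \<longleftrightarrow>
     card (rcosets\<^bsub>\<Gamma>\<lparr>carrier := grade_set E \<Gamma> grad (ring_center E)\<rparr>\<^esub>
             (grade_set E \<Gamma> grad (fixed_center E \<tau>))) = 2"

definition Sigma_unitary :: "('a, 'm) ring_scheme \<Rightarrow> ('a \<Rightarrow> 'a) \<Rightarrow> 'a set" where
  "Sigma_unitary E \<tau> = generate (units_of E) {a \<in> Units E. \<tau> a = a}"

definition Sigma'_unitary :: "('a, 'm) ring_scheme \<Rightarrow> ('a \<Rightarrow> 'a) \<Rightarrow> 'a set" where
  "Sigma'_unitary E \<tau> = {a \<in> Units E. Nrd E a \<in> Units (E\<lparr>carrier := fixed_center E \<tau>\<rparr>)}"

definition SK1_unitary :: "('a, 'm) ring_scheme \<Rightarrow> ('a \<Rightarrow> 'a) \<Rightarrow> 'a set monoid" where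
  "SK1_unitary E \<tau> =
     (units_of E)\<lparr>carrier := Sigma'_unitary E \<tau>\<rparr> Mod Sigma_unitary E \<tau>"

end

theory Submission
  imports Defs
begin

text \<open>Total ramification provides a homogeneous \<open>t \<in> T\<close> with \<open>\<tau> t = - t\<close> and forces
  \<open>\<tau> = id\<close> on \<open>T\<^sub>0\<close>. Hence \<open>a \<in> E\<^sub>0\<close> and \<open>\<tau> a\<close> have the same minimal polynomial over
  \<open>T\<^sub>0\<close>, and a Skolem--Noether argument gives a homogeneous \<open>x \<noteq> 0\<close> with \<open>\<tau> a x = x a\<close>, which
  can be taken symmetric or skew. Then \<open>x a\<close> is of the same type as \<open>x\<close>, and \<open>t\<close> turns skew
  elements into symmetric ones, so \<open>a \<in> \<Sigma>\<close>. All homogeneous elements reduce to degree zero up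
  to \<open>t\<close>, and \<open>t \<in> \<Sigma>\<close> because \<open>E\<close> is not commutative.

  The unitary \<open>SK\<^sub>1\<close> is then a set of cosets of \<open>E\<^sup>*\<close> and it remains to see that it is nonempty,
  which needs \<open>Nrd 1 = 1\<close>. As the reduced norm is defined by a definite description, this in turn
  needs a splitting of the quotient division ring to exist at all; a maximal subfield provides
  one.\<close>

section \<open>Linear relations over subfields\<close>

text \<open>Characteristic 2 is not excluded in advance. Index two leaves a degree of T in which R
  is zero; there z + \<tau> z, being fixed, vanishes, so \<tau> acts as -1, and -1 differs from 1
  since otherwise that degree would occur in R. Multiplying T_0 into this degree carries the sign
  over and leaves \<tau> trivial on T_0. The center of E_0 may be larger than T_0, and equal minimal
  polynomials over T_0 do not make a and \<tau> a conjugate inside E_0. The intertwiner is therefore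
  sought among homogeneous elements of all degrees: the elements of E_0 that commute with every
  homogeneous unit are exactly those of T_0, and a minimal relation argument can use this. If x
  intertwines, so does \<tau> x, hence also x + \<tau> x and x - \<tau> x, which are not both zero.
  Dividing a homogeneous x by the symmetric element x + \<tau> x of the same degree, if that is
  nonzero, leads to degree zero. That units are homogeneous comes from a translation invariant order
  on the torsion-free grade group; the same order excludes zero divisors, on which the fractions
  rest.\<close>

lemma (in ring) subfield_of_commuting_invertible:
  assumes K: "subring K R"
    and comm: "\<And>x y. \<lbrakk>x \<in> K; y \<in> K\<rbrakk> \<Longrightarrow> x \<otimes> y = y \<otimes> x"
    and inv: "\<And>x. \<lbrakk>x \<in> K; x \<noteq> \<zero>\<rbrakk> \<Longrightarrow> x \<in> Units R \<and> inv x \<in> K"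
    and one: "\<one> \<noteq> \<zero>"
  shows "subfield K R"
proof (rule subfieldI)
  show "subcring K R"
    using K comm by (rule subcringI)
  note KE = subringE[OF K]
  show "Units (R\<lparr>carrier := K\<rparr>) = K - {\<zero>}"
  proof (intro equalityI subsetI)
    fix k assume "k \<in> Units (R\<lparr>carrier := K\<rparr>)"
    then obtain k' where k: "k \<in> K" "k' \<in> K" "k \<otimes> k' = \<one>"
      unfolding Units_def by auto
    have "k \<noteq> \<zero>"
    proof
      assume "k = \<zero>"
      then have "\<zero> = \<one>" using k KE(1) by auto
      then show False using one by simp
    qed
    then show "k \<in> K - {\<zero>}" using k by simp
  next
    fix k assume "k \<in> K - {\<zero>}"
    then have "k \<in> K" "k \<in> Units R" "inv k \<in> K" using inv by auto
    then show "k \<in> Units (R\<lparr>carrier := K\<rparr>)"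
      unfolding Units_def[of "R\<lparr>carrier := K\<rparr>"] using Units_l_inv Units_r_inv by (auto intro!: bexI[of _ "inv k"])
  qed
qed

text \<open>Linear algebra over a subfield is phrased with lists and the recursive
  \<open>combine\<close>, while \<open>module_basis\<close> uses indexed sums. This lemma and the
  next two translate between the two styles.\<close>

lemma (in ring) combine_eq_finsum:
  assumes "length Ks = length Us" "set Ks \<subseteq> carrier R" "set Us \<subseteq> carrier R"
  shows "combine Ks Us = (\<Oplus>i\<in>{..<length Us}. Ks ! i \<otimes> Us ! i)"
  using assms
proof (induction Ks Us rule: list_induct2)
  case Nil
  then show ?case by simp
next
  case (Cons k Ks u Us)
  let ?f = "\<lambda>i. (k # Ks) ! i \<otimes> (u # Us) ! i"
  have mem: "Ks ! i \<in> carrier R" "Us ! i \<in> carrier R" if "i < length Us" for i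
    using that Cons.hyps Cons.prems by (auto simp: subset_eq)
  have "(\<Oplus>i\<in>{..<length (u # Us)}. ?f i) = (\<Oplus>i\<in>insert 0 (Suc ` {..<length Us}). ?f i)"
    by (simp add: lessThan_Suc_eq_insert_0)
  also have "\<dots> = ?f 0 \<oplus> (\<Oplus>i\<in>Suc ` {..<length Us}. ?f i)"
    using Cons.prems mem by (subst finsum_insert) auto
  also have "(\<Oplus>i\<in>Suc ` {..<length Us}. ?f i) = (\<Oplus>i\<in>{..<length Us}. ?f (Suc i))"
    using Cons.prems mem by (subst finsum_reindex) auto
  finally show ?case using Cons by simp
qed

lemma (in ring) Span_eq_finsum:
  assumes K: "subfield K R" and Us: "set Us \<subseteq> carrier R"
  shows "x \<in> Span K Us \<longleftrightarrow>
    (\<exists>c. c \<in> {..<length Us} \<rightarrow>\<^sub>E K \<and> x = (\<Oplus>i\<in>{..<length Us}. c i \<otimes> Us ! i))"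
    (is "_ \<longleftrightarrow> ?R")
proof
  note KE = subringE[OF subfieldE(1)[OF K]]
  assume "x \<in> Span K Us"
  then obtain Ks where Ks: "set Ks \<subseteq> K" "length Ks = length Us" "x = combine Ks Us"
    using Span_mem_iff_length_version[OF K Us] by blast
  have "x = (\<Oplus>i\<in>{..<length Us}. Ks ! i \<otimes> Us ! i)"
    using combine_eq_finsum Ks Us KE(1) by auto
  also have "\<dots> = (\<Oplus>i\<in>{..<length Us}. restrict (\<lambda>i. Ks ! i) {..<length Us} i \<otimes> Us ! i)"
    using Ks Us KE(1) by (intro finsum_cong') (auto simp: subset_eq)
  finally show ?R
    using Ks by (intro exI[of _ "restrict (\<lambda>i. Ks ! i) {..<length Us}"]) (auto simp: subset_eq)
next
  note KE = subringE[OF subfieldE(1)[OF K]]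
  assume ?R
  then obtain c where c: "c \<in> {..<length Us} \<rightarrow>\<^sub>E K" "x = (\<Oplus>i\<in>{..<length Us}. c i \<otimes> Us ! i)"
    by blast
  let ?Ks = "map c [0..<length Us]"
  have cK: "c i \<in> K" if "i < length Us" for i using PiE_mem[OF c(1), of i] that by blast
  then have Ks: "set ?Ks \<subseteq> K" "length ?Ks = length Us" by (auto simp: image_subset_iff)
  have "combine ?Ks Us = (\<Oplus>i\<in>{..<length Us}. ?Ks ! i \<otimes> Us ! i)"
    using combine_eq_finsum Ks Us KE(1) by blast
  also have "\<dots> = x"
    unfolding c(2) using cK Us KE(1) by (intro finsum_cong') (auto simp: subset_eq)
  finally show "x \<in> Span K Us"
    using Span_mem_iff_length_version[OF K Us] Ks by metis
qed

lemma (in ring) independent_coeffs_zero: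
  assumes K: "subfield K R" and "independent K Us"
    and c: "c \<in> {..<length Us} \<rightarrow> K" and "(\<Oplus>i\<in>{..<length Us}. c i \<otimes> Us ! i) = \<zero>"
    and "i < length Us"
  shows "c i = \<zero>"
proof -
  note KE = subringE[OF subfieldE(1)[OF K]]
  have Us: "set Us \<subseteq> carrier R" using assms(2) by (rule independent_in_carrier)
  let ?Ks = "map c [0..<length Us]"
  have Ks: "set ?Ks \<subseteq> K" "length ?Ks = length Us" using c by auto
  have "combine ?Ks Us = (\<Oplus>i\<in>{..<length Us}. ?Ks ! i \<otimes> Us ! i)"
    using combine_eq_finsum Ks Us KE(1) by blast
  also have "\<dots> = (\<Oplus>i\<in>{..<length Us}. c i \<otimes> Us ! i)"
    using c Us KE(1) by (intro finsum_cong') (auto simp: subset_eq Pi_iff)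
  finally have "set (take (length Us) ?Ks) \<subseteq> {\<zero>}"
    using independent_imp_trivial_combine[OF K assms(2) Ks(1)] assms(4) by simp
  then show ?thesis using assms(5) by (auto simp: subset_eq)
qed

text \<open>One more power of x than the dimension of the span forces a dependence. It is cut off at
  its last nonzero coefficient, so that \<open>N\<close> is the true degree of the relation; users
  then pass to the least such \<open>N\<close> and have a minimal polynomial in hand.\<close>

lemma (in ring) exists_power_relation:
  assumes K: "subfield K R" and Vs: "set Vs \<subseteq> carrier R" and x: "x \<in> carrier R"
    and pow: "\<And>i::nat. x [^] i \<in> Span K Vs"
  shows "\<exists>N c. c \<in> UNIV \<rightarrow> K \<and> c N \<noteq> \<zero> \<and> (\<Oplus>i\<in>{..N::nat}. c i \<otimes> x [^] i) = \<zero>"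
proof -
  note KE = subringE[OF subfieldE(1)[OF K]]
  obtain Ws where Ws: "independent K Ws" "Span K Ws = Span K Vs"
    using filter_base[OF K Vs] by metis
  define m where "m = Suc (length Ws)"
  define Us where "Us = map (\<lambda>i::nat. x [^] i) [0..<m]"
  have Us: "set Us \<subseteq> carrier R" "set Us \<subseteq> Span K Ws" "length Us = m"
    using x pow Ws by (auto simp: Us_def)
  then have "dependent K Us"
    using independent_length_le[OF K _ Ws(1), of Us] by (auto simp: m_def)
  then obtain Ks where Ks: "length Ks = m" "combine Ks Us = \<zero>" "set Ks \<subseteq> K" "set Ks \<noteq> {\<zero>}"
    using dependent_imp_non_trivial_combine[OF K Us(1)] Us(3) by metis
  have "Ks \<noteq> []" using Ks(1) by (auto simp: m_def)
  then have "\<exists>k\<in>set Ks. k \<noteq> \<zero>" using Ks(4) by (cases Ks) auto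
  then obtain j where j: "j < m" "Ks ! j \<noteq> \<zero>"
    using Ks(1) by (metis in_set_conv_nth)
  define c where "c i = (if i < m then Ks ! i else \<zero>)" for i
  have "c i \<in> K" for i using Ks(1,3) KE(2) by (auto simp: c_def subset_eq)
  then have c: "c \<in> UNIV \<rightarrow> K" by simp
  then have cc: "c i \<in> carrier R" for i using KE(1) by auto
  define N where "N = (GREATEST i. c i \<noteq> \<zero>)"
  have bound: "c i \<noteq> \<zero> \<Longrightarrow> i \<le> m" for i by (auto simp: c_def split: if_splits)
  have "c j \<noteq> \<zero>" using j by (simp add: c_def)
  then have N: "c N \<noteq> \<zero>" unfolding N_def by (rule GreatestI_nat) (use bound in blast)
  have N': "c i = \<zero>" if "i > N" for i
    using Greatest_le_nat[of "\<lambda>i. c i \<noteq> \<zero>" i m] bound that unfolding N_def by force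
  have "\<zero> = (\<Oplus>i\<in>{..<m}. Ks ! i \<otimes> Us ! i)"
    using combine_eq_finsum[of Ks Us] Ks Us KE(1) by auto
  also have "\<dots> = (\<Oplus>i\<in>{..<m}. c i \<otimes> x [^] i)"
  proof (intro finsum_cong')
    show "(\<lambda>i. c i \<otimes> x [^] i) \<in> {..<m} \<rightarrow> carrier R" using cc x by simp
  qed (simp_all add: c_def Us_def)
  also have "\<dots> = (\<Oplus>i\<in>{..N}. c i \<otimes> x [^] i)"
  proof (rule add.finprod_mono_neutral_cong_right)
    show "{..N} \<subseteq> {..<m}" using N by (auto simp: c_def split: if_splits)
  qed (use N' x cc in auto)
  finally show ?thesis using N c by metis
qed

text \<open>The classical argument with a relation of minimal length.\<close>

lemma (in ring) left_coeffs_zero_of_identity: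
  assumes S: "subring S R" and S_inv: "\<And>v. \<lbrakk>v \<in> S; v \<noteq> \<zero>\<rbrakk> \<Longrightarrow> v \<in> Units R \<and> inv v \<in> S"
    and Y: "Y \<subseteq> Units R" "\<one> \<in> Y" "\<And>x y. \<lbrakk>x \<in> Y; y \<in> Y\<rbrakk> \<Longrightarrow> x \<otimes> y \<in> Y"
    and conj: "\<And>v y. \<lbrakk>v \<in> S; y \<in> Y\<rbrakk> \<Longrightarrow> inv y \<otimes> v \<otimes> y \<in> S"
    and fin: "finite I" and u: "u \<in> I \<rightarrow> carrier R"
    and indep: "\<And>w. \<lbrakk>w \<in> I \<rightarrow> S; \<And>i y. \<lbrakk>i \<in> I; y \<in> Y\<rbrakk> \<Longrightarrow> w i \<otimes> y = y \<otimes> w i;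
        (\<Oplus>i\<in>I. w i \<otimes> u i) = \<zero>\<rbrakk> \<Longrightarrow> \<forall>i\<in>I. w i = \<zero>"
    and "v \<in> I \<rightarrow> S" and "\<And>x. x \<in> Y \<Longrightarrow> (\<Oplus>i\<in>I. v i \<otimes> x \<otimes> u i) = \<zero>"
  shows "\<forall>i\<in>I. v i = \<zero>"
  using assms(10,11)
proof (induction "card {i \<in> I. v i \<noteq> \<zero>}" arbitrary: v rule: less_induct)
  case less
  note SE = subringE[OF S]
  have uc [simp]: "u i \<in> carrier R" if "i \<in> I" for i using u that by auto
  have Yc [simp]: "y \<in> carrier R" "inv y \<in> carrier R" if "y \<in> Y" for y using Y(1) that by auto
  show ?case
  proof (rule ccontr)
    assume "\<not> ?case"
    then obtain j where j: "j \<in> I" "v j \<noteq> \<zero>" by auto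
    have vS: "v i \<in> S" if "i \<in> I" for i using less.prems that by auto
    have vj: "v j \<in> Units R" "inv (v j) \<in> S" using S_inv j vS by auto
    have vjc [simp]: "inv (v j) \<in> carrier R" using vj by simp
    have vc [simp]: "v i \<in> carrier R" if "i \<in> I" for i using vS that SE(1) by auto
    \<comment> \<open>With the coefficient at j normalised to 1, conjugating the relation does not
      change that coefficient, so a difference of two conjugates is strictly shorter.\<close>
    define w where "w i = inv (v j) \<otimes> v i" for i
    have wS: "w i \<in> S" if "i \<in> I" for i using vj vS that SE(6) by (auto simp: w_def)
    have wc [simp]: "w i \<in> carrier R" if "i \<in> I" for i using wS that SE(1) by auto
    have wj: "w j = \<one>" using vj by (simp add: w_def)
    have w0: "(\<Oplus>i\<in>I. w i \<otimes> x \<otimes> u i) = \<zero>" if x: "x \<in> Y" for x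
    proof -
      have "inv (v j) \<otimes> (\<Oplus>i\<in>I. v i \<otimes> x \<otimes> u i) = (\<Oplus>i\<in>I. inv (v j) \<otimes> (v i \<otimes> x \<otimes> u i))"
        using fin x by (intro finsum_rdistr) auto
      also have "\<dots> = (\<Oplus>i\<in>I. w i \<otimes> x \<otimes> u i)"
        using x by (intro finsum_cong') (auto simp: w_def m_assoc)
      finally show ?thesis using less.prems(2)[OF x] by simp
    qed
    have comm: "w i \<otimes> y = y \<otimes> w i" if i: "i \<in> I" and y: "y \<in> Y" for i y
    proof -
      \<comment> \<open>These are the coefficients obtained from the identity at x by subtracting
        \<open>inv y\<close> times the identity at \<open>y \<otimes> x\<close>. They stay in
        \<open>S\<close> by \<open>conj\<close>, vanish wherever v does, and vanish at j
        too.\<close>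
      define d where "d i = w i \<ominus> inv y \<otimes> w i \<otimes> y" for i
      have yU: "y \<in> Units R" using y Y by auto
      have dS: "d \<in> I \<rightarrow> S"
        using wS conj[OF _ y] SE(5,7) by (auto simp: d_def minus_eq)
      have dj: "d j = \<zero>" using yU y by (simp add: d_def wj r_neg minus_eq)
      have "{i \<in> I. d i \<noteq> \<zero>} \<subset> {i \<in> I. v i \<noteq> \<zero>}"
      proof (intro psubsetI subsetI)
        fix k assume "k \<in> {i \<in> I. d i \<noteq> \<zero>}"
        moreover have "v k = \<zero> \<Longrightarrow> d k = \<zero>" using y by (simp add: d_def w_def minus_eq)
        ultimately show "k \<in> {i \<in> I. v i \<noteq> \<zero>}" by auto
      next
        show "{i \<in> I. d i \<noteq> \<zero>} \<noteq> {i \<in> I. v i \<noteq> \<zero>}" using j dj by auto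
      qed
      then have card: "card {i \<in> I. d i \<noteq> \<zero>} < card {i \<in> I. v i \<noteq> \<zero>}"
        using fin by (intro psubset_card_mono) auto
      have d0: "(\<Oplus>i\<in>I. d i \<otimes> x \<otimes> u i) = \<zero>" if x: "x \<in> Y" for x
      proof -
        have yx: "y \<otimes> x \<in> Y" using Y(3) x y by auto
        have "(\<Oplus>i\<in>I. w i \<otimes> x \<otimes> u i) \<oplus> (\<ominus> (inv y)) \<otimes> (\<Oplus>i\<in>I. w i \<otimes> (y \<otimes> x) \<otimes> u i)
          = (\<Oplus>i\<in>I. w i \<otimes> x \<otimes> u i) \<oplus> (\<Oplus>i\<in>I. (\<ominus> (inv y)) \<otimes> (w i \<otimes> (y \<otimes> x) \<otimes> u i))"
          using fin x y by (subst finsum_rdistr) auto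
        also have "\<dots> = (\<Oplus>i\<in>I. w i \<otimes> x \<otimes> u i \<oplus> (\<ominus> (inv y)) \<otimes> (w i \<otimes> (y \<otimes> x) \<otimes> u i))"
          using x y by (subst finsum_addf) auto
        also have "\<dots> = (\<Oplus>i\<in>I. d i \<otimes> x \<otimes> u i)"
        proof (intro finsum_cong')
          fix i assume i: "i \<in> I"
          show "w i \<otimes> x \<otimes> u i \<oplus> (\<ominus> (inv y)) \<otimes> (w i \<otimes> (y \<otimes> x) \<otimes> u i) = d i \<otimes> x \<otimes> u i"
            using i x y by (simp add: d_def minus_eq l_distr l_minus m_assoc)
        next
          show "(\<lambda>i. d i \<otimes> x \<otimes> u i) \<in> I \<rightarrow> carrier R"
            using dS SE(1) x by (auto simp: Pi_iff subset_eq)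
        qed simp
        finally show ?thesis using w0[OF x] w0[OF yx] y by simp
      qed
      have "d i = \<zero>" using less.hyps[OF card dS d0] i by auto
      then have "w i = inv y \<otimes> w i \<otimes> y"
        using i y by (simp add: d_def)
      then have "y \<otimes> w i = y \<otimes> (inv y \<otimes> w i \<otimes> y)" by simp
      also have "\<dots> = (y \<otimes> inv y) \<otimes> w i \<otimes> y" using i y by (simp only: m_assoc wc Yc m_closed)
      finally show ?thesis using yU i y by simp
    qed
    \<comment> \<open>The identity at x = 1 is a relation among the u i whose coefficients commute
      with all of \<open>Y\<close>. By \<open>indep\<close> it is trivial, although its coefficient
      at j is 1.\<close>
    have "(\<Oplus>i\<in>I. w i \<otimes> u i) = (\<Oplus>i\<in>I. w i \<otimes> \<one> \<otimes> u i)"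
      by (intro finsum_cong') auto
    then have sum0: "(\<Oplus>i\<in>I. w i \<otimes> u i) = \<zero>" using w0[OF Y(2)] by simp
    have "w \<in> I \<rightarrow> S" using wS by blast
    from indep[OF this comm sum0] have "w j = \<zero>" using j by blast
    then have "v j \<otimes> \<one> = v j \<otimes> \<zero>" using wj by simp
    then show False using j by simp
  qed
qed

section \<open>Torsion-free abelian groups are orderable\<close>

text \<open>The set of elements above the identity in a translation invariant partial order, written
  multiplicatively. The order itself is never introduced; a \<le> m is expressed by
  \<open>m \<otimes> inv a \<in> P\<close>.\<close>

definition pointed_cone :: "('g, 'n) monoid_scheme \<Rightarrow> 'g set \<Rightarrow> bool" where
  "pointed_cone G P \<longleftrightarrow> P \<subseteq> carrier G \<and> \<one>\<^bsub>G\<^esub> \<in> P \<and> (\<forall>x\<in>P. \<forall>y\<in>P. x \<otimes>\<^bsub>G\<^esub> y \<in> P)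
    \<and> (\<forall>x\<in>P. inv\<^bsub>G\<^esub> x \<in> P \<longrightarrow> x = \<one>\<^bsub>G\<^esub>)"

text \<open>Adjoining g and its powers to \<open>P\<close> gives a larger submonoid, which by
  maximality cannot be pointed. An element x = p g^k other than 1 whose inverse q g^l also lies in
  it yields g^-(k+l) = p q in \<open>P\<close>.\<close>

lemma (in comm_group) inv_power_mem_maximal_cone:
  assumes P: "pointed_cone G P" and max: "\<And>Q. \<lbrakk>pointed_cone G Q; P \<subseteq> Q\<rbrakk> \<Longrightarrow> Q = P"
    and g: "g \<in> carrier G" "g \<notin> P"
  shows "\<exists>n>0. inv g [^] (n::nat) \<in> P"
proof -
  note PD = P[unfolded pointed_cone_def]
  have Pc [simp]: "p \<in> carrier G" if "p \<in> P" for p using PD that by auto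
  define Q where "Q = {p \<otimes> g [^] (k::nat) | p k. p \<in> P}"
  have QI: "p \<otimes> g [^] (k::nat) \<in> Q" if "p \<in> P" for p k using that by (auto simp: Q_def)
  have PQ: "P \<subseteq> Q"
  proof
    fix p assume "p \<in> P"
    then show "p \<in> Q" using QI[of p 0] by simp
  qed
  have "g \<in> Q" using QI[of \<one> 1] PD g by simp
  then have "\<not> pointed_cone G Q" using max PQ g by blast
  moreover have "Q \<subseteq> carrier G" using g by (auto simp: Q_def)
  moreover have "\<one> \<in> Q" using PQ PD by auto
  moreover have "x \<otimes> y \<in> Q" if "x \<in> Q" "y \<in> Q" for x y
  proof -
    from that obtain p k q l where x: "p \<in> P" "x = p \<otimes> g [^] (k::nat)"
      and y: "q \<in> P" "y = q \<otimes> g [^] (l::nat)" by (auto simp: Q_def)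
    have "x \<otimes> y = (p \<otimes> q) \<otimes> g [^] (k + l)"
      using x y g by (simp add: nat_pow_mult[symmetric] m_ac)
    then show ?thesis using QI x y PD by auto
  qed
  ultimately obtain x where x: "x \<in> Q" "inv x \<in> Q" "x \<noteq> \<one>"
    unfolding pointed_cone_def by blast
  obtain p k q l where p: "p \<in> P" "x = p \<otimes> g [^] (k::nat)"
    and q: "q \<in> P" "inv x = q \<otimes> g [^] (l::nat)" using x by (auto simp: Q_def)
  have xc: "x \<in> carrier G" using p g by simp
  \<comment> \<open>For k = l = 0 the element x and its inverse would both lie in \<open>P\<close>
    itself, which is pointed.\<close>
  have "k + l \<noteq> 0"
  proof
    assume "k + l = 0"
    then have "x = p" "inv x = q" using p q by auto
    then show False using p q x PD by auto
  qed
  moreover have "inv g [^] (k + l) = p \<otimes> q"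
  proof -
    have "\<one> = x \<otimes> inv x" using xc by simp
    also have "\<dots> = p \<otimes> q \<otimes> g [^] (k + l)"
      using p(1) q g by (simp add: p(2) nat_pow_mult[symmetric] m_ac)
    finally have "p \<otimes> q = inv (g [^] (k + l))"
      using p q g by (metis (full_types) Pc inv_equality m_closed nat_pow_closed)
    then show ?thesis using g by (simp add: nat_pow_inv)
  qed
  ultimately show ?thesis using p q PD by (intro exI[of _ "k + l"]) auto
qed

text \<open>A maximal cone exists by Zorn. If it missed both g and its inverse, a positive power of
  each would lie in it; passing to a common exponent, that power of g is 1, and torsion-freeness
  gives g = 1.\<close>

lemma (in comm_group) exists_total_cone:
  assumes tf: "\<And>x k. \<lbrakk>x \<in> carrier G; 0 < (k::nat); x [^] k = \<one>\<rbrakk> \<Longrightarrow> x = \<one>"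
  shows "\<exists>P. pointed_cone G P \<and> (\<forall>g\<in>carrier G. g \<in> P \<or> inv g \<in> P)"
proof -
  define \<A> where "\<A> = Collect (pointed_cone G)"
  have "\<exists>M\<in>\<A>. (\<forall>Q\<in>\<A>. M \<subseteq> Q \<longrightarrow> Q = M)"
  proof (rule subset_Zorn_nonempty)
    show "\<A> \<noteq> {}"
      by (auto simp: \<A>_def pointed_cone_def intro!: exI[of _ "{\<one>}"])
  next
    fix \<C> assume ne: "\<C> \<noteq> {}" and ch: "subset.chain \<A> \<C>"
    have C: "pointed_cone G U" if "U \<in> \<C>" for U using ch that by (auto simp: \<A>_def subset_chain_def)
    have tot: "U \<subseteq> Y \<or> Y \<subseteq> U" if "U \<in> \<C>" "Y \<in> \<C>" for U Y
      using ch that by (auto simp: \<A>_def subset_chain_def)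
    have two: "\<exists>Z\<in>\<C>. x \<in> Z \<and> y \<in> Z" if "x \<in> \<Union>\<C>" "y \<in> \<Union>\<C>" for x y
      using that tot by (metis UnionE subsetD)
    have "\<Union>\<C> \<subseteq> carrier G" using C by (meson Union_least pointed_cone_def)
    moreover have "\<one> \<in> \<Union>\<C>" using ne C by (auto simp: pointed_cone_def)
    moreover have "x \<otimes> y \<in> \<Union>\<C>" if "x \<in> \<Union>\<C>" "y \<in> \<Union>\<C>" for x y
      using two[OF that] C by (auto simp: pointed_cone_def)
    moreover have "x = \<one>" if "x \<in> \<Union>\<C>" "inv x \<in> \<Union>\<C>" for x
      using two[OF that] C by (auto simp: pointed_cone_def)
    ultimately show "\<Union>\<C> \<in> \<A>"
      unfolding \<A>_def pointed_cone_def mem_Collect_eq by blast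
  qed
  then obtain P where P: "pointed_cone G P"
    and max: "\<And>Q. \<lbrakk>pointed_cone G Q; P \<subseteq> Q\<rbrakk> \<Longrightarrow> Q = P" by (auto simp: \<A>_def)
  note PD = P[unfolded pointed_cone_def]
  have pow: "p [^] (k::nat) \<in> P" if "p \<in> P" for p k
    using that PD by (induction k) auto
  have "g \<in> P \<or> inv g \<in> P" if g: "g \<in> carrier G" for g
  proof (rule ccontr)
    assume "\<not> ?thesis"
    then have "g \<notin> P" "inv g \<notin> P" by auto
    then obtain n m :: nat where nm: "n > 0" "inv g [^] n \<in> P" "m > 0" "inv (inv g) [^] m \<in> P"
      using inv_power_mem_maximal_cone[OF P max] g by (metis inv_closed)
    have 1: "g [^] (m * n) \<in> P" using pow[OF nm(4), of n] g by (simp add: nat_pow_pow)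
    have 2: "inv g [^] (n * m) \<in> P" using pow[OF nm(2), of m] g by (simp add: nat_pow_pow)
    have "inv (g [^] (m * n)) \<in> P" using 2 g by (simp add: nat_pow_inv mult.commute)
    then have "g [^] (m * n) = \<one>" using 1 PD by blast
    then have "g = \<one>" using tf[OF g, of "m * n"] nm by simp
    then show False using \<open>g \<notin> P\<close> PD by simp
  qed
  then show ?thesis using P by blast
qed

text \<open>The total order attached to \<open>P\<close> gives every finite nonempty set a greatest
  element; applied to the opposite cone the same lemma gives a least one.\<close>

lemma (in comm_group) finite_set_has_extremal:
  assumes P: "pointed_cone G P" "\<And>g. g \<in> carrier G \<Longrightarrow> g \<in> P \<or> inv g \<in> P"
    and "finite A" "A \<noteq> {}" "A \<subseteq> carrier G"
  shows "\<exists>m\<in>A. \<forall>a\<in>A. m \<otimes> inv a \<in> P"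
  using assms(3-5)
proof (induction rule: finite_ne_induct)
  case (singleton x)
  then show ?case using P(1) by (auto simp: pointed_cone_def)
next
  case (insert x F)
  note PD = P(1)[unfolded pointed_cone_def]
  from insert obtain m where m: "m \<in> F" "\<And>a. a \<in> F \<Longrightarrow> m \<otimes> inv a \<in> P" by auto
  have c: "x \<in> carrier G" "m \<in> carrier G" "F \<subseteq> carrier G" using insert m by auto
  show ?case
  proof (cases "m \<otimes> inv x \<in> P")
    case True
    then show ?thesis using m by auto
  next
    case False
    then have "inv (m \<otimes> inv x) \<in> P" using P(2)[of "m \<otimes> inv x"] c by auto
    then have xm: "x \<otimes> inv m \<in> P" using c by (simp add: inv_mult m_comm)
    have "x \<otimes> inv a \<in> P" if a: "a \<in> F" for a
    proof -
      have ac: "a \<in> carrier G" using a c by auto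
      have "x \<otimes> inv a = (x \<otimes> inv m) \<otimes> (m \<otimes> inv a)"
        using c ac by (metis inv_closed inv_solve_left m_assoc m_closed)
      then show ?thesis using PD xm m(2)[OF a] by auto
    qed
    moreover have "x \<otimes> inv x \<in> P" using c PD by simp
    ultimately show ?thesis by auto
  qed
qed

text \<open>The two pairs consist of the greatest elements and of the least elements of
  \<open>A\<close> and \<open>B\<close>. They can share their first entry only if greatest and least
  element of \<open>A\<close> coincide, which makes \<open>A\<close> a singleton.\<close>

lemma (in comm_group) two_unique_products:
  assumes tf: "\<And>x k. \<lbrakk>x \<in> carrier G; 0 < (k::nat); x [^] k = \<one>\<rbrakk> \<Longrightarrow> x = \<one>"
    and A: "finite A" "A \<noteq> {}" "A \<subseteq> carrier G" and B: "finite B" "B \<noteq> {}" "B \<subseteq> carrier G"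
  obtains a b a' b' where "a \<in> A" "b \<in> B" "a' \<in> A" "b' \<in> B"
    "\<And>x y. \<lbrakk>x \<in> A; y \<in> B; x \<otimes> y = a \<otimes> b\<rbrakk> \<Longrightarrow> x = a \<and> y = b"
    "\<And>x y. \<lbrakk>x \<in> A; y \<in> B; x \<otimes> y = a' \<otimes> b'\<rbrakk> \<Longrightarrow> x = a' \<and> y = b'"
    "a = a' \<Longrightarrow> A = {a}"
proof -
  obtain P where P: "pointed_cone G P" and tot: "\<And>g. g \<in> carrier G \<Longrightarrow> g \<in> P \<or> inv g \<in> P"
    using exists_total_cone tf by blast
  note PD = P[unfolded pointed_cone_def]
  \<comment> \<open>The cone of the opposite order.\<close>
  define P' where "P' = {x \<in> carrier G. inv x \<in> P}"
  have P': "pointed_cone G P'"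
    unfolding pointed_cone_def
  proof (intro conjI ballI impI)
    fix x y assume "x \<in> P'" "y \<in> P'"
    then show "x \<otimes> y \<in> P'" using PD by (auto simp: P'_def inv_mult)
  next
    fix x assume "x \<in> P'" "inv x \<in> P'"
    then have "inv x \<in> P" "x \<in> P" "x \<in> carrier G" by (auto simp: P'_def)
    then show "x = \<one>" using PD by auto
  qed (use PD in \<open>auto simp: P'_def\<close>)
  have tot': "g \<in> P' \<or> inv g \<in> P'" if "g \<in> carrier G" for g
    using tot that by (auto simp: P'_def)
  \<comment> \<open>From x \<le> a, y \<le> b and xy = ab the quotients a/x and b/y are mutually
    inverse elements of the cone, hence both equal to 1.\<close>
  have uniq: "x = a \<and> y = b"
    if Q: "pointed_cone G Q" and "x \<in> carrier G" "y \<in> carrier G" "a \<in> carrier G" "b \<in> carrier G"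
      "a \<otimes> inv x \<in> Q" "b \<otimes> inv y \<in> Q" "x \<otimes> y = a \<otimes> b" for Q x y a b
  proof -
    have "(a \<otimes> inv x) \<otimes> (b \<otimes> inv y) = (a \<otimes> b) \<otimes> inv (x \<otimes> y)"
      using that(2-7) by (simp add: inv_mult m_ac)
    also have "\<dots> = \<one>" using that(2,3,8) by (metis m_closed r_inv)
    finally have one: "(a \<otimes> inv x) \<otimes> (b \<otimes> inv y) = \<one>" .
    then have "inv (b \<otimes> inv y) = a \<otimes> inv x"
      using that by (intro inv_equality) auto
    then have "b \<otimes> inv y = \<one>" using Q that by (auto simp: pointed_cone_def)
    moreover from this have "a \<otimes> inv x = \<one>" using one that by simp
    ultimately show ?thesis
      using that by (metis inv_closed inv_equality inv_inv)
  qed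
  obtain a b a' b' where ab: "a \<in> A" "b \<in> B" "a' \<in> A" "b' \<in> B"
    "\<forall>x\<in>A. a \<otimes> inv x \<in> P" "\<forall>x\<in>B. b \<otimes> inv x \<in> P"
    "\<forall>x\<in>A. a' \<otimes> inv x \<in> P'" "\<forall>x\<in>B. b' \<otimes> inv x \<in> P'"
    using finite_set_has_extremal[OF P tot A] finite_set_has_extremal[OF P tot B]
      finite_set_has_extremal[OF P' tot' A] finite_set_has_extremal[OF P' tot' B] by metis
  show ?thesis
  proof (rule that[OF ab(1-4)])
    fix x y assume "x \<in> A" "y \<in> B" "x \<otimes> y = a \<otimes> b"
    then show "x = a \<and> y = b" using uniq[OF P, of x y a b] ab(1,2,5,6) A(3) B(3) by (meson subsetD)
  next
    fix x y assume "x \<in> A" "y \<in> B" "x \<otimes> y = a' \<otimes> b'"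
    then show "x = a' \<and> y = b'" using uniq[OF P', of x y a' b'] ab(3,4,7,8) A(3) B(3) by (meson subsetD)
  next
    assume "a = a'"
    have "x = a" if x: "x \<in> A" for x
    proof -
      have c: "x \<in> carrier G" "a \<in> carrier G" using x ab A by auto
      have "a \<otimes> inv x \<in> P" "inv (a \<otimes> inv x) \<in> P"
        using ab(5,7) x \<open>a = a'\<close> by (auto simp: P'_def)
      then have "a \<otimes> inv x = \<one>" using PD by blast
      then show ?thesis using inv_equality[of a "inv x"] c by simp
    qed
    then show "A = {a}" using ab(1) by blast
  qed
qed

section \<open>Homogeneous components\<close>

lemma (in ring) finsum_only_nonzero:
  assumes "finite A" "a \<in> A" "f a \<in> carrier R" "\<And>i. \<lbrakk>i \<in> A; i \<noteq> a\<rbrakk> \<Longrightarrow> f i = \<zero>"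
  shows "(\<Oplus>i\<in>A. f i) = f a"
proof -
  have fc: "f \<in> A - {a} \<rightarrow> carrier R" using assms(4) by force
  have "(\<Oplus>i\<in>A. f i) = (\<Oplus>i\<in>insert a (A - {a}). f i)" using assms(2) by (simp add: insert_absorb)
  also have "\<dots> = f a \<oplus> (\<Oplus>i\<in>A - {a}. f i)"
    using assms(1,3) fc by (intro finsum_insert) auto
  also have "(\<Oplus>i\<in>A - {a}. f i) = (\<Oplus>i\<in>A - {a}. \<zero>)"
    using assms(4) by (intro finsum_cong') auto
  finally show ?thesis using assms(3) by simp
qed

lemma (in abelian_group) finsum_mem_subgroup:
  assumes "additive_subgroup H G" "finite A" "f \<in> A \<rightarrow> H"
  shows "(\<Oplus>i\<in>A. f i) \<in> H"
  using assms(2,3)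
proof (induction A rule: finite_induct)
  interpret H: additive_subgroup H G by fact
  case empty
  then show ?case by simp
next
  interpret H: additive_subgroup H G by fact
  case (insert x F)
  then have "f \<in> F \<rightarrow> carrier G" "f x \<in> carrier G" using H.a_subset by auto
  then show ?case using insert by simp
qed

context graded_ring
begin

lemma grad_closed: "\<lbrakk>\<gamma> \<in> carrier \<Gamma>; x \<in> grad \<gamma>\<rbrakk> \<Longrightarrow> x \<in> carrier E"
  using additive_subgroup.a_subset[OF grad_subgroup] by auto

lemma grad_zero: "\<gamma> \<in> carrier \<Gamma> \<Longrightarrow> \<zero> \<in> grad \<gamma>"
  using additive_subgroup.zero_closed[OF grad_subgroup] .

lemma grad_add: "\<lbrakk>\<gamma> \<in> carrier \<Gamma>; x \<in> grad \<gamma>; y \<in> grad \<gamma>\<rbrakk> \<Longrightarrow> x \<oplus> y \<in> grad \<gamma>"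
  using additive_subgroup.a_closed[OF grad_subgroup] .

lemma grad_uminus: "\<lbrakk>\<gamma> \<in> carrier \<Gamma>; x \<in> grad \<gamma>\<rbrakk> \<Longrightarrow> \<ominus> x \<in> grad \<gamma>"
  using additive_subgroup.a_inv_closed[OF grad_subgroup] by blast

lemma grad_minus: "\<lbrakk>\<gamma> \<in> carrier \<Gamma>; x \<in> grad \<gamma>; y \<in> grad \<gamma>\<rbrakk> \<Longrightarrow> x \<ominus> y \<in> grad \<gamma>"
  unfolding minus_eq by (intro grad_add grad_uminus)

definition component :: "'a \<Rightarrow> 'g \<Rightarrow> 'a" where
  "component x = (THE f. f \<in> (\<Pi>\<^sub>E \<gamma>\<in>carrier \<Gamma>. grad \<gamma>)
    \<and> finite {\<gamma> \<in> carrier \<Gamma>. f \<gamma> \<noteq> \<zero>} \<and> x = finsum E f {\<gamma> \<in> carrier \<Gamma>. f \<gamma> \<noteq> \<zero>})"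

definition support :: "'a \<Rightarrow> 'g set" where
  "support x = {\<gamma> \<in> carrier \<Gamma>. component x \<gamma> \<noteq> \<zero>}"

lemma component_props:
  assumes "x \<in> carrier E"
  shows "component x \<in> (\<Pi>\<^sub>E \<gamma>\<in>carrier \<Gamma>. grad \<gamma>)" "finite (support x)"
    "x = finsum E (component x) (support x)"
  using theI'[OF direct_sum[OF assms]] unfolding component_def support_def by blast+

lemma support_subset: "support x \<subseteq> carrier \<Gamma>"
  by (auto simp: support_def)

lemma component_mem: "\<lbrakk>x \<in> carrier E; \<gamma> \<in> carrier \<Gamma>\<rbrakk> \<Longrightarrow> component x \<gamma> \<in> grad \<gamma>"
  using component_props(1) by auto

lemma component_closed: "\<lbrakk>x \<in> carrier E; \<gamma> \<in> carrier \<Gamma>\<rbrakk> \<Longrightarrow> component x \<gamma> \<in> carrier E"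
  using component_mem grad_closed by blast

lemma sum_components:
  assumes x: "x \<in> carrier E" and A: "finite A" "support x \<subseteq> A" "A \<subseteq> carrier \<Gamma>"
  shows "x = (\<Oplus>\<gamma>\<in>A. component x \<gamma>)"
proof -
  have "(\<Oplus>\<gamma>\<in>support x. component x \<gamma>) = (\<Oplus>\<gamma>\<in>A. component x \<gamma>)"
    using A x component_closed support_subset
    by (intro add.finprod_mono_neutral_cong_left) (auto simp: support_def)
  then show ?thesis using component_props(3)[OF x] by simp
qed

text \<open>Uniqueness of the decomposition in its working form. The index set need not be the
  support: g may vanish at some degrees of \<open>A\<close>, and its values outside \<open>A\<close>
  are ignored.\<close>

lemma component_eqI:
  assumes A: "finite A" "A \<subseteq> carrier \<Gamma>" and g: "\<And>\<gamma>. \<gamma> \<in> A \<Longrightarrow> g \<gamma> \<in> grad \<gamma>"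
    and x: "x = (\<Oplus>\<gamma>\<in>A. g \<gamma>)" and \<gamma>: "\<gamma> \<in> carrier \<Gamma>"
  shows "component x \<gamma> = (if \<gamma> \<in> A then g \<gamma> else \<zero>)"
proof -
  define f where "f = (\<lambda>\<gamma>\<in>carrier \<Gamma>. if \<gamma> \<in> A then g \<gamma> else \<zero>)"
  have gc: "g \<gamma> \<in> carrier E" if "\<gamma> \<in> A" for \<gamma> using A g grad_closed that by blast
  have xc: "x \<in> carrier E" using x gc by auto
  have f: "f \<in> (\<Pi>\<^sub>E \<gamma>\<in>carrier \<Gamma>. grad \<gamma>)" using g grad_zero by (auto simp: f_def)
  have supp: "{\<gamma> \<in> carrier \<Gamma>. f \<gamma> \<noteq> \<zero>} \<subseteq> A" by (auto simp: f_def)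
  then have fin: "finite {\<gamma> \<in> carrier \<Gamma>. f \<gamma> \<noteq> \<zero>}" using A finite_subset by blast
  have "finsum E f {\<gamma> \<in> carrier \<Gamma>. f \<gamma> \<noteq> \<zero>} = x"
    unfolding x using A gc supp
    by (intro add.finprod_mono_neutral_cong_left) (auto simp: f_def subset_eq)
  then have "component x = f"
    unfolding component_def using f fin direct_sum[OF xc] by (intro the1_equality) auto
  then show ?thesis using \<gamma> by (simp add: f_def)
qed

lemma component_homogeneous:
  assumes "\<delta> \<in> carrier \<Gamma>" "x \<in> grad \<delta>" "\<gamma> \<in> carrier \<Gamma>"
  shows "component x \<gamma> = (if \<gamma> = \<delta> then x else \<zero>)"
  using component_eqI[of "{\<delta>}" "\<lambda>_. x" x \<gamma>] assms grad_closed by auto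

lemma grad_inter:
  assumes "\<gamma> \<in> carrier \<Gamma>" "\<delta> \<in> carrier \<Gamma>" "x \<in> grad \<gamma>" "x \<in> grad \<delta>" "x \<noteq> \<zero>"
  shows "\<gamma> = \<delta>"
  using component_homogeneous[of \<gamma> x \<gamma>] component_homogeneous[of \<delta> x \<gamma>] assms
  by (auto split: if_splits)

lemma component_add:
  assumes x: "x \<in> carrier E" and y: "y \<in> carrier E" and \<gamma>: "\<gamma> \<in> carrier \<Gamma>"
  shows "component (x \<oplus> y) \<gamma> = component x \<gamma> \<oplus> component y \<gamma>"
proof -
  define A where "A = support x \<union> support y"
  have A: "finite A" "A \<subseteq> carrier \<Gamma>" "support x \<subseteq> A" "support y \<subseteq> A"
    using component_props(2) x y support_subset by (auto simp: A_def)
  have c: "component x \<in> A \<rightarrow> carrier E" "component y \<in> A \<rightarrow> carrier E"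
    using x y A component_closed by blast+
  have "x \<oplus> y = (\<Oplus>\<gamma>\<in>A. component x \<gamma>) \<oplus> (\<Oplus>\<gamma>\<in>A. component y \<gamma>)"
    using sum_components[of x A] sum_components[of y A] A x y by simp
  also have "\<dots> = (\<Oplus>\<gamma>\<in>A. component x \<gamma> \<oplus> component y \<gamma>)"
    using c by (simp add: finsum_addf)
  finally have "component (x \<oplus> y) \<gamma> = (if \<gamma> \<in> A then component x \<gamma> \<oplus> component y \<gamma> else \<zero>)"
    using A(1,2) \<gamma> x y component_mem grad_add
    by (intro component_eqI) auto
  moreover have "component x \<gamma> = \<zero>" "component y \<gamma> = \<zero>" if "\<gamma> \<notin> A"
    using that A \<gamma> by (auto simp: support_def)
  ultimately show ?thesis by auto
qed

lemma component_zero: "\<gamma> \<in> carrier \<Gamma> \<Longrightarrow> component \<zero> \<gamma> = \<zero>"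
  using component_homogeneous[of \<gamma> \<zero> \<gamma>] grad_zero by simp

lemma component_finsum:
  assumes "finite I" "f \<in> I \<rightarrow> carrier E" "\<gamma> \<in> carrier \<Gamma>"
  shows "component (\<Oplus>i\<in>I. f i) \<gamma> = (\<Oplus>i\<in>I. component (f i) \<gamma>)"
  using assms(1,2)
proof (induction I rule: finite_induct)
  case empty
  then show ?case using assms(3) by (simp add: component_zero)
next
  case (insert i I)
  then have "f i \<in> carrier E" "f \<in> I \<rightarrow> carrier E" by auto
  moreover from this have "(\<lambda>i. component (f i) \<gamma>) \<in> I \<rightarrow> carrier E"
    using assms(3) component_closed by auto
  ultimately show ?case using insert assms(3) by (simp add: component_add component_closed)
qed

lemma zero_if_components_zero:
  assumes "x \<in> carrier E" "\<And>\<gamma>. \<gamma> \<in> carrier \<Gamma> \<Longrightarrow> component x \<gamma> = \<zero>"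
  shows "x = \<zero>"
  using component_props(3)[OF assms(1)] assms(2) by (simp add: support_def cong: conj_cong)

lemma support_nonempty: "\<lbrakk>x \<in> carrier E; x \<noteq> \<zero>\<rbrakk> \<Longrightarrow> support x \<noteq> {}"
  using zero_if_components_zero by (auto simp: support_def)

text \<open>Multiplication by a homogeneous element shifts all degrees by the same amount, and
  cancellation in the grade group leaves one summand in the prescribed degree.\<close>

lemma component_mult_homogeneous:
  assumes x: "x \<in> carrier E" and \<delta>: "\<delta> \<in> carrier \<Gamma>" and y: "y \<in> grad \<delta>" and \<gamma>: "\<gamma> \<in> carrier \<Gamma>"
  shows "component (x \<otimes> y) (\<gamma> \<otimes>\<^bsub>\<Gamma>\<^esub> \<delta>) = component x \<gamma> \<otimes> y"
    and "component (y \<otimes> x) (\<delta> \<otimes>\<^bsub>\<Gamma>\<^esub> \<gamma>) = y \<otimes> component x \<gamma>"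
proof -
  note fin = component_props(2)[OF x]
  have yc: "y \<in> carrier E" using \<delta> y grad_closed by blast
  have c: "component x \<alpha> \<in> carrier E" if "\<alpha> \<in> support x" for \<alpha>
    using that x component_closed support_subset by blast
  have cm: "component x \<alpha> \<in> grad \<alpha>" "\<alpha> \<in> carrier \<Gamma>" if "\<alpha> \<in> support x" for \<alpha>
    using that x component_mem support_subset by blast+
  have cancel: "\<alpha> \<otimes>\<^bsub>\<Gamma>\<^esub> \<delta> = \<gamma> \<otimes>\<^bsub>\<Gamma>\<^esub> \<delta> \<longleftrightarrow> \<alpha> = \<gamma>" "\<delta> \<otimes>\<^bsub>\<Gamma>\<^esub> \<alpha> = \<delta> \<otimes>\<^bsub>\<Gamma>\<^esub> \<gamma> \<longleftrightarrow> \<alpha> = \<gamma>"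
    if "\<alpha> \<in> carrier \<Gamma>" for \<alpha> using that \<gamma> \<delta> by auto
  have x_eq: "x = (\<Oplus>\<alpha>\<in>support x. component x \<alpha>)" by (rule component_props(3)[OF x])
  \<comment> \<open>The degree \<gamma> may lie outside the support of x; the second premise then
    makes the right side zero as well.\<close>
  have single: "(\<Oplus>\<alpha>\<in>support x. if \<alpha> = \<gamma> then h \<alpha> else \<zero>) = h \<gamma>"
    if "\<And>\<alpha>. \<alpha> \<in> carrier \<Gamma> \<Longrightarrow> h \<alpha> \<in> carrier E" "component x \<gamma> = \<zero> \<Longrightarrow> h \<gamma> = \<zero>" for h
  proof (cases "\<gamma> \<in> support x")
    case True
    then show ?thesis using fin that \<gamma> by (subst finsum_only_nonzero[of _ \<gamma>]) auto
  next
    case False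
    then have "(\<Oplus>\<alpha>\<in>support x. if \<alpha> = \<gamma> then h \<alpha> else \<zero>) = (\<Oplus>\<alpha>\<in>support x. \<zero>)"
      by (intro finsum_cong') auto
    then show ?thesis using False that(2) \<gamma> by (simp add: support_def)
  qed
  have "x \<otimes> y = (\<Oplus>\<alpha>\<in>support x. component x \<alpha> \<otimes> y)"
    by (subst x_eq) (use fin yc c in \<open>auto intro!: finsum_ldistr\<close>)
  then have "component (x \<otimes> y) (\<gamma> \<otimes>\<^bsub>\<Gamma>\<^esub> \<delta>)
      = (\<Oplus>\<alpha>\<in>support x. component (component x \<alpha> \<otimes> y) (\<gamma> \<otimes>\<^bsub>\<Gamma>\<^esub> \<delta>))"
    using fin c yc \<gamma> \<delta> by (simp add: component_finsum)
  also have "\<dots> = (\<Oplus>\<alpha>\<in>support x. if \<alpha> = \<gamma> then component x \<alpha> \<otimes> y else \<zero>)"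
  proof (intro finsum_cong')
    fix \<alpha> assume a: "\<alpha> \<in> support x"
    have "component x \<alpha> \<otimes> y \<in> grad (\<alpha> \<otimes>\<^bsub>\<Gamma>\<^esub> \<delta>)" using grad_mult cm[OF a] \<delta> y by blast
    then show "component (component x \<alpha> \<otimes> y) (\<gamma> \<otimes>\<^bsub>\<Gamma>\<^esub> \<delta>) = (if \<alpha> = \<gamma> then component x \<alpha> \<otimes> y else \<zero>)"
      using component_homogeneous[of "\<alpha> \<otimes>\<^bsub>\<Gamma>\<^esub> \<delta>" _ "\<gamma> \<otimes>\<^bsub>\<Gamma>\<^esub> \<delta>"] cm[OF a] cancel(1)[of \<alpha>] \<gamma> \<delta>
      by (auto split: if_splits)
  qed (use c yc in auto)
  also have "\<dots> = component x \<gamma> \<otimes> y"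
    using component_closed x yc by (intro single) auto
  finally show "component (x \<otimes> y) (\<gamma> \<otimes>\<^bsub>\<Gamma>\<^esub> \<delta>) = component x \<gamma> \<otimes> y" .
  have "y \<otimes> x = (\<Oplus>\<alpha>\<in>support x. y \<otimes> component x \<alpha>)"
    by (subst x_eq) (use fin yc c in \<open>auto intro!: finsum_rdistr\<close>)
  then have "component (y \<otimes> x) (\<delta> \<otimes>\<^bsub>\<Gamma>\<^esub> \<gamma>)
      = (\<Oplus>\<alpha>\<in>support x. component (y \<otimes> component x \<alpha>) (\<delta> \<otimes>\<^bsub>\<Gamma>\<^esub> \<gamma>))"
    using fin c yc \<gamma> \<delta> by (simp add: component_finsum)
  also have "\<dots> = (\<Oplus>\<alpha>\<in>support x. if \<alpha> = \<gamma> then y \<otimes> component x \<alpha> else \<zero>)"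
  proof (intro finsum_cong')
    fix \<alpha> assume a: "\<alpha> \<in> support x"
    have "y \<otimes> component x \<alpha> \<in> grad (\<delta> \<otimes>\<^bsub>\<Gamma>\<^esub> \<alpha>)" using grad_mult cm[OF a] \<delta> y by blast
    then show "component (y \<otimes> component x \<alpha>) (\<delta> \<otimes>\<^bsub>\<Gamma>\<^esub> \<gamma>) = (if \<alpha> = \<gamma> then y \<otimes> component x \<alpha> else \<zero>)"
      using component_homogeneous[of "\<delta> \<otimes>\<^bsub>\<Gamma>\<^esub> \<alpha>" _ "\<delta> \<otimes>\<^bsub>\<Gamma>\<^esub> \<gamma>"] cm[OF a] cancel(2)[of \<alpha>] \<gamma> \<delta>
      by (auto split: if_splits)
  qed (use c yc in auto)
  also have "\<dots> = y \<otimes> component x \<gamma>"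
    using component_closed x yc by (intro single) auto
  finally show "component (y \<otimes> x) (\<delta> \<otimes>\<^bsub>\<Gamma>\<^esub> \<gamma>) = y \<otimes> component x \<gamma>" .
qed

text \<open>The axioms of a grading do not place 1 in degree zero. Its degree zero component e
  satisfies x e = x for homogeneous x, by comparing components of x 1 in the degree of x; summing
  over the components of 1 itself gives e = 1.\<close>

lemma one_mem_grad: "\<one> \<in> grad \<one>\<^bsub>\<Gamma>\<^esub>"
proof -
  define e where "e = component \<one> \<one>\<^bsub>\<Gamma>\<^esub>"
  have e: "e \<in> grad \<one>\<^bsub>\<Gamma>\<^esub>" "e \<in> carrier E"
    unfolding e_def by (auto intro: component_mem component_closed)
  have xe: "x \<otimes> e = x" if "\<gamma> \<in> carrier \<Gamma>" "x \<in> grad \<gamma>" for x \<gamma>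
    using component_mult_homogeneous(2)[of \<one> \<gamma> x "\<one>\<^bsub>\<Gamma>\<^esub>"] that
      component_homogeneous[of \<gamma> x \<gamma>] grad_closed[OF that] by (simp add: e_def)
  define f where "f = component \<one>"
  define A where "A = support \<one>"
  have one: "(\<Oplus>\<gamma>\<in>A. f \<gamma>) = \<one>" unfolding f_def A_def using component_props(3)[OF one_closed] by metis
  have A: "finite A" "A \<subseteq> carrier \<Gamma>" unfolding A_def using component_props(2) support_subset by auto
  have f: "f \<gamma> \<in> grad \<gamma>" "f \<gamma> \<in> carrier E" if "\<gamma> \<in> A" for \<gamma>
    using that A component_mem component_closed by (auto simp: f_def)
  have "(\<Oplus>\<gamma>\<in>A. f \<gamma>) \<otimes> e = (\<Oplus>\<gamma>\<in>A. f \<gamma> \<otimes> e)"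
    using e A f by (intro finsum_ldistr) auto
  also have "\<dots> = (\<Oplus>\<gamma>\<in>A. f \<gamma>)"
    using xe f A by (intro finsum_cong') blast+
  finally have "e = \<one>" unfolding one using e(2) by simp
  then show ?thesis using e(1) by simp
qed

end

section \<open>Graded division rings\<close>

lemma (in ring) ring_centerD:
  assumes "z \<in> ring_center R"
  shows "z \<in> carrier R" "x \<in> carrier R \<Longrightarrow> z \<otimes> x = x \<otimes> z"
  using assms by (auto simp: ring_center_def)

lemma (in ring) ring_center_subring: "subring (ring_center R) R"
proof (rule subringI)
  fix h1 h2 assume h: "h1 \<in> ring_center R" "h2 \<in> ring_center R"
  note hD = ring_centerD(1)[OF h(1)] ring_centerD(1)[OF h(2)]
    ring_centerD(2)[OF h(1)] ring_centerD(2)[OF h(2)]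
  show "h1 \<otimes> h2 \<in> ring_center R"
    unfolding ring_center_def
  proof (intro CollectI conjI ballI)
    fix x assume x: "x \<in> carrier R"
    have "h1 \<otimes> h2 \<otimes> x = h1 \<otimes> (h2 \<otimes> x)" using hD(1,2) x by (simp add: m_assoc)
    also have "\<dots> = h1 \<otimes> (x \<otimes> h2)" using hD(4)[OF x] by simp
    also have "\<dots> = (h1 \<otimes> x) \<otimes> h2" using hD(1,2) x by (simp add: m_assoc)
    also have "\<dots> = x \<otimes> (h1 \<otimes> h2)" using hD(1,2) hD(3)[OF x] x by (simp add: m_assoc)
    finally show "h1 \<otimes> h2 \<otimes> x = x \<otimes> (h1 \<otimes> h2)" .
  qed (use hD(1,2) in simp)
  show "h1 \<oplus> h2 \<in> ring_center R"
    unfolding ring_center_def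
  proof (intro CollectI conjI ballI)
    fix x assume x: "x \<in> carrier R"
    then show "(h1 \<oplus> h2) \<otimes> x = x \<otimes> (h1 \<oplus> h2)"
      using hD(1,2) hD(3,4)[OF x] by (simp add: l_distr r_distr)
  qed (use hD(1,2) in simp)
qed (auto simp: ring_center_def l_minus r_minus)

lemma (in ring) ring_center_inv:
  assumes z: "z \<in> ring_center R" "z \<in> Units R"
  shows "inv z \<in> ring_center R"
  unfolding ring_center_def
proof (intro CollectI conjI ballI)
  fix x assume x: "x \<in> carrier R"
  have zc: "z \<in> carrier R" "inv z \<in> carrier R" using z by auto
  have "inv z \<otimes> x = inv z \<otimes> (x \<otimes> z) \<otimes> inv z" using z zc x by (simp add: m_assoc)
  also have "\<dots> = inv z \<otimes> (z \<otimes> x) \<otimes> inv z" using ring_centerD(2)[OF z(1) x] by simp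
  also have "\<dots> = (inv z \<otimes> z) \<otimes> x \<otimes> inv z" using zc x by (simp only: m_assoc m_closed)
  also have "\<dots> = x \<otimes> inv z" using z zc x by simp
  finally show "inv z \<otimes> x = x \<otimes> inv z" .
qed (use z in auto)

section \<open>Absence of zero divisors and homogeneity of units\<close>

context graded_division_ring
begin

lemma zero_not_unit: "\<zero> \<notin> Units E"
proof
  assume "\<zero> \<in> Units E"
  then have "\<zero> \<otimes> inv \<zero> = \<one>" "inv \<zero> \<in> carrier E" by (rule Units_r_inv, simp)
  then show False using one_not_zero by simp
qed

text \<open>The component of x in degree \<gamma> contributes to degree ab through the component of
  y in degree \<gamma>^-1 ab. By uniqueness the latter lies outside the support of y unless \<gamma>
  = a.\<close>

lemma component_of_unique_product:
  assumes x: "x \<in> carrier E" and y: "y \<in> carrier E"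
    and a: "a \<in> support x" and b: "b \<in> support y"
    and uniq: "\<forall>\<gamma>\<in>support x. \<forall>\<delta>\<in>support y. \<gamma> \<otimes>\<^bsub>\<Gamma>\<^esub> \<delta> = a \<otimes>\<^bsub>\<Gamma>\<^esub> b \<longrightarrow> \<gamma> = a \<and> \<delta> = b"
  shows "component (x \<otimes> y) (a \<otimes>\<^bsub>\<Gamma>\<^esub> b) = component x a \<otimes> component y b"
proof -
  note fin = component_props(2)[OF x]
  have ab: "a \<in> carrier \<Gamma>" "b \<in> carrier \<Gamma>" using a b support_subset by auto
  have s: "\<gamma> \<in> carrier \<Gamma>" "component x \<gamma> \<in> grad \<gamma>" "component x \<gamma> \<in> carrier E"
    if "\<gamma> \<in> support x" for \<gamma>
    using that x component_mem component_closed support_subset by blast+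
  have comp: "component (component x \<gamma> \<otimes> y) (a \<otimes>\<^bsub>\<Gamma>\<^esub> b)
      = component x \<gamma> \<otimes> component y (inv\<^bsub>\<Gamma>\<^esub> \<gamma> \<otimes>\<^bsub>\<Gamma>\<^esub> (a \<otimes>\<^bsub>\<Gamma>\<^esub> b))" if g: "\<gamma> \<in> support x" for \<gamma>
  proof -
    have "\<gamma> \<otimes>\<^bsub>\<Gamma>\<^esub> (inv\<^bsub>\<Gamma>\<^esub> \<gamma> \<otimes>\<^bsub>\<Gamma>\<^esub> (a \<otimes>\<^bsub>\<Gamma>\<^esub> b)) = a \<otimes>\<^bsub>\<Gamma>\<^esub> b"
      using s(1)[OF g] ab by (simp add: grp.m_assoc[symmetric])
    then show ?thesis
      using component_mult_homogeneous(2)[of y \<gamma> "component x \<gamma>" "inv\<^bsub>\<Gamma>\<^esub> \<gamma> \<otimes>\<^bsub>\<Gamma>\<^esub> (a \<otimes>\<^bsub>\<Gamma>\<^esub> b)"]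
        s[OF g] ab y by simp
  qed
  have "x \<otimes> y = (\<Oplus>\<gamma>\<in>support x. component x \<gamma>) \<otimes> y"
    using component_props(3)[OF x] by simp
  also have "\<dots> = (\<Oplus>\<gamma>\<in>support x. component x \<gamma> \<otimes> y)"
    using fin y s by (intro finsum_ldistr) auto
  finally have "component (x \<otimes> y) (a \<otimes>\<^bsub>\<Gamma>\<^esub> b)
      = (\<Oplus>\<gamma>\<in>support x. component (component x \<gamma> \<otimes> y) (a \<otimes>\<^bsub>\<Gamma>\<^esub> b))"
    using fin s y ab by (simp add: component_finsum)
  also have "\<dots> = component (component x a \<otimes> y) (a \<otimes>\<^bsub>\<Gamma>\<^esub> b)"
  proof (rule finsum_only_nonzero[OF fin a])
    show "component (component x a \<otimes> y) (a \<otimes>\<^bsub>\<Gamma>\<^esub> b) \<in> carrier E"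
      using s[OF a] y ab component_closed by simp
  next
    fix \<gamma> assume g: "\<gamma> \<in> support x" "\<gamma> \<noteq> a"
    let ?\<delta> = "inv\<^bsub>\<Gamma>\<^esub> \<gamma> \<otimes>\<^bsub>\<Gamma>\<^esub> (a \<otimes>\<^bsub>\<Gamma>\<^esub> b)"
    have d: "?\<delta> \<in> carrier \<Gamma>" "\<gamma> \<otimes>\<^bsub>\<Gamma>\<^esub> ?\<delta> = a \<otimes>\<^bsub>\<Gamma>\<^esub> b"
      using s(1)[OF g(1)] ab by (simp_all add: grp.m_assoc[symmetric])
    have "?\<delta> \<notin> support y" using uniq g d(2) by blast
    then have "component y ?\<delta> = \<zero>" using d(1) by (simp add: support_def)
    then show "component (component x \<gamma> \<otimes> y) (a \<otimes>\<^bsub>\<Gamma>\<^esub> b) = \<zero>"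
      using comp[OF g(1)] s[OF g(1)] by simp
  qed
  also have "\<dots> = component x a \<otimes> component y b"
    using comp[OF a] ab by (simp add: grp.m_assoc[symmetric])
  finally show ?thesis .
qed

lemma component_unit: "\<lbrakk>x \<in> carrier E; \<gamma> \<in> support x\<rbrakk> \<Longrightarrow> component x \<gamma> \<in> Units E"
  using component_mem homogeneous_unit by (auto simp: support_def)

lemma mult_unit_nonzero:
  assumes "u \<in> Units E" "y \<in> carrier E" "y \<noteq> \<zero>"
  shows "u \<otimes> y \<noteq> \<zero>" "y \<otimes> u \<noteq> \<zero>"
proof -
  have "inv u \<otimes> (u \<otimes> y) = y" "(y \<otimes> u) \<otimes> inv u = y"
    using assms(1,2) Units_closed[OF assms(1)] Units_inv_closed[OF assms(1)]
    by (simp add: m_assoc[symmetric], simp add: m_assoc)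
  then show "u \<otimes> y \<noteq> \<zero>" "y \<otimes> u \<noteq> \<zero>" using assms by auto
qed

lemma two_unique_products_of_supports:
  assumes x: "x \<in> carrier E" "x \<noteq> \<zero>" and y: "y \<in> carrier E" "y \<noteq> \<zero>"
  shows "\<exists>a\<in>support x. \<exists>b\<in>support y. \<exists>a'\<in>support x. \<exists>b'\<in>support y.
    (\<forall>\<gamma>\<in>support x. \<forall>\<delta>\<in>support y. \<gamma> \<otimes>\<^bsub>\<Gamma>\<^esub> \<delta> = a \<otimes>\<^bsub>\<Gamma>\<^esub> b \<longrightarrow> \<gamma> = a \<and> \<delta> = b) \<and>
    (\<forall>\<gamma>\<in>support x. \<forall>\<delta>\<in>support y. \<gamma> \<otimes>\<^bsub>\<Gamma>\<^esub> \<delta> = a' \<otimes>\<^bsub>\<Gamma>\<^esub> b' \<longrightarrow> \<gamma> = a' \<and> \<delta> = b') \<and>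
    (a = a' \<longrightarrow> support x = {a})"
proof (rule grp.two_unique_products[of "support x" "support y"])
  show "\<gamma> = \<one>\<^bsub>\<Gamma>\<^esub>" if "\<gamma> \<in> carrier \<Gamma>" "0 < (k::nat)" "\<gamma> [^]\<^bsub>\<Gamma>\<^esub> k = \<one>\<^bsub>\<Gamma>\<^esub>" for \<gamma> k
    using that by (rule torsion_free)
next
  fix a b a' b'
  assume 1: "a \<in> support x" "b \<in> support y" "a' \<in> support x" "b' \<in> support y"
    and 2: "\<And>\<gamma> \<delta>. \<lbrakk>\<gamma> \<in> support x; \<delta> \<in> support y; \<gamma> \<otimes>\<^bsub>\<Gamma>\<^esub> \<delta> = a \<otimes>\<^bsub>\<Gamma>\<^esub> b\<rbrakk> \<Longrightarrow> \<gamma> = a \<and> \<delta> = b"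
    "\<And>\<gamma> \<delta>. \<lbrakk>\<gamma> \<in> support x; \<delta> \<in> support y; \<gamma> \<otimes>\<^bsub>\<Gamma>\<^esub> \<delta> = a' \<otimes>\<^bsub>\<Gamma>\<^esub> b'\<rbrakk> \<Longrightarrow> \<gamma> = a' \<and> \<delta> = b'"
    "a = a' \<Longrightarrow> support x = {a}"
  show ?thesis
    by (intro bexI[OF _ 1(1)] bexI[OF _ 1(2)] bexI[OF _ 1(3)] bexI[OF _ 1(4)] conjI[OF _ conjI])
      (intro ballI impI 2; assumption)+
qed (rule component_props(2)[OF x(1)] support_nonempty[OF x] support_subset
      component_props(2)[OF y(1)] support_nonempty[OF y])+

text \<open>A product of extremal components is a product of units, and no other pair of components
  can cancel it.\<close>

lemma integral:
  assumes x: "x \<in> carrier E" "x \<noteq> \<zero>" and y: "y \<in> carrier E" "y \<noteq> \<zero>"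
  shows "x \<otimes> y \<noteq> \<zero>"
proof -
  obtain a b where ab: "a \<in> support x" "b \<in> support y"
    "\<forall>\<gamma>\<in>support x. \<forall>\<delta>\<in>support y. \<gamma> \<otimes>\<^bsub>\<Gamma>\<^esub> \<delta> = a \<otimes>\<^bsub>\<Gamma>\<^esub> b \<longrightarrow> \<gamma> = a \<and> \<delta> = b"
    using two_unique_products_of_supports[OF x y] by blast
  have "component (x \<otimes> y) (a \<otimes>\<^bsub>\<Gamma>\<^esub> b) = component x a \<otimes> component y b"
    using component_of_unique_product[OF x(1) y(1) ab] .
  also have "\<dots> \<noteq> \<zero>"
    using component_unit ab(1,2) x y component_closed mult_unit_nonzero(1)
    by (auto simp: support_def)
  finally show ?thesis
    using component_zero[of "a \<otimes>\<^bsub>\<Gamma>\<^esub> b"] ab(1,2) support_subset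
    by (metis grp.m_closed subsetD)
qed

text \<open>The product of x with its inverse lives in degree zero alone, so the greatest and the
  least pair of degrees multiply to the same element. Uniqueness identifies the two pairs and leaves
  a single degree in the support of x.\<close>

lemma Units_homogeneous:
  assumes x: "x \<in> Units E"
  shows "\<exists>\<gamma>\<in>carrier \<Gamma>. x \<in> grad \<gamma>"
proof -
  let ?y = "inv x"
  have c: "x \<in> carrier E" "?y \<in> carrier E" "x \<noteq> \<zero>" "?y \<noteq> \<zero>"
    using x zero_not_unit Units_inv_Units[OF x] by (auto simp del: Units_inv_Units)
  obtain a b a' b' where ab: "a \<in> support x" "b \<in> support ?y" "a' \<in> support x" "b' \<in> support ?y"
    "\<forall>\<gamma>\<in>support x. \<forall>\<delta>\<in>support ?y. \<gamma> \<otimes>\<^bsub>\<Gamma>\<^esub> \<delta> = a \<otimes>\<^bsub>\<Gamma>\<^esub> b \<longrightarrow> \<gamma> = a \<and> \<delta> = b"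
    "\<forall>\<gamma>\<in>support x. \<forall>\<delta>\<in>support ?y. \<gamma> \<otimes>\<^bsub>\<Gamma>\<^esub> \<delta> = a' \<otimes>\<^bsub>\<Gamma>\<^esub> b' \<longrightarrow> \<gamma> = a' \<and> \<delta> = b'"
    "a = a' \<Longrightarrow> support x = {a}"
    using two_unique_products_of_supports[OF c(1,3,2,4)] by blast
  have deg: "\<alpha> \<otimes>\<^bsub>\<Gamma>\<^esub> \<beta> = \<one>\<^bsub>\<Gamma>\<^esub>" if "\<alpha> \<in> support x" "\<beta> \<in> support ?y"
    "\<forall>\<gamma>\<in>support x. \<forall>\<delta>\<in>support ?y. \<gamma> \<otimes>\<^bsub>\<Gamma>\<^esub> \<delta> = \<alpha> \<otimes>\<^bsub>\<Gamma>\<^esub> \<beta> \<longrightarrow> \<gamma> = \<alpha> \<and> \<delta> = \<beta>" for \<alpha> \<beta>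
  proof -
    have g: "\<alpha> \<in> carrier \<Gamma>" "\<beta> \<in> carrier \<Gamma>" using that(1,2) support_subset by auto
    have "component \<one> (\<alpha> \<otimes>\<^bsub>\<Gamma>\<^esub> \<beta>) = component x \<alpha> \<otimes> component ?y \<beta>"
      using component_of_unique_product[OF c(1,2) that] x by simp
    also have "\<dots> \<noteq> \<zero>"
      using component_unit that(1,2) c component_closed mult_unit_nonzero(1)
      by (auto simp: support_def)
    finally show ?thesis
      using component_homogeneous[OF _ one_mem_grad, of "\<alpha> \<otimes>\<^bsub>\<Gamma>\<^esub> \<beta>"] g
      by (auto split: if_splits)
  qed
  have "a' \<otimes>\<^bsub>\<Gamma>\<^esub> b' = a \<otimes>\<^bsub>\<Gamma>\<^esub> b" using deg ab by metis
  then have "a = a'" using ab(3-5) by blast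
  then have "support x = {a}" by (rule ab(7))
  moreover have a: "a \<in> carrier \<Gamma>" using ab(1) support_subset by auto
  ultimately have "x = component x a"
    using component_props(3)[OF c(1)] component_closed[OF c(1)] by simp
  then show ?thesis using component_mem[OF c(1) a] a by metis
qed

lemma inv_homogeneous:
  assumes x: "x \<in> Units E" and \<gamma>: "\<gamma> \<in> carrier \<Gamma>" "x \<in> grad \<gamma>"
  shows "inv x \<in> grad (inv\<^bsub>\<Gamma>\<^esub> \<gamma>)"
proof -
  obtain \<delta> where \<delta>: "\<delta> \<in> carrier \<Gamma>" "inv x \<in> grad \<delta>"
    using Units_homogeneous[of "inv x"] x by auto
  have "\<one> \<in> grad (\<gamma> \<otimes>\<^bsub>\<Gamma>\<^esub> \<delta>)" using grad_mult[OF \<gamma>(1) \<delta>(1) \<gamma>(2) \<delta>(2)] x by simp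
  then have "\<gamma> \<otimes>\<^bsub>\<Gamma>\<^esub> \<delta> = \<one>\<^bsub>\<Gamma>\<^esub>"
    using grad_inter[OF _ _ _ one_mem_grad] \<gamma> \<delta> one_not_zero by simp
  then have "\<delta> = inv\<^bsub>\<Gamma>\<^esub> \<gamma>" using \<gamma> \<delta> by (metis grp.inv_equality grp.m_comm)
  then show ?thesis using \<delta> by simp
qed

text \<open>Every nonzero homogeneous component is a unit, so the units generate \<open>E\<close>
  additively.\<close>

lemma central_if_commutes_with_units:
  assumes z: "z \<in> carrier E" and comm: "\<And>y. y \<in> Units E \<Longrightarrow> z \<otimes> y = y \<otimes> z"
  shows "z \<in> ring_center E"
proof -
  have "z \<otimes> x = x \<otimes> z" if x: "x \<in> carrier E" for x
  proof -
    note fin = component_props(2)[OF x]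
    have s: "component x \<gamma> \<in> carrier E" "component x \<gamma> \<in> Units E" if "\<gamma> \<in> support x" for \<gamma>
      using that x component_unit by auto
    have "z \<otimes> (\<Oplus>\<gamma>\<in>support x. component x \<gamma>) = (\<Oplus>\<gamma>\<in>support x. z \<otimes> component x \<gamma>)"
      using fin z s by (intro finsum_rdistr) auto
    also have "\<dots> = (\<Oplus>\<gamma>\<in>support x. component x \<gamma> \<otimes> z)"
      using comm s z by (intro finsum_cong') auto
    also have "\<dots> = (\<Oplus>\<gamma>\<in>support x. component x \<gamma>) \<otimes> z"
      using fin z s by (intro finsum_ldistr[symmetric]) auto
    finally show ?thesis using component_props(3)[OF x] by simp
  qed
  then show ?thesis using z by (simp add: ring_center_def)
qed

text \<open>Makes T a graded subring: for homogeneous y the two sides of zy = yz are compared in one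
  degree, where commutativity of the grade group matches the positions.\<close>

lemma component_central:
  assumes z: "z \<in> ring_center E" and \<gamma>: "\<gamma> \<in> carrier \<Gamma>"
  shows "component z \<gamma> \<in> ring_center E"
proof (rule central_if_commutes_with_units)
  have zc: "z \<in> carrier E" using z ring_centerD by auto
  then show "component z \<gamma> \<in> carrier E" using \<gamma> component_closed by auto
  fix y assume y: "y \<in> Units E"
  then obtain \<delta> where \<delta>: "\<delta> \<in> carrier \<Gamma>" "y \<in> grad \<delta>" using Units_homogeneous by blast
  have "component z \<gamma> \<otimes> y = component (z \<otimes> y) (\<gamma> \<otimes>\<^bsub>\<Gamma>\<^esub> \<delta>)"
    using component_mult_homogeneous(1)[OF zc \<delta> \<gamma>] by simp
  also have "\<dots> = component (y \<otimes> z) (\<delta> \<otimes>\<^bsub>\<Gamma>\<^esub> \<gamma>)"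
    using ring_centerD(2)[OF z Units_closed[OF y]] grp.m_comm[OF \<gamma> \<delta>(1)] by simp
  also have "\<dots> = y \<otimes> component z \<gamma>"
    using component_mult_homogeneous(2)[OF zc \<delta> \<gamma>] .
  finally show "component z \<gamma> \<otimes> y = y \<otimes> component z \<gamma>" .
qed

section \<open>The degree zero part and its finite dimension over T_0\<close>

lemma zero_degree_subring: "subring (grad \<one>\<^bsub>\<Gamma>\<^esub>) E"
  using grad_closed[of "\<one>\<^bsub>\<Gamma>\<^esub>"] one_mem_grad grad_uminus grad_add
    grad_mult[of "\<one>\<^bsub>\<Gamma>\<^esub>" "\<one>\<^bsub>\<Gamma>\<^esub>"]
  by (intro subringI) auto

lemma zero_degree_inv:
  assumes "v \<in> grad \<one>\<^bsub>\<Gamma>\<^esub>" "v \<noteq> \<zero>"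
  shows "v \<in> Units E \<and> inv v \<in> grad \<one>\<^bsub>\<Gamma>\<^esub>"
  using homogeneous_unit[OF _ assms] inv_homogeneous[of v "\<one>\<^bsub>\<Gamma>\<^esub>"] assms by simp

text \<open>With E_0 as coefficient ring and the unit group as \<open>Y\<close>, this supplies the
  conjugation hypothesis of \<open>left_coeffs_zero_of_identity\<close>.\<close>

lemma zero_degree_conj:
  assumes v: "v \<in> grad \<one>\<^bsub>\<Gamma>\<^esub>" and y: "y \<in> Units E"
  shows "inv y \<otimes> v \<otimes> y \<in> grad \<one>\<^bsub>\<Gamma>\<^esub>"
proof -
  obtain \<delta> where \<delta>: "\<delta> \<in> carrier \<Gamma>" "y \<in> grad \<delta>" using Units_homogeneous y by blast
  have "inv y \<otimes> v \<in> grad (inv\<^bsub>\<Gamma>\<^esub> \<delta> \<otimes>\<^bsub>\<Gamma>\<^esub> \<one>\<^bsub>\<Gamma>\<^esub>)"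
    using grad_mult[OF _ _ inv_homogeneous[OF y \<delta>] v] \<delta> by simp
  then have "inv y \<otimes> v \<otimes> y \<in> grad (inv\<^bsub>\<Gamma>\<^esub> \<delta> \<otimes>\<^bsub>\<Gamma>\<^esub> \<one>\<^bsub>\<Gamma>\<^esub> \<otimes>\<^bsub>\<Gamma>\<^esub> \<delta>)"
    using grad_mult[OF _ \<delta>(1) _ \<delta>(2)] \<delta> by blast
  then show ?thesis using \<delta> by simp
qed

lemma subfield_zero_degree_center: "subfield (ring_center E \<inter> grad \<one>\<^bsub>\<Gamma>\<^esub>) E"
proof (rule subfield_of_commuting_invertible)
  show "subring (ring_center E \<inter> grad \<one>\<^bsub>\<Gamma>\<^esub>) E"
    by (rule subring_inter[OF ring_center_subring zero_degree_subring])
next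
  fix x assume "x \<in> ring_center E \<inter> grad \<one>\<^bsub>\<Gamma>\<^esub>" "x \<noteq> \<zero>"
  then show "x \<in> Units E \<and> inv x \<in> ring_center E \<inter> grad \<one>\<^bsub>\<Gamma>\<^esub>"
    using zero_degree_inv[of x] ring_center_inv[of x] by auto
qed (use one_not_zero ring_centerD in auto)

text \<open>Let b run through a homogeneous basis over T, with degrees d(b). An element of degree
  zero only sees the components of its coefficients in the degrees inverse to d(b), and each such
  piece of T is spanned over T_0 by a single t(b). Hence the products t(b) b span E_0.\<close>

lemma zero_degree_finite_dim:
  assumes "graded_fin_dim E \<Gamma> grad (ring_center E)"
  obtains Vs where "set Vs \<subseteq> carrier E"
    "grad \<one>\<^bsub>\<Gamma>\<^esub> \<subseteq> Span (ring_center E \<inter> grad \<one>\<^bsub>\<Gamma>\<^esub>) Vs"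
proof -
  let ?K = "ring_center E \<inter> grad \<one>\<^bsub>\<Gamma>\<^esub>"
  note K = subfield_zero_degree_center
  obtain B where B: "module_basis E (ring_center E) B" "B \<subseteq> (\<Union>\<gamma>\<in>carrier \<Gamma>. grad \<gamma>)"
    using assms by (auto simp: graded_fin_dim_def)
  have "\<forall>b\<in>B. \<exists>\<gamma>. \<gamma> \<in> carrier \<Gamma> \<and> b \<in> grad \<gamma>" using B(2) by auto
  then obtain d where d: "\<And>b. b \<in> B \<Longrightarrow> d b \<in> carrier \<Gamma> \<and> b \<in> grad (d b)" by metis
  define S where "S b = ring_center E \<inter> grad (inv\<^bsub>\<Gamma>\<^esub> (d b))" for b
  have "\<exists>t. t \<in> S b \<and> (\<forall>s\<in>S b. \<exists>r\<in>?K. s = r \<otimes> t)" if b: "b \<in> B" for b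
  proof (cases "S b \<subseteq> {\<zero>}")
    case True
    \<comment> \<open>When T has nothing in the degree inverse to d(b), the spanning element is 0; a
      spanning list may well contain it.\<close>
    have z: "\<zero> \<in> S b" using d[OF b] grad_zero subringE(2)[OF ring_center_subring] by (simp add: S_def)
    have "\<zero> \<in> ?K" using subringE(2)[OF subfieldE(1)[OF K]] .
    moreover have "s = \<zero> \<otimes> \<zero>" if "s \<in> S b" for s using that True by auto
    ultimately show ?thesis using z by blast
  next
    case False
    then obtain t where t: "t \<in> S b" "t \<noteq> \<zero>" by auto
    have di: "inv\<^bsub>\<Gamma>\<^esub> (d b) \<in> carrier \<Gamma>" using d[OF b] by simp
    have tU: "t \<in> Units E" using homogeneous_unit[OF di] t by (auto simp: S_def)
    have "\<exists>r\<in>?K. s = r \<otimes> t" if s: "s \<in> S b" for s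
    proof
      have sc: "s \<in> carrier E" using s ring_centerD by (auto simp: S_def)
      show "s = s \<otimes> inv t \<otimes> t" using tU sc by (simp add: m_assoc Units_closed)
      have "s \<otimes> inv t \<in> grad (inv\<^bsub>\<Gamma>\<^esub> (d b) \<otimes>\<^bsub>\<Gamma>\<^esub> inv\<^bsub>\<Gamma>\<^esub> (inv\<^bsub>\<Gamma>\<^esub> (d b)))"
        using grad_mult[OF di _ _ inv_homogeneous[OF tU di]] s t di by (auto simp: S_def)
      moreover have "s \<otimes> inv t \<in> ring_center E"
        using subringE(6)[OF ring_center_subring] ring_center_inv[OF _ tU] s t by (auto simp: S_def)
      ultimately show "s \<otimes> inv t \<in> ?K" using di by simp
    qed
    then show ?thesis using t by blast
  qed
  then obtain t where t: "\<And>b. b \<in> B \<Longrightarrow> t b \<in> S b"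
    and tS: "\<And>b s. \<lbrakk>b \<in> B; s \<in> S b\<rbrakk> \<Longrightarrow> \<exists>r\<in>?K. s = r \<otimes> t b" by metis
  have fin: "finite B" and Bc: "B \<subseteq> carrier E" using B(1) by (auto simp: module_basis_def)
  have tc: "t b \<in> carrier E" if "b \<in> B" for b using t[OF that] ring_centerD by (auto simp: S_def)
  obtain Bs where Bs: "set Bs = B" using fin finite_list by blast
  define Vs where "Vs = map (\<lambda>b. t b \<otimes> b) Bs"
  have Vs: "set Vs \<subseteq> carrier E" using Bs tc Bc by (auto simp: Vs_def)
  have "x \<in> Span ?K Vs" if x: "x \<in> grad \<one>\<^bsub>\<Gamma>\<^esub>" for x
  proof -
    have xc: "x \<in> carrier E" using x grad_closed by auto
    obtain c where c: "c \<in> B \<rightarrow>\<^sub>E ring_center E" "x = (\<Oplus>b\<in>B. c b \<otimes> b)"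
      using B(1) xc unfolding module_basis_def by blast
    have cT: "c b \<in> ring_center E" if "b \<in> B" for b using PiE_mem[OF c(1) that] .
    then have cc: "c b \<in> carrier E" if "b \<in> B" for b using that ring_centerD by blast
    have bc: "b \<in> carrier E" if "b \<in> B" for b using Bc that by auto
    have "x = component x \<one>\<^bsub>\<Gamma>\<^esub>" using component_homogeneous[OF _ x, of "\<one>\<^bsub>\<Gamma>\<^esub>"] by simp
    also have "\<dots> = (\<Oplus>b\<in>B. component (c b \<otimes> b) \<one>\<^bsub>\<Gamma>\<^esub>)"
      unfolding c(2) using fin cc bc by (intro component_finsum) auto
    also have "\<dots> \<in> Span ?K Vs"
    proof (rule finsum_mem_subgroup[OF _ fin])
      show "additive_subgroup (Span ?K Vs) E"
        using Span_is_add_subgroup[OF K Vs] by (rule additive_subgroup.intro)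
      show "(\<lambda>b. component (c b \<otimes> b) \<one>\<^bsub>\<Gamma>\<^esub>) \<in> B \<rightarrow> Span ?K Vs"
      proof
        fix b assume b: "b \<in> B"
        have di: "inv\<^bsub>\<Gamma>\<^esub> (d b) \<in> carrier \<Gamma>" using d[OF b] by simp
        have "component (c b \<otimes> b) (inv\<^bsub>\<Gamma>\<^esub> (d b) \<otimes>\<^bsub>\<Gamma>\<^esub> d b) = component (c b) (inv\<^bsub>\<Gamma>\<^esub> (d b)) \<otimes> b"
          using component_mult_homogeneous(1)[OF cc[OF b]] d[OF b] di by blast
        then have 1: "component (c b \<otimes> b) \<one>\<^bsub>\<Gamma>\<^esub> = component (c b) (inv\<^bsub>\<Gamma>\<^esub> (d b)) \<otimes> b"
          using d[OF b] by simp
        have "component (c b) (inv\<^bsub>\<Gamma>\<^esub> (d b)) \<in> S b"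
          using component_central[OF cT[OF b] di] component_mem[OF cc[OF b] di] by (simp add: S_def)
        then obtain r where r: "r \<in> ?K" "component (c b) (inv\<^bsub>\<Gamma>\<^esub> (d b)) = r \<otimes> t b"
          using tS[OF b] by blast
        have rc: "r \<in> carrier E" using r ring_centerD by blast
        have "component (c b \<otimes> b) \<one>\<^bsub>\<Gamma>\<^esub> = r \<otimes> (t b \<otimes> b)"
          unfolding 1 r(2) using rc tc[OF b] bc[OF b] by (simp add: m_assoc)
        moreover have "t b \<otimes> b \<in> Span ?K Vs"
          using Span_base_incl[OF K Vs] b Bs by (auto simp: Vs_def)
        ultimately show "component (c b \<otimes> b) \<one>\<^bsub>\<Gamma>\<^esub> \<in> Span ?K Vs"
          using Span_smult_closed[OF K Vs r(1)] by simp
      qed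
    qed
    finally show ?thesis .
  qed
  then show ?thesis using that Vs by blast
qed

end

section \<open>Products of symmetric elements\<close>

context graded_division_ring
begin

text \<open>A Skolem--Noether statement in degree zero.  For a polynomial $f$ with
  $f(a) = f(b) = 0$, the operator obtained from the divided difference
  $(f(b) - f(a)) / (b - a)$, with $b$ acting on the left and $a$ on the right, takes values in
  the intertwiners; for the minimal polynomial of $a$ it does not vanish.\<close>

lemma zero_degree_intertwiner:
  assumes fd: "graded_fin_dim E \<Gamma> grad (ring_center E)"
    and a: "a \<in> grad \<one>\<^bsub>\<Gamma>\<^esub>" and b: "b \<in> grad \<one>\<^bsub>\<Gamma>\<^esub>"
    and transfer: "\<And>N c. \<lbrakk>c \<in> UNIV \<rightarrow> ring_center E \<inter> grad \<one>\<^bsub>\<Gamma>\<^esub>;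
        (\<Oplus>i\<in>{..N::nat}. c i \<otimes> a [^] i) = \<zero>\<rbrakk> \<Longrightarrow> (\<Oplus>i\<in>{..N}. c i \<otimes> b [^] i) = \<zero>"
  shows "\<exists>x\<in>Units E. b \<otimes> x = x \<otimes> a"
proof -
  let ?S = "grad \<one>\<^bsub>\<Gamma>\<^esub>"
  let ?K = "ring_center E \<inter> ?S"
  note SE = subringE[OF zero_degree_subring]
  note K = subfield_zero_degree_center
  note KE = subringE[OF subfieldE(1)[OF K]]
  have pow: "x [^] (i::nat) \<in> ?S" if "x \<in> ?S" for x i
    using that SE(3,6) by (induction i) auto
  have ac: "a \<in> carrier E" "b \<in> carrier E" using a b grad_closed by auto
  let ?rel = "\<lambda>N. \<exists>c. c \<in> UNIV \<rightarrow> ?K \<and> c N \<noteq> \<zero> \<and> (\<Oplus>i\<in>{..N::nat}. c i \<otimes> a [^] i) = \<zero>"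
  \<comment> \<open>The degree of the minimal polynomial of a over T_0. Minimality returns at the
    end, when a relation among lower powers is ruled out.\<close>
  define N where "N = (LEAST N. ?rel N)"
  obtain Vs where Vs: "set Vs \<subseteq> carrier E" "?S \<subseteq> Span ?K Vs"
    using zero_degree_finite_dim[OF fd] by blast
  have "\<exists>N. ?rel N"
    using exists_power_relation[OF K Vs(1) ac(1)] pow[OF a] Vs(2) by blast
  then have "?rel N" unfolding N_def by (rule LeastI_ex)
  then obtain c where c: "c \<in> UNIV \<rightarrow> ?K" "c N \<noteq> \<zero>" "(\<Oplus>i\<in>{..N}. c i \<otimes> a [^] i) = \<zero>"
    by blast
  have minimal: "N \<le> n" if "?rel n" for n unfolding N_def using that by (rule Least_le)
  have "N \<noteq> 0"
  proof
    assume "N = 0"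
    then show False using c ac ring_centerD by (auto simp: Pi_iff)
  qed
  then obtain M where M: "N = Suc M" by (cases N) auto
  \<comment> \<open>The relation controls the coefficients up to N only. Cutting them off there lets
    shifted sums keep the range \<open>{..N}\<close>.\<close>
  define f where "f i = (if i \<le> N then c i else \<zero>)" for i
  have fK: "f i \<in> ?K" for i using c(1) KE(2) by (auto simp: f_def)
  then have fS: "f i \<in> ?S" and fT: "f i \<in> ring_center E" for i by auto
  have fc [simp]: "f i \<in> carrier E" for i using fT ring_centerD by blast
  have fcomm: "f i \<otimes> x = x \<otimes> f i" if "x \<in> carrier E" for i x
    using ring_centerD(2)[OF fT that] .
  have fa: "(\<Oplus>i\<in>{..N}. f i \<otimes> a [^] i) = \<zero>"
  proof -
    have "(\<Oplus>i\<in>{..N}. f i \<otimes> a [^] i) = (\<Oplus>i\<in>{..N}. c i \<otimes> a [^] i)"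
      using c(1) KE(1) ac by (intro finsum_cong') (auto simp: f_def Pi_iff subset_eq)
    then show ?thesis using c(3) by simp
  qed
  have fb: "(\<Oplus>i\<in>{..N}. f i \<otimes> b [^] i) = \<zero>" using transfer[OF _ fa] fK by blast
  \<comment> \<open>Horner coefficients: the divided difference is the sum of \<open>v i\<close>
    times a^i, with the powers of b collected in \<open>v i\<close>. They satisfy f(i+1) + b v(i+1)
    = v(i), with v(M) = f(N) at the top and f(0) + b v(0) = f(b) = 0 at the bottom.\<close>
  define v where "v i = (\<Oplus>j\<in>{..N}. f (Suc i + j) \<otimes> b [^] j)" for i
  have vS: "v i \<in> ?S" for i
    unfolding v_def
  proof (rule finsum_mem_subgroup[OF grad_subgroup])
    show "(\<lambda>j. f (Suc i + j) \<otimes> b [^] j) \<in> {..N} \<rightarrow> ?S" using SE(6)[OF fS pow[OF b]] by blast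
  qed auto
  have vc [simp]: "v i \<in> carrier E" for i using vS SE(1) by blast
  have horner: "f i \<oplus> b \<otimes> v i = (\<Oplus>j\<in>{..N}. f (i + j) \<otimes> b [^] j)" for i
  proof -
    have "b \<otimes> v i = (\<Oplus>j\<in>{..N}. b \<otimes> (f (Suc i + j) \<otimes> b [^] j))"
      unfolding v_def using ac by (intro finsum_rdistr) auto
    also have "\<dots> = (\<Oplus>j\<in>{..N}. f (i + Suc j) \<otimes> b [^] Suc j)"
    proof (intro finsum_cong')
      fix j
      have "b \<otimes> (f (Suc i + j) \<otimes> b [^] j) = (b \<otimes> f (Suc i + j)) \<otimes> b [^] j"
        using ac by (simp add: m_assoc)
      also have "\<dots> = f (Suc i + j) \<otimes> (b \<otimes> b [^] j)"
        by (simp only: fcomm[OF ac(2), symmetric] m_assoc fc ac nat_pow_closed)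
      also have "b \<otimes> b [^] j = b [^] Suc j" using ac by (metis nat_pow_Suc2)
      finally show "b \<otimes> (f (Suc i + j) \<otimes> b [^] j) = f (i + Suc j) \<otimes> b [^] Suc j" by simp
    qed (use ac in auto)
    finally have "f i \<oplus> b \<otimes> v i = (\<Oplus>j\<in>{..Suc N}. f (i + j) \<otimes> b [^] j)"
      using ac by (subst finsum_Suc2) (auto simp: a_comm)
    also have "\<dots> = (\<Oplus>j\<in>{..N}. f (i + j) \<otimes> b [^] j)"
    proof -
      have "f (i + Suc N) = \<zero>" by (simp add: f_def)
      then show ?thesis using ac by (subst finsum_Suc) auto
    qed
    finally show ?thesis .
  qed
  have v0: "f 0 \<oplus> b \<otimes> v 0 = \<zero>" using horner[of 0] fb by simp
  have vSuc: "f (Suc i) \<oplus> b \<otimes> v (Suc i) = v i" for i using horner[of "Suc i"] by (simp add: v_def)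
  have vN: "v N = \<zero>"
  proof -
    have "v N = (\<Oplus>j\<in>{..N}. \<zero>)" unfolding v_def using ac by (intro finsum_cong') (auto simp: f_def)
    then show ?thesis by simp
  qed
  have vM: "v M = f N" using vSuc[of M] vN ac M by simp
  define y where "y x = (\<Oplus>i\<in>{..M}. v i \<otimes> x \<otimes> a [^] i)" for x
  have inter: "b \<otimes> y x = y x \<otimes> a" if x: "x \<in> Units E" for x
  proof -
    have xc [simp]: "x \<in> carrier E" using x by auto
    \<comment> \<open>This sum is evaluated twice. The Horner recursion shifts the index and gives
      \<open>y x \<otimes> a\<close>; splitting each bracket gives x f(a) plus
      \<open>b \<otimes> y x\<close>, and f(a) = 0.\<close>
    define q where "q = (\<Oplus>i\<in>{..Suc M}. (f i \<oplus> b \<otimes> v i) \<otimes> x \<otimes> a [^] i)"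
    have "q = (\<Oplus>i\<in>{..M}. (f (Suc i) \<oplus> b \<otimes> v (Suc i)) \<otimes> x \<otimes> a [^] Suc i)
        \<oplus> (f 0 \<oplus> b \<otimes> v 0) \<otimes> x \<otimes> a [^] (0::nat)"
      unfolding q_def using ac by (subst finsum_Suc2) auto
    also have "\<dots> = (\<Oplus>i\<in>{..M}. v i \<otimes> x \<otimes> a [^] Suc i)"
      unfolding vSuc v0 using ac by simp
    also have "\<dots> = (\<Oplus>i\<in>{..M}. v i \<otimes> x \<otimes> a [^] i \<otimes> a)"
      using ac by (intro finsum_cong') (auto simp: m_assoc)
    also have "\<dots> = y x \<otimes> a"
      unfolding y_def using ac by (intro finsum_ldistr[symmetric]) auto
    finally have 1: "q = y x \<otimes> a" .
    have "q = (\<Oplus>i\<in>{..Suc M}. x \<otimes> (f i \<otimes> a [^] i) \<oplus> b \<otimes> (v i \<otimes> x \<otimes> a [^] i))"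
      unfolding q_def
    proof (intro finsum_cong')
      fix i
      have "(f i \<oplus> b \<otimes> v i) \<otimes> x \<otimes> a [^] i = f i \<otimes> x \<otimes> a [^] i \<oplus> b \<otimes> v i \<otimes> x \<otimes> a [^] i"
        using ac by (simp add: l_distr)
      then show "(f i \<oplus> b \<otimes> v i) \<otimes> x \<otimes> a [^] i = x \<otimes> (f i \<otimes> a [^] i) \<oplus> b \<otimes> (v i \<otimes> x \<otimes> a [^] i)"
        using fcomm[OF xc, of i] ac by (simp add: m_assoc)
    qed (use ac in auto)
    also have "\<dots> = (\<Oplus>i\<in>{..Suc M}. x \<otimes> (f i \<otimes> a [^] i)) \<oplus> (\<Oplus>i\<in>{..Suc M}. b \<otimes> (v i \<otimes> x \<otimes> a [^] i))"
      using ac by (intro finsum_addf) auto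
    also have "(\<Oplus>i\<in>{..Suc M}. x \<otimes> (f i \<otimes> a [^] i)) = x \<otimes> (\<Oplus>i\<in>{..Suc M}. f i \<otimes> a [^] i)"
      using ac by (intro finsum_rdistr[symmetric]) auto
    also have "\<dots> = \<zero>" using fa M by simp
    also have "(\<Oplus>i\<in>{..Suc M}. b \<otimes> (v i \<otimes> x \<otimes> a [^] i)) = (\<Oplus>i\<in>{..M}. b \<otimes> (v i \<otimes> x \<otimes> a [^] i))"
      using ac vN M by (subst finsum_Suc) auto
    also have "\<dots> = b \<otimes> y x"
      unfolding y_def using ac by (intro finsum_rdistr[symmetric]) auto
    finally have "q = b \<otimes> y x" using ac by (simp add: y_def)
    then show ?thesis using 1 by simp
  qed
  have "\<exists>x\<in>Units E. y x \<noteq> \<zero>"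
  proof (rule ccontr)
    assume "\<not> ?thesis"
    then have y0: "y x = \<zero>" if "x \<in> Units E" for x using that by blast
    \<comment> \<open>If every \<open>y x\<close> vanished, the coefficient lemma would apply with
      E_0 as \<open>S\<close>, the unit group as \<open>Y\<close> and the powers of a as u.
      Coefficients commuting with all units lie in T_0, so a nontrivial relation among them would
      undercut N. The conclusion contradicts v(M) = f(N).\<close>
    have "\<forall>i\<in>{..M}. v i = \<zero>"
    proof (rule left_coeffs_zero_of_identity[OF zero_degree_subring zero_degree_inv subset_refl
            Units_one_closed Units_m_closed zero_degree_conj])
      show "(\<Oplus>i\<in>{..M}. v i \<otimes> x \<otimes> a [^] i) = \<zero>" if "x \<in> Units E" for x
        using y0[OF that] by (simp add: y_def)
    next
      fix w assume w: "w \<in> {..M} \<rightarrow> ?S" "(\<Oplus>i\<in>{..M}. w i \<otimes> a [^] i) = \<zero>"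
        and wcomm: "\<And>i y. \<lbrakk>i \<in> {..M}; y \<in> Units E\<rbrakk> \<Longrightarrow> w i \<otimes> y = y \<otimes> w i"
      have wc: "w i \<in> carrier E" if "i \<le> M" for i using w(1) that SE(1) by (auto simp: Pi_iff)
      have wK: "w i \<in> ?K" if "i \<le> M" for i
        using central_if_commutes_with_units[OF wc[OF that]] wcomm that w(1) by auto
      show "\<forall>i\<in>{..M}. w i = \<zero>"
      proof (rule ccontr)
        assume "\<not> ?thesis"
        then obtain k where k: "k \<le> M" "w k \<noteq> \<zero>" by auto
        \<comment> \<open>Truncating at the last nonzero coefficient brings the relation into the
          form over which N was minimised.\<close>
        define j where "j = Max {i. i \<le> M \<and> w i \<noteq> \<zero>}"
        have fin: "finite {i. i \<le> M \<and> w i \<noteq> \<zero>}" by (rule finite_subset[of _ "{..M}"]) auto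
        have "j \<in> {i. i \<le> M \<and> w i \<noteq> \<zero>}" unfolding j_def using fin k by (intro Max_in) auto
        then have j: "j \<le> M" "w j \<noteq> \<zero>" by auto
        have above: "w i = \<zero>" if "j < i" "i \<le> M" for i
          using Max_ge[OF fin, of i] that unfolding j_def[symmetric] by force
        define d where "d i = (if i \<le> M then w i else \<zero>)" for i
        have d: "d i \<in> ?K" for i using wK KE(2) by (auto simp: d_def)
        then have dc: "d i \<in> carrier E" for i using ring_centerD by blast
        have "\<zero> = (\<Oplus>i\<in>{..M}. d i \<otimes> a [^] i)"
          unfolding w(2)[symmetric] using wc ac dc by (intro finsum_cong') (auto simp: d_def)
        also have "\<dots> = (\<Oplus>i\<in>{..j}. d i \<otimes> a [^] i)"
          using j above dc ac by (intro add.finprod_mono_neutral_cong_right) (auto simp: d_def)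
        finally have "?rel j" using d j by (intro exI[of _ d]) (auto simp: d_def)
        then have "N \<le> j" by (rule minimal)
        then show False using j M by simp
      qed
    qed (use vS ac in auto)
    then show False using vM c(2) by (simp add: f_def)
  qed
  then obtain x where x: "x \<in> Units E" "y x \<noteq> \<zero>" by blast
  obtain \<delta> where \<delta>: "\<delta> \<in> carrier \<Gamma>" "x \<in> grad \<delta>" using Units_homogeneous x by blast
  \<comment> \<open>All v(i) and powers of a have degree zero, so a nonzero \<open>y x\<close> is
    homogeneous of the degree of x and therefore a unit.\<close>
  have "y x \<in> grad \<delta>"
    unfolding y_def
  proof (rule finsum_mem_subgroup[OF grad_subgroup[OF \<delta>(1)]])
    show "(\<lambda>i. v i \<otimes> x \<otimes> a [^] i) \<in> {..M} \<rightarrow> grad \<delta>"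
    proof
      fix i
      have "v i \<otimes> x \<in> grad \<delta>" using grad_mult[OF _ \<delta>(1) vS \<delta>(2)] \<delta> by simp
      then show "v i \<otimes> x \<otimes> a [^] i \<in> grad \<delta>"
        using grad_mult[OF \<delta>(1) _ _ pow[OF a]] \<delta> by fastforce
    qed
  qed auto
  then have "y x \<in> Units E" using homogeneous_unit \<delta> x by blast
  then show ?thesis using inter[OF x(1)] by blast
qed

end

locale graded_division_involution = graded_division_ring E \<Gamma> grad + graded_involution E \<Gamma> grad \<tau>
  for E :: "('a, 'm) ring_scheme" (structure) and \<Gamma> :: "('g, 'n) monoid_scheme" and grad \<tau>
begin

lemma tau_zero: "\<tau> \<zero> = \<zero>"
proof -
  have "\<tau> \<zero> \<oplus> \<tau> \<zero> = \<tau> \<zero> \<oplus> \<zero>" using inv_add[of \<zero> \<zero>] inv_closed by simp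
  then show ?thesis using inv_closed[of \<zero>] by (simp only: add.l_cancel zero_closed)
qed

lemma tau_uminus:
  assumes x: "x \<in> carrier E" shows "\<tau> (\<ominus> x) = \<ominus> \<tau> x"
proof -
  have "\<tau> (\<ominus> x) \<oplus> \<tau> x = \<zero>" using inv_add[of "\<ominus> x" x] x tau_zero by (simp add: l_neg)
  then show ?thesis using minus_equality inv_closed x by simp
qed

lemma tau_finsum:
  assumes "finite I" "f \<in> I \<rightarrow> carrier E"
  shows "\<tau> (\<Oplus>i\<in>I. f i) = (\<Oplus>i\<in>I. \<tau> (f i))"
  using assms
proof (induction I rule: finite_induct)
  case (insert i I)
  then have "f i \<in> carrier E" "f \<in> I \<rightarrow> carrier E" by auto
  moreover from this have "(\<lambda>i. \<tau> (f i)) \<in> I \<rightarrow> carrier E" using inv_closed by auto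
  ultimately show ?case using insert by (simp add: inv_add inv_closed)
qed (simp add: tau_zero)

lemma tau_pow: "x \<in> carrier E \<Longrightarrow> \<tau> (x [^] (n::nat)) = \<tau> x [^] n"
proof (induction n)
  case (Suc n)
  then show ?case using inv_mult[of "x [^] n" x] inv_closed[of x] nat_pow_Suc2[of "\<tau> x" n] by simp
qed (simp add: inv_one)

lemma tau_grad: "\<lbrakk>\<gamma> \<in> carrier \<Gamma>; x \<in> grad \<gamma>\<rbrakk> \<Longrightarrow> \<tau> x \<in> grad \<gamma>"
  using inv_graded by blast

lemma tau_central:
  assumes z: "z \<in> ring_center E" shows "\<tau> z \<in> ring_center E"
  unfolding ring_center_def
proof (intro CollectI conjI ballI)
  have zc: "z \<in> carrier E" using z ring_centerD by blast
  then show "\<tau> z \<in> carrier E" by (rule inv_closed)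
  fix x assume x: "x \<in> carrier E"
  have "\<tau> z \<otimes> x = \<tau> (\<tau> x \<otimes> z)" using inv_mult[of "\<tau> x" z] inv_inv inv_closed x zc by simp
  also have "\<tau> x \<otimes> z = z \<otimes> \<tau> x" using ring_centerD(2)[OF z inv_closed[OF x]] by simp
  also have "\<tau> (z \<otimes> \<tau> x) = x \<otimes> \<tau> z" using inv_mult[of z "\<tau> x"] inv_inv inv_closed x zc by simp
  finally show "\<tau> z \<otimes> x = x \<otimes> \<tau> z" .
qed

lemma Sigma_subgroup: "subgroup (Sigma_unitary E \<tau>) (units_of E)"
  unfolding Sigma_unitary_def
  by (rule group.generate_is_subgroup[OF units_group]) (auto simp: units_of_carrier)

lemma Sigma_subset: "Sigma_unitary E \<tau> \<subseteq> Units E"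
  using subgroup.subset[OF Sigma_subgroup] by (simp add: units_of_carrier)

lemma symmetric_mem_Sigma: "\<lbrakk>a \<in> Units E; \<tau> a = a\<rbrakk> \<Longrightarrow> a \<in> Sigma_unitary E \<tau>"
  unfolding Sigma_unitary_def by (auto intro: generate.incl)

lemma Sigma_mult: "\<lbrakk>a \<in> Sigma_unitary E \<tau>; b \<in> Sigma_unitary E \<tau>\<rbrakk> \<Longrightarrow> a \<otimes> b \<in> Sigma_unitary E \<tau>"
  using subgroup.m_closed[OF Sigma_subgroup] by (simp add: units_of_mult)

lemma Sigma_inv: "a \<in> Sigma_unitary E \<tau> \<Longrightarrow> inv a \<in> Sigma_unitary E \<tau>"
  using subgroup.m_inv_closed[OF Sigma_subgroup, of a] units_of_inv[of a] subsetD[OF Sigma_subset, of a]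
  by simp

text \<open>The standard way of removing an auxiliary factor: symmetric multipliers are used to
  reach an element of the subgroup and are then divided out.\<close>

lemma Sigma_left_quotient:
  assumes "u \<in> Sigma_unitary E \<tau>" "a \<in> carrier E" "u \<otimes> a \<in> Sigma_unitary E \<tau>"
  shows "a \<in> Sigma_unitary E \<tau>"
proof -
  have u: "u \<in> Units E" using assms Sigma_subset by blast
  have "inv u \<otimes> (u \<otimes> a) \<in> Sigma_unitary E \<tau>" by (rule Sigma_mult[OF Sigma_inv[OF assms(1)] assms(3)])
  moreover have "inv u \<otimes> (u \<otimes> a) = a" using u assms(2) Units_closed[OF u] by (simp add: m_assoc[symmetric])
  ultimately show ?thesis by simp
qed

lemma symmetrize:
  assumes x: "x \<in> carrier E"
  shows "\<tau> (x \<oplus> \<tau> x) = x \<oplus> \<tau> x" "\<tau> (x \<ominus> \<tau> x) = \<ominus> (x \<ominus> \<tau> x)"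
proof -
  note c = x inv_closed[OF x]
  show "\<tau> (x \<oplus> \<tau> x) = x \<oplus> \<tau> x"
    using inv_add[OF c] inv_inv[OF x] a_comm[OF c] by simp
  have "\<tau> (x \<ominus> \<tau> x) = \<tau> x \<oplus> \<ominus> x"
    unfolding minus_eq inv_add[OF x a_inv_closed[OF c(2)]] tau_uminus[OF c(2)] inv_inv[OF x] ..
  also have "\<dots> = \<ominus> (x \<ominus> \<tau> x)"
    unfolding minus_eq minus_add[OF x a_inv_closed[OF c(2)]] minus_minus[OF c(2)]
    by (rule a_comm[OF c(2) a_inv_closed[OF x]])
  finally show "\<tau> (x \<ominus> \<tau> x) = \<ominus> (x \<ominus> \<tau> x)" .
qed

section \<open>Generation by symmetric units in the presence of a central skew element\<close>

context
  fixes t and \<epsilon>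
  assumes t: "t \<in> ring_center E" "\<epsilon> \<in> carrier \<Gamma>" "t \<in> grad \<epsilon>" "t \<noteq> \<zero>"
    and tau_t: "\<tau> t = \<ominus> t" "\<ominus> t \<noteq> t"
    and tau_zero_degree: "\<And>z. z \<in> ring_center E \<inter> grad \<one>\<^bsub>\<Gamma>\<^esub> \<Longrightarrow> \<tau> z = z"
begin

lemma t_props: "t \<in> carrier E" "t \<in> Units E" "x \<in> carrier E \<Longrightarrow> t \<otimes> x = x \<otimes> t"
  using t ring_centerD homogeneous_unit by auto

lemma skew_times_t:
  assumes "x \<in> Units E" "\<tau> x = \<ominus> x"
  shows "t \<otimes> x \<in> Sigma_unitary E \<tau>"
proof (rule symmetric_mem_Sigma)
  have xc: "x \<in> carrier E" using assms by auto
  show "t \<otimes> x \<in> Units E" using assms t_props by auto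
  have "\<tau> (t \<otimes> x) = (\<ominus> x) \<otimes> (\<ominus> t)" using inv_mult[OF t_props(1) xc] assms tau_t by simp
  also have "\<dots> = t \<otimes> x" using t_props(1) t_props(3)[OF xc] xc by (simp add: l_minus r_minus)
  finally show "\<tau> (t \<otimes> x) = t \<otimes> x" .
qed

text \<open>If sum and difference of x and \<tau> x both vanished, then 2x = 0; multiplication by
  x^-1 t would turn this into 2t = 0, against \<open>tau_t\<close>.\<close>

lemma two_torsion_free:
  assumes x: "x \<in> Units E" and "x \<oplus> \<tau> x = \<zero>"
  shows "x \<ominus> \<tau> x \<noteq> \<zero>"
proof
  assume 0: "x \<ominus> \<tau> x = \<zero>"
  have xc: "x \<in> carrier E" "\<tau> x \<in> carrier E" using x inv_closed by auto
  have "\<tau> x = x" using 0 xc by (metis r_right_minus_eq)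
  then have "x \<oplus> x = \<zero>" using assms by simp
  then have "\<zero> = (x \<oplus> x) \<otimes> (inv x \<otimes> t)" using x t_props by simp
  also have "\<dots> = x \<otimes> (inv x \<otimes> t) \<oplus> x \<otimes> (inv x \<otimes> t)" using x xc t_props by (simp add: l_distr)
  also have "x \<otimes> (inv x \<otimes> t) = t" using x xc t_props by (simp add: m_assoc[symmetric])
  finally have "\<ominus> t = t" using t_props by (metis minus_equality)
  then show False using tau_t by simp
qed

lemma zero_degree_mem_Sigma:
  assumes fd: "graded_fin_dim E \<Gamma> grad (ring_center E)"
    and a: "a \<in> grad \<one>\<^bsub>\<Gamma>\<^esub>" "a \<noteq> \<zero>"
  shows "a \<in> Sigma_unitary E \<tau>"
proof -
  have aU: "a \<in> Units E" using homogeneous_unit[OF _ a] by simp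
  have ac: "a \<in> carrier E" "\<tau> a \<in> carrier E" using aU inv_closed by auto
  \<comment> \<open>Applying \<tau> to a polynomial relation for a reverses the order of each
    product, but the coefficients are central and fixed, so the same relation holds for \<tau>
    a.\<close>
  have "\<exists>x\<in>Units E. \<tau> a \<otimes> x = x \<otimes> a"
  proof (rule zero_degree_intertwiner[OF fd a(1) tau_grad[OF _ a(1)]])
    fix N :: nat and c
    assume c: "c \<in> UNIV \<rightarrow> ring_center E \<inter> grad \<one>\<^bsub>\<Gamma>\<^esub>" and sum0: "(\<Oplus>i\<in>{..N}. c i \<otimes> a [^] i) = \<zero>"
    have cK: "c i \<in> ring_center E" "c i \<in> ring_center E \<inter> grad \<one>\<^bsub>\<Gamma>\<^esub>" for i using c by auto
    have cc: "c i \<in> carrier E" for i using cK ring_centerD by blast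
    have "\<zero> = \<tau> (\<Oplus>i\<in>{..N}. c i \<otimes> a [^] i)" using sum0 tau_zero by simp
    also have "\<dots> = (\<Oplus>i\<in>{..N}. \<tau> (c i \<otimes> a [^] i))" using cc ac by (intro tau_finsum) auto
    also have "\<dots> = (\<Oplus>i\<in>{..N}. c i \<otimes> \<tau> a [^] i)"
    proof (intro finsum_cong')
      fix i
      have "\<tau> (c i \<otimes> a [^] i) = \<tau> a [^] i \<otimes> c i"
        using inv_mult[OF cc nat_pow_closed[OF ac(1)]] tau_pow[OF ac(1)] tau_zero_degree[OF cK(2)] by simp
      then show "\<tau> (c i \<otimes> a [^] i) = c i \<otimes> \<tau> a [^] i"
        using ring_centerD(2)[OF cK(1) nat_pow_closed[OF ac(2)]] by simp
    qed (use cc ac in auto)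
    finally show "(\<Oplus>i\<in>{..N}. c i \<otimes> \<tau> a [^] i) = \<zero>" by simp
  qed simp
  then obtain x where x: "x \<in> Units E" "\<tau> a \<otimes> x = x \<otimes> a" by blast
  obtain \<delta> where \<delta>: "\<delta> \<in> carrier \<Gamma>" "x \<in> grad \<delta>" using Units_homogeneous x by blast
  have xc: "x \<in> carrier E" "\<tau> x \<in> carrier E" using x inv_closed by auto
  \<comment> \<open>Applying \<tau> to the intertwining relation exchanges its sides, so \<tau> x
    intertwines as well, and so do sums and differences with x.\<close>
  have x': "\<tau> a \<otimes> \<tau> x = \<tau> x \<otimes> a"
    using arg_cong[OF x(2), of \<tau>] inv_mult xc ac inv_inv by simp
  show ?thesis
  proof (cases "x \<oplus> \<tau> x = \<zero>")
    case False
    define s where "s = x \<oplus> \<tau> x"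
    have sU: "s \<in> Units E"
      using homogeneous_unit[OF \<delta>(1) grad_add[OF \<delta> tau_grad[OF \<delta>]]] False by (simp add: s_def)
    have s: "\<tau> s = s" using symmetrize xc by (simp add: s_def)
    have "\<tau> a \<otimes> s = s \<otimes> a" using x x' xc ac by (simp add: s_def l_distr r_distr)
    then have "\<tau> (s \<otimes> a) = s \<otimes> a" using inv_mult[OF Units_closed[OF sU] ac(1)] s by simp
    then have "s \<otimes> a \<in> Sigma_unitary E \<tau>" using sU aU by (intro symmetric_mem_Sigma) auto
    then show ?thesis using Sigma_left_quotient[OF symmetric_mem_Sigma[OF sU s] ac(1)] by simp
  next
    case True
    \<comment> \<open>Since \<tau> x = -x in this case, k is 2x; it is nonzero because
      characteristic 2 is excluded.\<close>
    define k where "k = x \<ominus> \<tau> x"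
    have kU: "k \<in> Units E"
      using homogeneous_unit[OF \<delta>(1) grad_minus[OF \<delta> tau_grad[OF \<delta>]]]
        two_torsion_free[OF x(1) True] by (simp add: k_def)
    have kc: "k \<in> carrier E" using kU by auto
    have k: "\<tau> k = \<ominus> k" using symmetrize xc by (simp add: k_def)
    have "\<tau> a \<otimes> k = k \<otimes> a"
      using x x' xc ac by (simp add: k_def minus_eq l_distr r_distr l_minus r_minus)
    then have "\<tau> (k \<otimes> a) = \<ominus> (k \<otimes> a)" using inv_mult[of k a] kc ac k by (simp add: r_minus)
    \<comment> \<open>Neither k nor ka is symmetric, but tk and tka are, and their quotient is
      a.\<close>
    then have "t \<otimes> (k \<otimes> a) \<in> Sigma_unitary E \<tau>" using kU aU by (intro skew_times_t) auto
    then have "t \<otimes> k \<otimes> a \<in> Sigma_unitary E \<tau>" using t_props kc ac by (simp add: m_assoc)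
    then show ?thesis using Sigma_left_quotient[OF skew_times_t[OF kU k] ac(1)] by simp
  qed
qed

text \<open>If \<open>t \<notin> \<Sigma>\<close>, then \<open>\<tau> = \<plusminus>1\<close> on each homogeneous piece, so
  non-commuting symmetric \<open>x, y\<close> anticommute and \<open>t x y\<close> is symmetric.\<close>

lemma t_mem_Sigma:
  assumes fd: "graded_fin_dim E \<Gamma> grad (ring_center E)"
    and noncomm: "carrier E \<noteq> ring_center E"
  shows "t \<in> Sigma_unitary E \<tau>"
proof (rule ccontr)
  assume tn: "t \<notin> Sigma_unitary E \<tau>"
  note tU = t_props(2) and tc = t_props(1) and tcomm = t_props(3)
  \<comment> \<open>Otherwise s and k below are units of the same degree, one symmetric and one
    skew. Their quotient has degree zero, so k lies in the subgroup together with s; as tk is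
    symmetric, t would lie there too.\<close>
  have sign: "\<tau> x = x \<or> \<tau> x = \<ominus> x" if x: "x \<in> Units E" for x
  proof (rule ccontr)
    assume n: "\<not> ?thesis"
    have xc: "x \<in> carrier E" "\<tau> x \<in> carrier E" using x inv_closed by auto
    obtain \<delta> where \<delta>: "\<delta> \<in> carrier \<Gamma>" "x \<in> grad \<delta>" using Units_homogeneous x by blast
    define s where "s = x \<oplus> \<tau> x"
    define k where "k = x \<ominus> \<tau> x"
    have "s \<noteq> \<zero>"
    proof
      assume "s = \<zero>"
      then have "\<tau> x \<oplus> x = \<zero>" using xc by (simp add: s_def a_comm)
      then show False using n xc minus_equality by metis
    qed
    moreover have "k \<noteq> \<zero>" using n xc unfolding k_def by (metis r_right_minus_eq)
    moreover have g: "s \<in> grad \<delta>" "k \<in> grad \<delta>"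
      using grad_add[OF \<delta> tau_grad[OF \<delta>]] grad_minus[OF \<delta> tau_grad[OF \<delta>]] by (simp_all add: s_def k_def)
    ultimately have U: "s \<in> Units E" "k \<in> Units E" using homogeneous_unit \<delta> by auto
    have "s \<in> Sigma_unitary E \<tau>" using symmetrize xc U by (intro symmetric_mem_Sigma) (auto simp: s_def)
    moreover have "inv s \<otimes> k \<in> Sigma_unitary E \<tau>"
    proof (rule zero_degree_mem_Sigma[OF fd])
      show "inv s \<otimes> k \<in> grad \<one>\<^bsub>\<Gamma>\<^esub>"
        using grad_mult[OF _ \<delta>(1) inv_homogeneous[OF U(1) \<delta>(1) g(1)] g(2)] \<delta> by simp
      show "inv s \<otimes> k \<noteq> \<zero>" using U zero_not_unit Units_m_closed Units_inv_Units by metis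
    qed
    ultimately have "s \<otimes> (inv s \<otimes> k) \<in> Sigma_unitary E \<tau>" by (rule Sigma_mult)
    then have kS: "k \<in> Sigma_unitary E \<tau>" using U by (simp add: m_assoc[symmetric] Units_closed)
    have "t \<otimes> k \<in> Sigma_unitary E \<tau>" using symmetrize xc U by (intro skew_times_t) (auto simp: k_def)
    then have "k \<otimes> t \<in> Sigma_unitary E \<tau>" using tcomm U by (simp add: Units_closed)
    then show False using Sigma_left_quotient[OF kS tc] tn by simp
  qed
  \<comment> \<open>Scaling by the central unit t makes any unit symmetric without affecting which
    pairs commute.\<close>
  have fixed: "\<exists>u\<in>{\<one>, t}. \<tau> (u \<otimes> x) = u \<otimes> x" if x: "x \<in> Units E" for x
  proof -
    have xc: "x \<in> carrier E" using x by auto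
    have "\<tau> (t \<otimes> x) = t \<otimes> x" if "\<tau> x = \<ominus> x"
      using inv_mult[OF tc xc] that tau_t tcomm[OF xc] tc xc by (simp add: l_minus r_minus)
    then show ?thesis using sign[OF x] xc by auto
  qed
  have "\<exists>x\<in>Units E. \<exists>y\<in>Units E. x \<otimes> y \<noteq> y \<otimes> x"
  proof (rule ccontr)
    assume "\<not> ?thesis"
    then have "x \<in> ring_center E" if "x \<in> Units E" for x
      using that central_if_commutes_with_units[of x] by auto
    then have "x \<in> ring_center E" if "x \<in> carrier E" for x
      using that ring_centerD(2) central_if_commutes_with_units[of x] by metis
    then show False using noncomm ring_centerD(1) by blast
  qed
  then obtain x y where xy: "x \<in> Units E" "y \<in> Units E" "x \<otimes> y \<noteq> y \<otimes> x" by blast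
  obtain u v where u: "u \<in> {\<one>, t}" "\<tau> (u \<otimes> x) = u \<otimes> x" and v: "v \<in> {\<one>, t}" "\<tau> (v \<otimes> y) = v \<otimes> y"
    using fixed xy by meson
  define p q where "p = u \<otimes> x" and "q = v \<otimes> y"
  have uv: "u \<in> Units E" "v \<in> Units E" "u \<in> ring_center E" "v \<in> ring_center E"
    using u v tU t subringE(3)[OF ring_center_subring] by auto
  have pq: "p \<in> Units E" "q \<in> Units E" "p \<in> carrier E" "q \<in> carrier E"
    using uv xy by (auto simp: p_def q_def)
  have c: "u \<in> carrier E" "v \<in> carrier E" "x \<in> carrier E" "y \<in> carrier E" using uv xy by auto
  have ne: "p \<otimes> q \<noteq> q \<otimes> p"
  proof
    assume eq: "p \<otimes> q = q \<otimes> p"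
    have "p \<otimes> q = u \<otimes> (x \<otimes> v) \<otimes> y" using c by (simp add: p_def q_def m_assoc)
    also have "x \<otimes> v = v \<otimes> x" using ring_centerD(2)[OF uv(4) c(3)] by simp
    finally have 1: "p \<otimes> q = (u \<otimes> v) \<otimes> (x \<otimes> y)" using c by (simp add: m_assoc)
    have "q \<otimes> p = v \<otimes> (y \<otimes> u) \<otimes> x" using c by (simp add: p_def q_def m_assoc)
    also have "y \<otimes> u = u \<otimes> y" using ring_centerD(2)[OF uv(3) c(4)] by simp
    finally have "q \<otimes> p = (v \<otimes> u) \<otimes> (y \<otimes> x)" using c by (simp add: m_assoc)
    also have "v \<otimes> u = u \<otimes> v" using ring_centerD(2)[OF uv(3) c(2)] by simp
    finally have "(u \<otimes> v) \<otimes> (x \<otimes> y) = (u \<otimes> v) \<otimes> (y \<otimes> x)" using 1 eq by simp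
    then show False using xy uv Units_l_cancel[of "u \<otimes> v" "x \<otimes> y" "y \<otimes> x"] c by simp
  qed
  have pq_sym: "\<tau> p = p" "\<tau> q = q" using u v by (simp_all add: p_def q_def)
  have tau_pq: "\<tau> (p \<otimes> q) = q \<otimes> p" using inv_mult[OF pq(3,4)] pq_sym by simp
  \<comment> \<open>As \<tau>(pq) = qp differs from pq, only the minus sign remains. Now pq is a
    product of symmetric units while t pq is symmetric itself, which forces t into the
    subgroup.\<close>
  then have "\<tau> (p \<otimes> q) = \<ominus> (p \<otimes> q)" using sign[of "p \<otimes> q"] pq ne by auto
  then have "t \<otimes> (p \<otimes> q) \<in> Sigma_unitary E \<tau>" using pq by (intro skew_times_t) auto
  then have "(p \<otimes> q) \<otimes> t \<in> Sigma_unitary E \<tau>" using tcomm[of "p \<otimes> q"] pq by simp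
  moreover have "p \<otimes> q \<in> Sigma_unitary E \<tau>"
    using symmetric_mem_Sigma pq pq_sym Sigma_mult by blast
  ultimately show False using Sigma_left_quotient tc tn by blast
qed

lemma Sigma_eq_Units:
  assumes fd: "graded_fin_dim E \<Gamma> grad (ring_center E)"
    and noncomm: "carrier E \<noteq> ring_center E"
  shows "Sigma_unitary E \<tau> = Units E"
proof (intro equalityI subsetI)
  fix x assume x: "x \<in> Units E"
  have xc: "x \<in> carrier E" "\<tau> x \<in> carrier E" using x inv_closed by auto
  obtain \<delta> where \<delta>: "\<delta> \<in> carrier \<Gamma>" "x \<in> grad \<delta>" using Units_homogeneous x by blast
  show "x \<in> Sigma_unitary E \<tau>"
  proof (cases "x \<oplus> \<tau> x = \<zero>")
    case True
    then have "\<tau> x = \<ominus> x" using xc by (metis a_comm minus_equality)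
    then show ?thesis
      using Sigma_left_quotient[OF t_mem_Sigma[OF assms] xc(1)] skew_times_t x by blast
  next
    case False
    define s where "s = x \<oplus> \<tau> x"
    have g: "s \<in> grad \<delta>" using grad_add[OF \<delta> tau_grad[OF \<delta>]] by (simp add: s_def)
    have U: "s \<in> Units E" using homogeneous_unit[OF \<delta>(1) g] False by (simp add: s_def)
    have "s \<in> Sigma_unitary E \<tau>" using symmetrize xc U by (intro symmetric_mem_Sigma) (auto simp: s_def)
    moreover have "inv s \<otimes> x \<in> Sigma_unitary E \<tau>"
    proof (rule zero_degree_mem_Sigma[OF fd])
      show "inv s \<otimes> x \<in> grad \<one>\<^bsub>\<Gamma>\<^esub>"
        using grad_mult[OF _ \<delta>(1) inv_homogeneous[OF U \<delta>(1) g] \<delta>(2)] \<delta> by simp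
      show "inv s \<otimes> x \<noteq> \<zero>" using U x zero_not_unit Units_m_closed Units_inv_Units by metis
    qed
    ultimately have "s \<otimes> (inv s \<otimes> x) \<in> Sigma_unitary E \<tau>" by (rule Sigma_mult)
    then show ?thesis using U xc by (simp add: m_assoc[symmetric] Units_closed)
  qed
qed (use Sigma_subset in blast)

end

end

section \<open>Splitting a division algebra by a maximal subfield\<close>

text \<open>The splitting field is \<open>R\<close> with its carrier replaced, and finite sums are
  formally different operations in the two records.\<close>

lemma (in ring) finsum_subring:
  assumes "subring C R" "finite A" "f \<in> A \<rightarrow> C"
  shows "finsum (R\<lparr>carrier := C\<rparr>) f A = finsum R f A"
  using assms(2,3)
proof (induction A rule: finite_induct)
  interpret L: ring "R\<lparr>carrier := C\<rparr>" by (rule subring_is_ring[OF assms(1)])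
  note CE = subringE[OF assms(1)]
  case empty
  then show ?case using L.finsum_empty[of f] by simp
next
  interpret L: ring "R\<lparr>carrier := C\<rparr>" by (rule subring_is_ring[OF assms(1)])
  note CE = subringE[OF assms(1)]
  case (insert x F)
  then have f: "f \<in> F \<rightarrow> C" "f x \<in> C" by auto
  then have "f \<in> F \<rightarrow> carrier R" "f x \<in> carrier R" using CE(1) by auto
  then show ?case using insert f L.finsum_insert[of F x f] by simp
qed

lemma (in abelian_monoid) finsum_swap:
  assumes "finite A" "finite B" "\<And>a b. \<lbrakk>a \<in> A; b \<in> B\<rbrakk> \<Longrightarrow> f a b \<in> carrier G"
  shows "(\<Oplus>a\<in>A. \<Oplus>b\<in>B. f a b) = (\<Oplus>b\<in>B. \<Oplus>a\<in>A. f a b)"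
  using assms(1,3)
proof (induction A rule: finite_induct)
  case (insert x F)
  then have c: "(\<lambda>b. \<Oplus>a\<in>F. f a b) \<in> B \<rightarrow> carrier G" "f x \<in> B \<rightarrow> carrier G"
    by (auto intro!: finsum_closed)
  have "(\<Oplus>a\<in>insert x F. \<Oplus>b\<in>B. f a b) = (\<Oplus>b\<in>B. f x b) \<oplus> (\<Oplus>a\<in>F. \<Oplus>b\<in>B. f a b)"
    using insert c by (subst finsum_insert) (auto intro!: finsum_closed)
  also have "(\<Oplus>a\<in>F. \<Oplus>b\<in>B. f a b) = (\<Oplus>b\<in>B. \<Oplus>a\<in>F. f a b)" using insert by blast
  also have "(\<Oplus>b\<in>B. f x b) \<oplus> (\<Oplus>b\<in>B. \<Oplus>a\<in>F. f a b) = (\<Oplus>b\<in>B. f x b \<oplus> (\<Oplus>a\<in>F. f a b))"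
    using c by (intro finsum_addf[symmetric]) auto
  also have "\<dots> = (\<Oplus>b\<in>B. \<Oplus>a\<in>insert x F. f a b)"
    using insert c by (intro finsum_cong') (auto intro!: finsum_closed simp: finsum_insert)
  finally show ?case .
qed simp

section \<open>Matrices as extensional functions on pairs of indices\<close>

lemma mat_ring_simps:
  "carrier (mat_ring L n) = {..<n} \<times> {..<n} \<rightarrow>\<^sub>E carrier L"
  "M \<otimes>\<^bsub>mat_ring L n\<^esub> N = (\<lambda>(i, j) \<in> {..<n} \<times> {..<n}. \<Oplus>\<^bsub>L\<^esub>k\<in>{..<n}. M (i, k) \<otimes>\<^bsub>L\<^esub> N (k, j))"
  "M \<oplus>\<^bsub>mat_ring L n\<^esub> N = (\<lambda>(i, j) \<in> {..<n} \<times> {..<n}. M (i, j) \<oplus>\<^bsub>L\<^esub> N (i, j))"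
  "\<one>\<^bsub>mat_ring L n\<^esub> = (\<lambda>(i, j) \<in> {..<n} \<times> {..<n}. if i = j then \<one>\<^bsub>L\<^esub> else \<zero>\<^bsub>L\<^esub>)"
  "\<zero>\<^bsub>mat_ring L n\<^esub> = (\<lambda>(i, j) \<in> {..<n} \<times> {..<n}. \<zero>\<^bsub>L\<^esub>)"
  by (simp_all add: mat_ring_def)

lemma mat_eqI:
  assumes "M \<in> extensional ({..<n} \<times> {..<n})" "N \<in> extensional ({..<n} \<times> {..<n})"
    and "\<And>i j. \<lbrakk>i < n; j < n\<rbrakk> \<Longrightarrow> M (i, j) = N (i, j)"
  shows "M = N"
  using assms by (intro extensionalityI[of _ "{..<n} \<times> {..<n}"]) auto

text \<open>The additive structure gives meaning to indexed sums of matrices, which can then be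
  evaluated entry by entry.\<close>

lemma (in ring) abelian_monoid_mat_ring: "abelian_monoid (mat_ring R n)"
proof (rule abelian_monoidI)
  fix M N assume "M \<in> carrier (mat_ring R n)" "N \<in> carrier (mat_ring R n)"
  then show "M \<oplus>\<^bsub>mat_ring R n\<^esub> N \<in> carrier (mat_ring R n)"
    by (auto simp: mat_ring_simps PiE_iff)
next
  show "\<zero>\<^bsub>mat_ring R n\<^esub> \<in> carrier (mat_ring R n)" by (auto simp: mat_ring_simps)
next
  fix M N P assume "M \<in> carrier (mat_ring R n)" "N \<in> carrier (mat_ring R n)" "P \<in> carrier (mat_ring R n)"
  then show "M \<oplus>\<^bsub>mat_ring R n\<^esub> N \<oplus>\<^bsub>mat_ring R n\<^esub> P = M \<oplus>\<^bsub>mat_ring R n\<^esub> (N \<oplus>\<^bsub>mat_ring R n\<^esub> P)"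
    by (intro mat_eqI[where n = n]) (auto simp: mat_ring_simps PiE_iff a_assoc)
next
  fix M assume M: "M \<in> carrier (mat_ring R n)"
  then show "\<zero>\<^bsub>mat_ring R n\<^esub> \<oplus>\<^bsub>mat_ring R n\<^esub> M = M"
    by (intro mat_eqI[where n = n]) (auto simp: mat_ring_simps PiE_iff)
next
  fix M N assume "M \<in> carrier (mat_ring R n)" "N \<in> carrier (mat_ring R n)"
  then show "M \<oplus>\<^bsub>mat_ring R n\<^esub> N = N \<oplus>\<^bsub>mat_ring R n\<^esub> M"
    by (intro mat_eqI[where n = n]) (auto simp: mat_ring_simps PiE_iff a_comm)
qed

lemma (in ring) mat_ring_finsum_entry:
  assumes "finite A" "f \<in> A \<rightarrow> carrier (mat_ring R n)" "i < n" "j < n"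
  shows "finsum (mat_ring R n) f A (i, j) = (\<Oplus>a\<in>A. f a (i, j))"
  using assms(1,2)
proof (induction A rule: finite_induct)
  interpret M: abelian_monoid "mat_ring R n" by (rule abelian_monoid_mat_ring)
  case empty
  then show ?case using assms(3,4) by (simp add: mat_ring_simps)
next
  interpret M: abelian_monoid "mat_ring R n" by (rule abelian_monoid_mat_ring)
  case (insert x F)
  then have f: "f \<in> F \<rightarrow> carrier (mat_ring R n)" "f x \<in> carrier (mat_ring R n)" by auto
  have e: "P (i, j) \<in> carrier R" if "P \<in> carrier (mat_ring R n)" for P
    using that assms(3,4) by (auto simp: mat_ring_simps)
  have "(\<lambda>a. f a (i, j)) \<in> F \<rightarrow> carrier R" "f x (i, j) \<in> carrier R"
    using f e by blast+
  then show ?case using insert f assms(3,4) by (simp add: mat_ring_simps)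
qed

lemma (in ring) scalar_mat_mult_entry:
  assumes "c \<in> carrier R" "M \<in> carrier (mat_ring R n)" "i < n" "j < n"
  shows "(scalar_mat R n c \<otimes>\<^bsub>mat_ring R n\<^esub> M) (i, j) = c \<otimes> M (i, j)"
proof -
  have M: "M (k, j) \<in> carrier R" if "k < n" for k using assms that by (auto simp: mat_ring_simps)
  have "(scalar_mat R n c \<otimes>\<^bsub>mat_ring R n\<^esub> M) (i, j)
      = (\<Oplus>k\<in>{..<n}. scalar_mat R n c (i, k) \<otimes> M (k, j))"
    using assms(3,4) by (simp add: mat_ring_simps)
  also have "\<dots> = scalar_mat R n c (i, i) \<otimes> M (i, j)"
    using assms M by (intro finsum_only_nonzero) (auto simp: scalar_mat_def)
  finally show ?thesis using assms(3) by (simp add: scalar_mat_def)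
qed

lemma (in ring) mat_mult_closed:
  assumes "M \<in> carrier (mat_ring R n)" "N \<in> carrier (mat_ring R n)"
  shows "M \<otimes>\<^bsub>mat_ring R n\<^esub> N \<in> carrier (mat_ring R n)"
  using assms by (auto simp: mat_ring_simps PiE_iff intro!: finsum_closed)

lemma (in ring) scalar_mat_closed: "c \<in> carrier R \<Longrightarrow> scalar_mat R n c \<in> carrier (mat_ring R n)"
  by (auto simp: mat_ring_simps scalar_mat_def)

section \<open>Finite-dimensional division algebras and self-centralizing subfields\<close>

locale division_algebra = ring R for R (structure) +
  fixes B
  assumes one_not_zero: "\<one> \<noteq> \<zero>"
    and nonzero_unit: "\<lbrakk>x \<in> carrier R; x \<noteq> \<zero>\<rbrakk> \<Longrightarrow> x \<in> Units R"
    and basis: "module_basis R (ring_center R) B"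
begin

lemma finite_B: "finite B" and B_closed: "b \<in> B \<Longrightarrow> b \<in> carrier R"
  using basis by (auto simp: module_basis_def)

lemma B_coeffs:
  assumes "x \<in> carrier R"
  obtains k where "\<And>b. b \<in> B \<Longrightarrow> k b \<in> ring_center R" "x = (\<Oplus>b\<in>B. k b \<otimes> b)"
proof -
  obtain c where c: "c \<in> B \<rightarrow>\<^sub>E ring_center R" "x = (\<Oplus>b\<in>B. c b \<otimes> b)"
    using basis assms unfolding module_basis_def by blast
  show ?thesis using that[of c] c PiE_mem[OF c(1)] by blast
qed

lemma B_independent:
  assumes w: "\<And>b. b \<in> B \<Longrightarrow> w b \<in> ring_center R" and "(\<Oplus>b\<in>B. w b \<otimes> b) = \<zero>" and "b \<in> B"
  shows "w b = \<zero>"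
proof -
  have z: "\<zero> \<in> ring_center R" using subringE(2)[OF ring_center_subring] .
  have ex1: "\<exists>!c. c \<in> B \<rightarrow>\<^sub>E ring_center R \<and> \<zero> = (\<Oplus>b\<in>B. c b \<otimes> b)"
    using basis zero_closed unfolding module_basis_def by blast
  have wc: "w b \<in> carrier R" if "b \<in> B" for b using w[OF that] ring_centerD by blast
  have "(\<Oplus>b\<in>B. restrict w B b \<otimes> b) = (\<Oplus>b\<in>B. w b \<otimes> b)"
    using wc B_closed by (intro finsum_cong') auto
  then have 1: "restrict w B \<in> B \<rightarrow>\<^sub>E ring_center R \<and> \<zero> = (\<Oplus>b\<in>B. restrict w B b \<otimes> b)"
    using w assms(2) by auto
  have "(\<Oplus>b\<in>B. restrict (\<lambda>_. \<zero>) B b \<otimes> b) = (\<Oplus>b\<in>B. \<zero>)"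
    using B_closed by (intro finsum_cong') auto
  then have 2: "restrict (\<lambda>_. \<zero>) B \<in> B \<rightarrow>\<^sub>E ring_center R \<and> \<zero> = (\<Oplus>b\<in>B. restrict (\<lambda>_. \<zero>) B b \<otimes> b)"
    using z by auto
  have "restrict w B = restrict (\<lambda>_. \<zero>) B" using ex1 1 2 by blast
  then show ?thesis using assms(3) by (metis restrict_apply')
qed

text \<open>Zorn is applied to commuting subsets instead of subfields, for which unions of chains
  are immediate. A maximal such set contains every element commuting with it, and closure under the
  field operations follows from this alone.\<close>

lemma exists_self_centralizing_subfield:
  obtains C where "subfield C R" "ring_center R \<subseteq> C"
    "\<And>x. \<lbrakk>x \<in> carrier R; \<And>c. c \<in> C \<Longrightarrow> c \<otimes> x = x \<otimes> c\<rbrakk> \<Longrightarrow> x \<in> C"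
proof -
  define comm where "comm S \<longleftrightarrow> S \<subseteq> carrier R \<and> (\<forall>x\<in>S. \<forall>y\<in>S. x \<otimes> y = y \<otimes> x)" for S
  have "\<exists>M\<in>Collect comm. \<forall>Q\<in>Collect comm. M \<subseteq> Q \<longrightarrow> Q = M"
  proof (rule subset_Zorn_nonempty)
    show "Collect comm \<noteq> {}" by (auto simp: comm_def intro!: exI[of _ "{}"])
  next
    fix \<C> assume ch: "subset.chain (Collect comm) \<C>"
    have c: "comm S" if "S \<in> \<C>" for S using ch that by (auto simp: subset_chain_def)
    have tot: "S \<subseteq> T \<or> T \<subseteq> S" if "S \<in> \<C>" "T \<in> \<C>" for S T
      using ch that by (auto simp: subset_chain_def)
    have "\<Union>\<C> \<subseteq> carrier R" using c unfolding comm_def by blast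
    moreover have "x \<otimes> y = y \<otimes> x" if xy: "x \<in> \<Union>\<C>" "y \<in> \<Union>\<C>" for x y
    proof -
      obtain S T where "x \<in> S" "S \<in> \<C>" "y \<in> T" "T \<in> \<C>" using xy by blast
      moreover from this have "S \<union> T = S \<or> S \<union> T = T" using tot by blast
      ultimately show ?thesis using c unfolding comm_def by blast
    qed
    ultimately show "\<Union>\<C> \<in> Collect comm" unfolding comm_def by blast
  qed
  then obtain C where C: "comm C" and max: "\<And>S. \<lbrakk>comm S; C \<subseteq> S\<rbrakk> \<Longrightarrow> S = C" by blast
  have Cc: "x \<in> carrier R" if "x \<in> C" for x using C that by (auto simp: comm_def)
  have CC: "x \<otimes> y = y \<otimes> x" if "x \<in> C" "y \<in> C" for x y using C that by (auto simp: comm_def)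
  have cent: "x \<in> C" if x: "x \<in> carrier R" "\<And>c. c \<in> C \<Longrightarrow> c \<otimes> x = x \<otimes> c" for x
  proof -
    have "comm (insert x C)" unfolding comm_def
    proof (intro conjI ballI)
      fix y z assume "y \<in> insert x C" "z \<in> insert x C"
      then show "y \<otimes> z = z \<otimes> y" using CC x(2) by auto
    qed (use Cc x in auto)
    then show ?thesis using max[of "insert x C"] by blast
  qed
  have sub: "subring C R"
  proof (rule subringI)
    fix x assume x: "x \<in> C"
    show "\<ominus> x \<in> C" using x Cc CC by (intro cent) (auto simp: l_minus r_minus)
    fix y assume y: "y \<in> C"
    show "x \<otimes> y \<in> C"
    proof (rule cent)
      fix c assume c: "c \<in> C"
      note m = Cc[OF x] Cc[OF y] Cc[OF c]
      have "c \<otimes> (x \<otimes> y) = (c \<otimes> x) \<otimes> y" using m by (simp add: m_assoc)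
      also have "\<dots> = x \<otimes> (c \<otimes> y)" using CC[OF c x] m by (simp add: m_assoc)
      also have "\<dots> = (x \<otimes> y) \<otimes> c" using CC[OF c y] m by (simp add: m_assoc)
      finally show "c \<otimes> (x \<otimes> y) = (x \<otimes> y) \<otimes> c" .
    qed (use x y Cc in auto)
    show "x \<oplus> y \<in> C" using x y Cc CC by (intro cent) (auto simp: l_distr r_distr)
  qed (use Cc in \<open>auto intro: cent\<close>)
  have inv: "inv x \<in> C" if x: "x \<in> C" "x \<noteq> \<zero>" for x
  proof (rule cent)
    have xU: "x \<in> Units R" using nonzero_unit Cc x by blast
    then show "inv x \<in> carrier R" by simp
    fix c assume c: "c \<in> C"
    note m = Cc[OF x(1)] Units_inv_closed[OF xU] Cc[OF c]
    have "c \<otimes> inv x = inv x \<otimes> (x \<otimes> c) \<otimes> inv x" using m xU by (simp add: m_assoc[symmetric])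
    also have "\<dots> = inv x \<otimes> (c \<otimes> x) \<otimes> inv x" using CC[OF x(1) c] by simp
    also have "\<dots> = inv x \<otimes> c" using m xU by (simp add: m_assoc)
    finally show "c \<otimes> inv x = inv x \<otimes> c" .
  qed
  show ?thesis
  proof (rule that[of C])
    show "subfield C R"
      using nonzero_unit Cc inv one_not_zero
      by (intro subfield_of_commuting_invertible[OF sub CC]) auto
    show "ring_center R \<subseteq> C"
    proof
      fix z assume z: "z \<in> ring_center R"
      show "z \<in> C" using ring_centerD(1)[OF z] ring_centerD(2)[OF z Cc] by (intro cent) auto
    qed
  qed (rule cent)
qed

end

section \<open>The algebra as a left vector space over a maximal subfield\<close>

locale maximal_subfield_basis = division_algebra R B for R (structure) and B +
  fixes C Us
  assumes C: "subfield C R" and center_C: "ring_center R \<subseteq> C"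
    and centralizer: "\<lbrakk>x \<in> carrier R; \<And>c. c \<in> C \<Longrightarrow> c \<otimes> x = x \<otimes> c\<rbrakk> \<Longrightarrow> x \<in> C"
    and indep: "independent C Us" and span: "Span C Us = carrier R"
begin

lemmas CE = subringE[OF subfieldE(1)[OF C]]

lemma C_comm: "\<lbrakk>x \<in> C; y \<in> C\<rbrakk> \<Longrightarrow> x \<otimes> y = y \<otimes> x"
  using subfieldE(4)[OF C] .

lemma C_closed: "x \<in> C \<Longrightarrow> x \<in> carrier R"
  using CE(1) by blast

lemma Us_closed: "i < length Us \<Longrightarrow> Us ! i \<in> carrier R"
  using independent_in_carrier[OF indep] by auto

text \<open>The image of \<open>R \<otimes> C\<close> in the endomorphisms of the left \<open>C\<close>-space \<open>R\<close>.\<close>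

definition op :: "('a \<Rightarrow> 'a) \<Rightarrow> 'a \<Rightarrow> 'a" where
  "op c x = (\<Oplus>b\<in>B. c b \<otimes> x \<otimes> b)"

lemma op_term_closed:
  "\<lbrakk>c \<in> B \<rightarrow> C; x \<in> carrier R; b \<in> B\<rbrakk> \<Longrightarrow> c b \<otimes> x \<otimes> b \<in> carrier R"
  using C_closed B_closed by auto

lemma op_closed: "\<lbrakk>c \<in> B \<rightarrow> C; x \<in> carrier R\<rbrakk> \<Longrightarrow> op c x \<in> carrier R"
  unfolding op_def using op_term_closed by (intro finsum_closed) auto

lemma op_add:
  assumes c: "c \<in> B \<rightarrow> C" and x: "x \<in> carrier R" and y: "y \<in> carrier R"
  shows "op c (x \<oplus> y) = op c x \<oplus> op c y"
proof -
  have "op c (x \<oplus> y) = (\<Oplus>b\<in>B. c b \<otimes> x \<otimes> b \<oplus> c b \<otimes> y \<otimes> b)"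
    unfolding op_def
  proof (intro finsum_cong')
    fix b assume b: "b \<in> B"
    then have "c b \<in> carrier R" "b \<in> carrier R" using c C_closed B_closed by auto
    then show "c b \<otimes> (x \<oplus> y) \<otimes> b = c b \<otimes> x \<otimes> b \<oplus> c b \<otimes> y \<otimes> b"
      using x y by (simp add: l_distr r_distr)
  qed (use op_term_closed[OF c] x y in auto)
  then show ?thesis
    unfolding op_def using op_term_closed[OF c x] op_term_closed[OF c y] by (simp add: finsum_addf)
qed

lemma op_smult:
  assumes c: "c \<in> B \<rightarrow> C" and l: "l \<in> C" and x: "x \<in> carrier R"
  shows "op c (l \<otimes> x) = l \<otimes> op c x" and "op (\<lambda>b. l \<otimes> c b) x = l \<otimes> op c x"
proof -
  have lc: "l \<in> carrier R" using l C_closed by blast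
  have "l \<otimes> op c x = (\<Oplus>b\<in>B. l \<otimes> (c b \<otimes> x \<otimes> b))"
    unfolding op_def using op_term_closed[OF c x] lc finite_B by (intro finsum_rdistr) auto
  moreover have "l \<otimes> (c b \<otimes> x \<otimes> b) = l \<otimes> c b \<otimes> x \<otimes> b" if "b \<in> B" for b
    using that c C_closed[of "c b"] B_closed[of b] lc x by (simp add: m_assoc Pi_iff)
  moreover have "l \<otimes> (c b \<otimes> x \<otimes> b) = c b \<otimes> (l \<otimes> x) \<otimes> b" if b: "b \<in> B" for b
  proof -
    have cb: "c b \<in> C" "c b \<in> carrier R" "b \<in> carrier R" using c b C_closed B_closed by auto
    have "l \<otimes> (c b \<otimes> x \<otimes> b) = (l \<otimes> c b) \<otimes> x \<otimes> b" using cb lc x by (simp add: m_assoc)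
    also have "l \<otimes> c b = c b \<otimes> l" using C_comm l cb by simp
    finally show ?thesis using cb lc x by (simp add: m_assoc)
  qed
  ultimately show "op c (l \<otimes> x) = l \<otimes> op c x" "op (\<lambda>b. l \<otimes> c b) x = l \<otimes> op c x"
    unfolding op_def using op_term_closed[OF c x] lc
    by (auto intro!: finsum_cong' simp: Pi_iff)
qed

lemma op_coeff_diff:
  assumes c: "c \<in> B \<rightarrow> C" and c': "c' \<in> B \<rightarrow> C" and x: "x \<in> carrier R"
  shows "op (\<lambda>b. c b \<ominus> c' b) x = op c x \<ominus> op c' x"
proof -
  have "op (\<lambda>b. c b \<ominus> c' b) x = (\<Oplus>b\<in>B. c b \<otimes> x \<otimes> b \<oplus> \<ominus> \<one> \<otimes> (c' b \<otimes> x \<otimes> b))"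
    unfolding op_def
  proof (intro finsum_cong')
    fix b assume b: "b \<in> B"
    then have "c b \<in> carrier R" "c' b \<in> carrier R" "b \<in> carrier R" using c c' C_closed B_closed by auto
    then show "(c b \<ominus> c' b) \<otimes> x \<otimes> b = c b \<otimes> x \<otimes> b \<oplus> \<ominus> \<one> \<otimes> (c' b \<otimes> x \<otimes> b)"
      using x by (simp add: minus_eq l_distr l_minus)
  qed (use op_term_closed[OF c x] op_term_closed[OF c' x] in auto)
  also have "\<dots> = op c x \<oplus> (\<Oplus>b\<in>B. \<ominus> \<one> \<otimes> (c' b \<otimes> x \<otimes> b))"
    unfolding op_def using op_term_closed[OF c x] op_term_closed[OF c' x] by (intro finsum_addf) auto
  also have "(\<Oplus>b\<in>B. \<ominus> \<one> \<otimes> (c' b \<otimes> x \<otimes> b)) = \<ominus> \<one> \<otimes> op c' x"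
    unfolding op_def using op_term_closed[OF c' x] finite_B by (intro finsum_rdistr[symmetric]) auto
  finally show ?thesis using op_closed[OF c' x] by (simp add: minus_eq l_minus)
qed

lemma coeff_diff_closed: "\<lbrakk>c \<in> B \<rightarrow> C; c' \<in> B \<rightarrow> C\<rbrakk> \<Longrightarrow> (\<lambda>b. c b \<ominus> c' b) \<in> B \<rightarrow> C"
  unfolding minus_eq by (intro Pi_I CE(7) CE(5)) auto

text \<open>The coefficients are those of 1 in the basis \<open>B\<close>; being central, they can
  be moved past x.\<close>

lemma op_id: "\<exists>c\<in>B \<rightarrow> C. \<forall>x\<in>carrier R. op c x = x"
proof -
  obtain k where k: "\<And>b. b \<in> B \<Longrightarrow> k b \<in> ring_center R" "\<one> = (\<Oplus>b\<in>B. k b \<otimes> b)"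
    using B_coeffs[OF one_closed] by blast
  have kC: "k \<in> B \<rightarrow> C" using k(1) center_C by auto
  have "op k x = x" if x: "x \<in> carrier R" for x
  proof -
    have "op k x = (\<Oplus>b\<in>B. x \<otimes> (k b \<otimes> b))"
      unfolding op_def
    proof (intro finsum_cong')
      fix b assume b: "b \<in> B"
      have "k b \<otimes> x = x \<otimes> k b" by (rule ring_centerD(2)[OF k(1)[OF b] x])
      then show "k b \<otimes> x \<otimes> b = x \<otimes> (k b \<otimes> b)"
        using ring_centerD(1)[OF k(1)[OF b]] B_closed[OF b] x by (simp add: m_assoc)
    qed (use ring_centerD(1)[OF k(1)] B_closed x in auto)
    also have "\<dots> = x \<otimes> (\<Oplus>b\<in>B. k b \<otimes> b)"
      using ring_centerD(1)[OF k(1)] B_closed x finite_B by (intro finsum_rdistr[symmetric]) auto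
    finally show ?thesis unfolding k(2)[symmetric] using x by simp
  qed
  then show ?thesis using kC by blast
qed

text \<open>Closure of the operators under right multiplications makes \<open>R\<close> simple under
  them: any nonzero value can be moved to 1.\<close>

lemma op_right_mult:
  assumes c: "c \<in> B \<rightarrow> C" and d: "d \<in> carrier R"
  shows "\<exists>c'\<in>B \<rightarrow> C. \<forall>x\<in>carrier R. op c' x = op c x \<otimes> d"
proof -
  have "\<exists>k. (\<forall>b'\<in>B. k b' \<in> ring_center R) \<and> b \<otimes> d = (\<Oplus>b'\<in>B. k b' \<otimes> b')" if "b \<in> B" for b
    using B_coeffs[of "b \<otimes> d"] B_closed[OF that] d by (metis m_closed)
  then obtain k where k: "\<And>b b'. \<lbrakk>b \<in> B; b' \<in> B\<rbrakk> \<Longrightarrow> k b b' \<in> ring_center R"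
    "\<And>b. b \<in> B \<Longrightarrow> b \<otimes> d = (\<Oplus>b'\<in>B. k b b' \<otimes> b')" by metis
  have kc: "k b b' \<in> carrier R" if "b \<in> B" "b' \<in> B" for b b' using k(1)[OF that] ring_centerD by blast
  have cc: "c b \<in> carrier R" if "b \<in> B" for b using c that C_closed by auto
  \<comment> \<open>Here \<open>k b b'\<close> are the structure constants of right multiplication
    by d; they are central, so they pass x and are absorbed by the coefficients on the left.\<close>
  define c' where "c' b' = (\<Oplus>b\<in>B. c b \<otimes> k b b')" for b'
  have c'C: "c' \<in> B \<rightarrow> C"
  proof
    fix b' assume b': "b' \<in> B"
    have add: "additive_subgroup C R"
      using subring.axioms(1)[OF subfieldE(1)[OF C]] by (rule additive_subgroup.intro)
    show "c' b' \<in> C"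
      unfolding c'_def
    proof (rule finsum_mem_subgroup[OF add finite_B], rule Pi_I)
      fix b assume "b \<in> B"
      then show "c b \<otimes> k b b' \<in> C" using k(1)[OF _ b'] center_C c by (intro CE(6)) auto
    qed
  qed
  have "op c' x = op c x \<otimes> d" if x: "x \<in> carrier R" for x
  proof -
    have "op c x \<otimes> d = (\<Oplus>b\<in>B. c b \<otimes> x \<otimes> b \<otimes> d)"
      unfolding op_def using op_term_closed[OF c x] d finite_B by (intro finsum_ldistr) auto
    also have "\<dots> = (\<Oplus>b\<in>B. \<Oplus>b'\<in>B. c b \<otimes> k b b' \<otimes> x \<otimes> b')"
    proof (intro finsum_cong')
      fix b assume b: "b \<in> B"
      have "c b \<otimes> x \<otimes> b \<otimes> d = c b \<otimes> x \<otimes> (b \<otimes> d)"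
        using cc[OF b] x B_closed[OF b] d by (simp add: m_assoc)
      also have "\<dots> = (\<Oplus>b'\<in>B. c b \<otimes> x \<otimes> (k b b' \<otimes> b'))"
        unfolding k(2)[OF b] using cc[OF b] x kc[OF b] B_closed finite_B by (intro finsum_rdistr) auto
      also have "\<dots> = (\<Oplus>b'\<in>B. c b \<otimes> k b b' \<otimes> x \<otimes> b')"
      proof (intro finsum_cong')
        fix b' assume b': "b' \<in> B"
        have "x \<otimes> k b b' = k b b' \<otimes> x" using ring_centerD(2)[OF k(1)[OF b b'] x] by simp
        moreover have "c b \<otimes> x \<otimes> (k b b' \<otimes> b') = c b \<otimes> (x \<otimes> k b b') \<otimes> b'"
          using cc[OF b] x kc[OF b b'] B_closed[OF b'] by (simp add: m_assoc)
        ultimately show "c b \<otimes> x \<otimes> (k b b' \<otimes> b') = c b \<otimes> k b b' \<otimes> x \<otimes> b'"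
          using cc[OF b] x kc[OF b b'] B_closed[OF b'] by (simp add: m_assoc)
      qed (use cc[OF b] x kc[OF b] B_closed in auto)
      finally show "c b \<otimes> x \<otimes> b \<otimes> d = (\<Oplus>b'\<in>B. c b \<otimes> k b b' \<otimes> x \<otimes> b')" .
    qed (use cc x kc B_closed in \<open>auto intro!: finsum_closed\<close>)
    also have "\<dots> = (\<Oplus>b'\<in>B. \<Oplus>b\<in>B. c b \<otimes> k b b' \<otimes> x \<otimes> b')"
      using cc x kc B_closed finite_B by (intro finsum_swap) auto
    also have "\<dots> = op c' x"
      unfolding op_def
    proof (intro finsum_cong')
      fix b' assume b': "b' \<in> B"
      have "(\<Oplus>b\<in>B. c b \<otimes> k b b' \<otimes> x \<otimes> b') = (\<Oplus>b\<in>B. c b \<otimes> k b b' \<otimes> (x \<otimes> b'))"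
        using cc x kc[OF _ b'] B_closed[OF b'] by (intro finsum_cong') (auto simp: m_assoc)
      also have "\<dots> = c' b' \<otimes> (x \<otimes> b')"
        unfolding c'_def using cc x kc[OF _ b'] B_closed[OF b'] finite_B
        by (intro finsum_ldistr[symmetric]) auto
      finally show "(\<Oplus>b\<in>B. c b \<otimes> k b b' \<otimes> x \<otimes> b') = c' b' \<otimes> x \<otimes> b'"
        using c'C b' C_closed x B_closed[OF b'] by (simp add: m_assoc Pi_iff)
    qed (use op_term_closed[OF c'C x] in auto)
    finally show ?thesis by simp
  qed
  then show ?thesis using c'C by blast
qed

text \<open>Jacobson density for the simple module \<open>R\<close> over \<open>R \<otimes> C\<close>, whose endomorphism ring is
  the centralizer of \<open>C\<close>.\<close>

lemma mem_Span_if_annihilated: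
  assumes "set Vs \<subseteq> carrier R" "y \<in> carrier R"
    and "\<And>c. \<lbrakk>c \<in> B \<rightarrow> C; \<forall>v\<in>set Vs. op c v = \<zero>\<rbrakk> \<Longrightarrow> op c y = \<zero>"
  shows "y \<in> Span C Vs"
  using assms
proof (induction Vs arbitrary: y)
  case Nil
  obtain c where c: "c \<in> B \<rightarrow> C" "\<forall>x\<in>carrier R. op c x = x" using op_id by blast
  then have "y = \<zero>" using Nil(3)[OF c(1)] Nil(2) by simp
  then show ?case by simp
next
  case (Cons u Vs)
  have u: "u \<in> carrier R" and Vs: "set Vs \<subseteq> carrier R" using Cons.prems by auto
  define A where "A = {c \<in> B \<rightarrow> C. \<forall>v\<in>set Vs. op c v = \<zero>}"
  show ?case
  proof (cases "\<forall>c\<in>A. op c u = \<zero>")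
    case True
    have "y \<in> Span C Vs"
    proof (rule Cons.IH[OF Vs Cons.prems(2)])
      fix c assume c: "c \<in> B \<rightarrow> C" "\<forall>v\<in>set Vs. op c v = \<zero>"
      then have "op c u = \<zero>" using True by (simp add: A_def)
      then show "op c y = \<zero>" using Cons.prems(3)[OF c(1)] c(2) by simp
    qed
    then show ?thesis using mono_Span[OF C Vs u] by blast
  next
    case False
    then obtain c1 where c1: "c1 \<in> A" "op c1 u \<noteq> \<zero>" by blast
    have c1C: "c1 \<in> B \<rightarrow> C" using c1 by (simp add: A_def)
    have c1U: "op c1 u \<in> Units R" using nonzero_unit op_closed[OF c1C u] c1 by blast
    \<comment> \<open>Right multiplication by the inverse value produces an operator that kills
      \<open>Vs\<close> and sends u to 1.\<close>
    obtain c0 where c0: "c0 \<in> B \<rightarrow> C" "\<forall>x\<in>carrier R. op c0 x = op c1 x \<otimes> inv (op c1 u)"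
      using op_right_mult[OF c1C Units_inv_closed[OF c1U]] by blast
    have c0u: "op c0 u = \<one>" using c0 u c1U by simp
    have c0A: "c0 \<in> A"
    proof -
      have "op c0 v = \<zero>" if "v \<in> set Vs" for v
      proof -
        have "v \<in> carrier R" "op c1 v = \<zero>" using that Vs c1 by (auto simp: A_def)
        then show ?thesis using c0 c1U by simp
      qed
      then show ?thesis using c0 by (simp add: A_def)
    qed
    define r where "r = op c0 y"
    have y: "y \<in> carrier R" by fact
    have rc: "r \<in> carrier R" unfolding r_def by (rule op_closed[OF c0(1) y])
    \<comment> \<open>Subtracting from c the operator c0 followed by right multiplication with
      \<open>op c u\<close> gives an operator that kills u as well as \<open>Vs\<close>, hence y by
      assumption.\<close>
    have key: "op c y = r \<otimes> op c u" if c: "c \<in> A" for c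
    proof -
      have cC: "c \<in> B \<rightarrow> C" using c by (simp add: A_def)
      have cu: "op c u \<in> carrier R" by (rule op_closed[OF cC u])
      obtain c2 where c2: "c2 \<in> B \<rightarrow> C" "\<forall>x\<in>carrier R. op c2 x = op c0 x \<otimes> op c u"
        using op_right_mult[OF c0(1) cu] by blast
      let ?d = "\<lambda>b. c b \<ominus> c2 b"
      have dC: "?d \<in> B \<rightarrow> C" by (rule coeff_diff_closed[OF cC c2(1)])
      have d: "op ?d x = op c x \<ominus> op c0 x \<otimes> op c u" if "x \<in> carrier R" for x
        using op_coeff_diff[OF cC c2(1) that] c2(2) that by simp
      have "op ?d y = \<zero>"
      proof (rule Cons.prems(3)[OF dC], intro ballI)
        fix v assume "v \<in> set (u # Vs)"
        then consider "v = u" | "v \<in> set Vs" by auto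
        then show "op ?d v = \<zero>"
        proof cases
          case 1
          then show ?thesis using d[OF u] c0u cu by (simp add: minus_eq r_neg)
        next
          case 2
          then have "v \<in> carrier R" "op c v = \<zero>" "op c0 v = \<zero>" using Vs c c0A by (auto simp: A_def)
          then show ?thesis using d[of v] cu by (simp add: minus_eq)
        qed
      qed
      then have "op c y \<ominus> r \<otimes> op c u = \<zero>" using d[OF y] by (simp add: r_def)
      then show ?thesis using op_closed[OF cC y] rc cu by simp
    qed
    \<comment> \<open>The key identity for the operator l c0, which takes the value l at u and lr at
      y, says that r commutes with every l in \<open>C\<close>.\<close>
    have rC: "r \<in> C"
    proof (rule centralizer[OF rc])
      fix l assume l: "l \<in> C"
      let ?d = "\<lambda>b. l \<otimes> c0 b"
      have dC: "?d \<in> B \<rightarrow> C" using c0 l CE(6) by auto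
      have "op ?d v = \<zero>" if "v \<in> set Vs" for v
      proof -
        have "v \<in> carrier R" "op c0 v = \<zero>" using that Vs c0A by (auto simp: A_def)
        then show ?thesis using op_smult(2)[OF c0(1) l, of v] C_closed[OF l] by simp
      qed
      then have "?d \<in> A" using dC by (simp add: A_def)
      then have "op ?d y = r \<otimes> op ?d u" by (rule key)
      then show "l \<otimes> r = r \<otimes> l"
        using op_smult(2)[OF c0(1) l u] op_smult(2)[OF c0(1) l y] c0u C_closed[OF l]
        by (simp add: r_def)
    qed
    have ru: "\<ominus> r \<otimes> u \<in> carrier R" using rc u by simp
    \<comment> \<open>With r now a scalar, the key identity says that y - ru is killed by every
      operator killing \<open>Vs\<close>, which is the situation of the shorter list.\<close>
    have "y \<oplus> \<ominus> r \<otimes> u \<in> Span C Vs"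
    proof (rule Cons.IH[OF Vs a_closed[OF y ru]])
      fix c assume c: "c \<in> B \<rightarrow> C" "\<forall>v\<in>set Vs. op c v = \<zero>"
      have cu: "op c u \<in> carrier R" by (rule op_closed[OF c(1) u])
      have "op c (y \<oplus> \<ominus> r \<otimes> u) = op c y \<oplus> \<ominus> r \<otimes> op c u"
        using op_add[OF c(1) y ru] op_smult(1)[OF c(1) CE(5)[OF rC] u] by simp
      also have "op c y = r \<otimes> op c u" using key c by (simp add: A_def)
      finally show "op c (y \<oplus> \<ominus> r \<otimes> u) = \<zero>" using rc cu by (simp add: l_minus r_neg)
    qed
    moreover have "y = r \<otimes> u \<oplus> (y \<oplus> \<ominus> r \<otimes> u)"
      using y rc u by (simp add: l_minus r_neg a_lcomm)
    ultimately have "y \<in> line_extension C u (Span C Vs)"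
      unfolding line_extension_mem_iff using rC by blast
    then show ?thesis by simp
  qed
qed

text \<open>The values at the tail are prescribed inductively. The value at the head is then
  corrected by an operator that vanishes on the tail, which exists because u lies outside the span
  of \<open>Vs\<close>.\<close>

lemma op_interpolation:
  assumes "independent C Vs" "\<And>i. i < length Vs \<Longrightarrow> a i \<in> carrier R"
  shows "\<exists>c\<in>B \<rightarrow> C. \<forall>i<length Vs. op c (Vs ! i) = a i"
  using assms
proof (induction Vs arbitrary: a rule: list.induct)
  case Nil
  then show ?case using op_id by auto
next
  case (Cons u Vs)
  have u: "u \<in> carrier R" "u \<notin> Span C Vs" "independent C Vs"
    using independent_backwards[OF Cons.prems(1)] by auto
  have Vs: "set Vs \<subseteq> carrier R" using independent_in_carrier[OF u(3)] .
  have "\<exists>c\<in>B \<rightarrow> C. \<forall>i<length Vs. op c (Vs ! i) = a (Suc i)"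
    using Cons.prems(2) by (intro Cons.IH[OF u(3)]) auto
  then obtain c where c: "c \<in> B \<rightarrow> C" "\<And>i. i < length Vs \<Longrightarrow> op c (Vs ! i) = a (Suc i)" by blast
  obtain h where h: "h \<in> B \<rightarrow> C" "\<forall>v\<in>set Vs. op h v = \<zero>" "op h u \<noteq> \<zero>"
    using mem_Span_if_annihilated[OF Vs u(1)] u(2) by blast
  have hU: "op h u \<in> Units R" using nonzero_unit op_closed[OF h(1) u(1)] h by blast
  have a0: "a 0 \<in> carrier R" using Cons.prems(2)[of 0] by simp
  have cu: "op c u \<in> carrier R" by (rule op_closed[OF c(1) u(1)])
  have d: "inv (op h u) \<otimes> (op c u \<ominus> a 0) \<in> carrier R" using hU cu a0 by simp
  \<comment> \<open>The right factor is chosen so that g takes at u exactly the error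
    \<open>op c u \<ominus> a 0\<close>, while still vanishing on \<open>Vs\<close>.\<close>
  obtain g where g: "g \<in> B \<rightarrow> C" "\<forall>x\<in>carrier R. op g x = op h x \<otimes> (inv (op h u) \<otimes> (op c u \<ominus> a 0))"
    using op_right_mult[OF h(1) d] by blast
  let ?f = "\<lambda>b. c b \<ominus> g b"
  have f: "op ?f x = op c x \<ominus> op h x \<otimes> (inv (op h u) \<otimes> (op c u \<ominus> a 0))" if "x \<in> carrier R" for x
    using op_coeff_diff[OF c(1) g(1) that] g(2) that by simp
  have "op ?f ((u # Vs) ! i) = a i" if i: "i < length (u # Vs)" for i
  proof (cases i)
    case 0
    have "op ?f u = op c u \<ominus> (op c u \<ominus> a 0)"
      using f[OF u(1)] hU cu a0 op_closed[OF h(1) u(1)] by (simp add: m_assoc[symmetric])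
    also have "\<dots> = a 0" using cu a0 by (simp add: minus_eq minus_add a_assoc[symmetric] r_neg)
    finally show ?thesis using 0 by simp
  next
    case (Suc j)
    then have j: "j < length Vs" using i by simp
    then have v: "Vs ! j \<in> carrier R" "op h (Vs ! j) = \<zero>" using Vs h(2) by auto
    have "op ?f (Vs ! j) = a (Suc j)"
      using f[OF v(1)] v(2) d c(2)[OF j] Cons.prems(2)[of "Suc j"] j by (simp add: minus_eq)
    then show ?thesis using Suc by simp
  qed
  then show ?case using coeff_diff_closed[OF c(1) g(1)] by blast
qed

text \<open>Faithfulness of the action. By \<open>C\<close>-linearity the operator vanishes
  everywhere, and an operator identity with independent right factors has zero coefficients.\<close>

lemma op_eq_zero_imp:
  assumes c: "c \<in> B \<rightarrow> C" and 0: "\<And>i. i < length Us \<Longrightarrow> op c (Us ! i) = \<zero>" and b: "b \<in> B"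
  shows "c b = \<zero>"
proof -
  have fin: "finite {..<length Us}" by simp
  have op0: "op c x = \<zero>" if x: "x \<in> carrier R" for x
  proof -
    have "x \<in> Span C Us" using x span by simp
    then obtain l where l: "l \<in> {..<length Us} \<rightarrow>\<^sub>E C" "x = (\<Oplus>i\<in>{..<length Us}. l i \<otimes> Us ! i)"
      using Span_eq_finsum[OF C independent_in_carrier[OF indep]] by blast
    have lC: "l i \<in> C" if "i < length Us" for i using PiE_mem[OF l(1)] that by blast
    have lU: "l i \<otimes> Us ! i \<in> carrier R" if "i < length Us" for i
      using C_closed[OF lC] Us_closed that by blast
    have "op c (\<Oplus>i\<in>I. l i \<otimes> Us ! i) = \<zero>" if "finite I" "I \<subseteq> {..<length Us}" for I
      using that
    proof (induction I rule: finite_induct)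
      case empty
      have "op c (\<zero> \<otimes> \<zero>) = \<zero> \<otimes> op c \<zero>" by (rule op_smult(1)[OF c CE(2) zero_closed])
      then show ?case using op_closed[OF c zero_closed] by simp
    next
      case (insert i I)
      have i: "i < length Us" using insert by simp
      have I: "(\<lambda>i. l i \<otimes> Us ! i) \<in> I \<rightarrow> carrier R" using lU insert by auto
      have "op c (\<Oplus>i\<in>insert i I. l i \<otimes> Us ! i) = op c (l i \<otimes> Us ! i) \<oplus> op c (\<Oplus>i\<in>I. l i \<otimes> Us ! i)"
        using insert I lU[OF i] op_add[OF c] by simp
      also have "op c (l i \<otimes> Us ! i) = \<zero>"
        using op_smult(1)[OF c lC[OF i] Us_closed[OF i]] 0[OF i] C_closed[OF lC[OF i]] by simp
      finally show ?case using insert by simp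
    qed
    then show ?thesis using l(2) by simp
  qed
  \<comment> \<open>The coefficient lemma is used with the whole ring as \<open>S\<close>, the units
    as \<open>Y\<close> and the basis elements as u. Coefficients commuting with all units are
    central, so \<open>B_independent\<close> provides \<open>indep\<close>.\<close>
  have "\<forall>b\<in>B. c b = \<zero>"
  proof (rule left_coeffs_zero_of_identity[where S = "carrier R" and Y = "Units R" and I = B and u = "\<lambda>b. b"])
    fix w assume w: "w \<in> B \<rightarrow> carrier R" "(\<Oplus>i\<in>B. w i \<otimes> i) = \<zero>"
      "\<And>i y. \<lbrakk>i \<in> B; y \<in> Units R\<rbrakk> \<Longrightarrow> w i \<otimes> y = y \<otimes> w i"
    have "w b \<in> ring_center R" if b: "b \<in> B" for b
    proof -
      have wb: "w b \<in> carrier R" using w(1) b by auto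
      have "w b \<otimes> y = y \<otimes> w b" if "y \<in> carrier R" for y
        using w(3)[OF b] nonzero_unit[OF that] wb by (cases "y = \<zero>") auto
      then show ?thesis using wb by (simp add: ring_center_def)
    qed
    then show "\<forall>b\<in>B. w b = \<zero>" using B_independent w(2) by blast
  next
    show "(\<Oplus>i\<in>B. c i \<otimes> x \<otimes> i) = \<zero>" if "x \<in> Units R" for x
      using op0[of x] that by (auto simp: op_def)
  qed (use carrier_is_subring nonzero_unit finite_B B_closed c C_closed in auto)
  then show ?thesis using b by blast
qed

section \<open>Coordinates with respect to the left basis\<close>

definition coord :: "'a \<Rightarrow> nat \<Rightarrow> 'a" where
  "coord x = (THE l. l \<in> {..<length Us} \<rightarrow>\<^sub>E C \<and> x = (\<Oplus>i\<in>{..<length Us}. l i \<otimes> Us ! i))"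

lemma coord_ex1:
  assumes x: "x \<in> carrier R"
  shows "\<exists>!l. l \<in> {..<length Us} \<rightarrow>\<^sub>E C \<and> x = (\<Oplus>i\<in>{..<length Us}. l i \<otimes> Us ! i)"
proof (rule ex_ex1I)
  show "\<exists>l. l \<in> {..<length Us} \<rightarrow>\<^sub>E C \<and> x = (\<Oplus>i\<in>{..<length Us}. l i \<otimes> Us ! i)"
    using Span_eq_finsum[OF C independent_in_carrier[OF indep]] x span by blast
next
  fix l m
  assume l: "l \<in> {..<length Us} \<rightarrow>\<^sub>E C \<and> x = (\<Oplus>i\<in>{..<length Us}. l i \<otimes> Us ! i)"
    and m: "m \<in> {..<length Us} \<rightarrow>\<^sub>E C \<and> x = (\<Oplus>i\<in>{..<length Us}. m i \<otimes> Us ! i)"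
  have lC: "l i \<in> C" "m i \<in> C" if "i < length Us" for i
    using PiE_mem[of l "{..<length Us}" "\<lambda>_. C"] PiE_mem[of m "{..<length Us}" "\<lambda>_. C"] l m that by blast+
  then have lc: "l i \<in> carrier R" "m i \<in> carrier R" if "i < length Us" for i using that C_closed by blast+
  have "(\<Oplus>i\<in>{..<length Us}. (l i \<ominus> m i) \<otimes> Us ! i)
      = (\<Oplus>i\<in>{..<length Us}. l i \<otimes> Us ! i \<oplus> \<ominus> \<one> \<otimes> (m i \<otimes> Us ! i))"
    using lc Us_closed by (intro finsum_cong') (auto simp: minus_eq l_distr l_minus)
  also have "\<dots> = (\<Oplus>i\<in>{..<length Us}. l i \<otimes> Us ! i) \<oplus> (\<Oplus>i\<in>{..<length Us}. \<ominus> \<one> \<otimes> (m i \<otimes> Us ! i))"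
    using lc Us_closed by (intro finsum_addf) auto
  also have "(\<Oplus>i\<in>{..<length Us}. \<ominus> \<one> \<otimes> (m i \<otimes> Us ! i)) = \<ominus> \<one> \<otimes> (\<Oplus>i\<in>{..<length Us}. m i \<otimes> Us ! i)"
    using lc Us_closed by (intro finsum_rdistr[symmetric]) auto
  also have "(\<Oplus>i\<in>{..<length Us}. l i \<otimes> Us ! i) = x" using l by simp
  also have "(\<Oplus>i\<in>{..<length Us}. m i \<otimes> Us ! i) = x" using m by simp
  finally have "(\<Oplus>i\<in>{..<length Us}. (l i \<ominus> m i) \<otimes> Us ! i) = \<zero>" using x by (simp add: l_minus r_neg)
  then have "l i \<ominus> m i = \<zero>" if "i < length Us" for i
    using independent_coeffs_zero[OF C indep, of "\<lambda>i. l i \<ominus> m i" i] lC CE(5,7) that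
    by (simp add: minus_eq Pi_iff)
  then have eq: "l i = m i" if "i < length Us" for i using lc that by simp
  show "l = m"
  proof (rule PiE_ext)
    show "l \<in> {..<length Us} \<rightarrow>\<^sub>E C" "m \<in> {..<length Us} \<rightarrow>\<^sub>E C" using l m by blast+
  qed (use eq in simp)
qed

lemma coord_props:
  assumes "x \<in> carrier R"
  shows "i < length Us \<Longrightarrow> coord x i \<in> C" "x = (\<Oplus>i\<in>{..<length Us}. coord x i \<otimes> Us ! i)"
proof -
  have p: "coord x \<in> {..<length Us} \<rightarrow>\<^sub>E C \<and> x = (\<Oplus>i\<in>{..<length Us}. coord x i \<otimes> Us ! i)"
    using theI'[OF coord_ex1[OF assms]] unfolding coord_def .
  then show "i < length Us \<Longrightarrow> coord x i \<in> C" using PiE_mem[of "coord x" "{..<length Us}" "\<lambda>_. C" i] by blast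
  show "x = (\<Oplus>i\<in>{..<length Us}. coord x i \<otimes> Us ! i)" using p by blast
qed

lemma coord_eqI:
  assumes l: "\<And>i. i < length Us \<Longrightarrow> l i \<in> C" and x: "x = (\<Oplus>i\<in>{..<length Us}. l i \<otimes> Us ! i)"
    and i: "i < length Us"
  shows "coord x i = l i"
proof -
  have lc: "l i \<in> carrier R" if "i < length Us" for i using that l C_closed by blast
  have xc: "x \<in> carrier R" unfolding x using lc Us_closed by (intro finsum_closed) auto
  have "x = (\<Oplus>i\<in>{..<length Us}. restrict l {..<length Us} i \<otimes> Us ! i)"
    unfolding x using lc Us_closed by (intro finsum_cong') auto
  then have "coord x = restrict l {..<length Us}"
    unfolding coord_def using l by (intro the1_equality[OF coord_ex1[OF xc]]) auto
  then show ?thesis using i by simp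
qed

lemma coord_add:
  assumes x: "x \<in> carrier R" and y: "y \<in> carrier R" and i: "i < length Us"
  shows "coord (x \<oplus> y) i = coord x i \<oplus> coord y i"
proof (rule coord_eqI[OF _ _ i])
  show "coord x i \<oplus> coord y i \<in> C" if "i < length Us" for i
    using coord_props(1) x y that CE(7) by blast
  have c: "coord x i \<in> carrier R" "coord y i \<in> carrier R" if "i < length Us" for i
    using coord_props(1) x y that C_closed by blast+
  have "x \<oplus> y = (\<Oplus>i\<in>{..<length Us}. coord x i \<otimes> Us ! i) \<oplus> (\<Oplus>i\<in>{..<length Us}. coord y i \<otimes> Us ! i)"
    using coord_props(2)[OF x] coord_props(2)[OF y] by simp
  also have "\<dots> = (\<Oplus>i\<in>{..<length Us}. coord x i \<otimes> Us ! i \<oplus> coord y i \<otimes> Us ! i)"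
    using c Us_closed by (intro finsum_addf[symmetric]) auto
  also have "\<dots> = (\<Oplus>i\<in>{..<length Us}. (coord x i \<oplus> coord y i) \<otimes> Us ! i)"
    using c Us_closed by (intro finsum_cong') (auto simp: l_distr)
  finally show "x \<oplus> y = (\<Oplus>i\<in>{..<length Us}. (coord x i \<oplus> coord y i) \<otimes> Us ! i)" .
qed

lemma coord_smult:
  assumes l: "l \<in> C" and x: "x \<in> carrier R" and i: "i < length Us"
  shows "coord (l \<otimes> x) i = l \<otimes> coord x i"
proof (rule coord_eqI[OF _ _ i])
  show "l \<otimes> coord x i \<in> C" if "i < length Us" for i
    using coord_props(1) x l that CE(6) by blast
  have c: "coord x i \<in> carrier R" if "i < length Us" for i
    using coord_props(1) x that C_closed by blast
  have "l \<otimes> x = l \<otimes> (\<Oplus>i\<in>{..<length Us}. coord x i \<otimes> Us ! i)"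
    using coord_props(2)[OF x] by simp
  also have "\<dots> = (\<Oplus>i\<in>{..<length Us}. l \<otimes> (coord x i \<otimes> Us ! i))"
    using c Us_closed C_closed[OF l] by (intro finsum_rdistr) auto
  also have "\<dots> = (\<Oplus>i\<in>{..<length Us}. (l \<otimes> coord x i) \<otimes> Us ! i)"
    using c Us_closed C_closed[OF l] by (intro finsum_cong') (auto simp: m_assoc)
  finally show "l \<otimes> x = (\<Oplus>i\<in>{..<length Us}. (l \<otimes> coord x i) \<otimes> Us ! i)" .
qed

lemma coord_linear_combination:
  assumes "finite A" "\<And>a. a \<in> A \<Longrightarrow> l a \<in> C" "\<And>a. a \<in> A \<Longrightarrow> x a \<in> carrier R" and i: "i < length Us"
  shows "coord (\<Oplus>a\<in>A. l a \<otimes> x a) i = (\<Oplus>a\<in>A. l a \<otimes> coord (x a) i)"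
  using assms(1-3)
proof (induction A rule: finite_induct)
  case empty
  have "coord (\<zero> \<otimes> \<zero>) i = \<zero> \<otimes> coord \<zero> i" by (rule coord_smult[OF CE(2) zero_closed i])
  then show ?case using coord_props(1)[OF zero_closed i] C_closed by simp
next
  case (insert a A)
  have c: "l b \<in> carrier R" "x b \<in> carrier R" "coord (x b) i \<in> carrier R" if "b \<in> insert a A" for b
    using insert.prems that coord_props(1)[OF _ i] C_closed by blast+
  have "coord (\<Oplus>a\<in>insert a A. l a \<otimes> x a) i = coord (l a \<otimes> x a \<oplus> (\<Oplus>a\<in>A. l a \<otimes> x a)) i"
    using insert.hyps c by (subst finsum_insert) auto
  also have "\<dots> = coord (l a \<otimes> x a) i \<oplus> coord (\<Oplus>a\<in>A. l a \<otimes> x a) i"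
    using c by (intro coord_add[OF _ _ i] finsum_closed) auto
  also have "\<dots> = l a \<otimes> coord (x a) i \<oplus> (\<Oplus>a\<in>A. l a \<otimes> coord (x a) i)"
    using coord_smult[OF _ _ i] insert by simp
  also have "\<dots> = (\<Oplus>a\<in>insert a A. l a \<otimes> coord (x a) i)"
    using insert.hyps c by (subst finsum_insert) auto
  finally show ?case .
qed

lemma coord_basis:
  assumes "i < length Us" "j < length Us"
  shows "coord (Us ! i) j = (if i = j then \<one> else \<zero>)"
proof (rule coord_eqI[OF _ _ assms(2)])
  show "(if i = k then \<one> else \<zero>) \<in> C" for k using CE(2,3) by simp
  have "(\<Oplus>k\<in>{..<length Us}. (if i = k then \<one> else \<zero>) \<otimes> Us ! k) = (if i = i then \<one> else \<zero>) \<otimes> Us ! i"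
    using assms(1) Us_closed by (intro finsum_only_nonzero) auto
  then show "Us ! i = (\<Oplus>k\<in>{..<length Us}. (if i = k then \<one> else \<zero>) \<otimes> Us ! k)"
    using Us_closed assms(1) by simp
qed

end

section \<open>The matrix representation and its bijectivity after scalar extension\<close>

context maximal_subfield_basis
begin

abbreviation "L \<equiv> R\<lparr>carrier := C\<rparr>"
abbreviation "n \<equiv> length Us"

text \<open>Right multiplication on the left \<open>C\<close>-space \<open>R\<close>, acting on row vectors, so that \<open>phi\<close> is
  multiplicative and not anti-multiplicative.\<close>

definition phi :: "'a \<Rightarrow> nat \<times> nat \<Rightarrow> 'a" where
  "phi d = (\<lambda>(i, j) \<in> {..<n} \<times> {..<n}. coord (Us ! i \<otimes> d) j)"

lemma ring_L: "ring L"
  by (rule subring_is_ring[OF subfieldE(1)[OF C]])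

lemma phi_entry: "\<lbrakk>i < n; j < n\<rbrakk> \<Longrightarrow> phi d (i, j) = coord (Us ! i \<otimes> d) j"
  by (simp add: phi_def)

lemma phi_extensional: "phi d \<in> extensional ({..<n} \<times> {..<n})"
  by (simp add: phi_def)

lemma phi_closed: "d \<in> carrier R \<Longrightarrow> phi d \<in> carrier (mat_ring L n)"
  using coord_props(1) Us_closed by (auto simp: mat_ring_simps phi_def)

lemma phi_mult:
  assumes d: "d \<in> carrier R" and e: "e \<in> carrier R"
  shows "phi (d \<otimes> e) = phi d \<otimes>\<^bsub>mat_ring L n\<^esub> phi e"
proof (rule mat_eqI[OF phi_extensional])
  show "phi d \<otimes>\<^bsub>mat_ring L n\<^esub> phi e \<in> extensional ({..<n} \<times> {..<n})"
    by (simp add: mat_ring_simps)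
  fix i j assume ij: "i < n" "j < n"
  have Ud: "Us ! i \<otimes> d \<in> carrier R" using Us_closed ij d by simp
  have cC: "coord (Us ! i \<otimes> d) k \<in> C" "coord (Us ! i \<otimes> d) k \<in> carrier R" if "k < n" for k
    using coord_props(1)[OF Ud that] C_closed by auto
  have kC: "coord (Us ! k \<otimes> e) j \<in> C" if "k < n" for k
    using coord_props(1)[OF _ ij(2)] Us_closed[OF that] e by simp
  have "Us ! i \<otimes> (d \<otimes> e) = (Us ! i \<otimes> d) \<otimes> e" using Us_closed ij d e by (simp add: m_assoc)
  also have "\<dots> = (\<Oplus>k\<in>{..<n}. coord (Us ! i \<otimes> d) k \<otimes> Us ! k) \<otimes> e"
    using coord_props(2)[OF Ud] by simp
  also have "\<dots> = (\<Oplus>k\<in>{..<n}. coord (Us ! i \<otimes> d) k \<otimes> Us ! k \<otimes> e)"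
    using cC Us_closed e by (intro finsum_ldistr) auto
  also have "\<dots> = (\<Oplus>k\<in>{..<n}. coord (Us ! i \<otimes> d) k \<otimes> (Us ! k \<otimes> e))"
    using cC Us_closed e by (intro finsum_cong') (auto simp: m_assoc)
  finally have "coord (Us ! i \<otimes> (d \<otimes> e)) j
      = coord (\<Oplus>k\<in>{..<n}. coord (Us ! i \<otimes> d) k \<otimes> (Us ! k \<otimes> e)) j" by simp
  also have "\<dots> = (\<Oplus>k\<in>{..<n}. coord (Us ! i \<otimes> d) k \<otimes> coord (Us ! k \<otimes> e) j)"
    using cC Us_closed e ij by (intro coord_linear_combination) auto
  also have "\<dots> = finsum L (\<lambda>k. coord (Us ! i \<otimes> d) k \<otimes> coord (Us ! k \<otimes> e) j) {..<n}"
    using cC kC CE(6) by (intro finsum_subring[OF subfieldE(1)[OF C], symmetric]) auto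
  also have "\<dots> = finsum L (\<lambda>k. phi d (i, k) \<otimes>\<^bsub>L\<^esub> phi e (k, j)) {..<n}"
    using ij cC kC CE(6)
    by (intro abelian_monoid.finsum_cong'[OF ring.axioms(1)[OF ring_L, THEN abelian_group.axioms(1)]])
       (auto simp: phi_entry)
  also have "\<dots> = (phi d \<otimes>\<^bsub>mat_ring L n\<^esub> phi e) (i, j)"
    using ij by (simp add: mat_ring_simps)
  finally show "phi (d \<otimes> e) (i, j) = (phi d \<otimes>\<^bsub>mat_ring L n\<^esub> phi e) (i, j)"
    using ij by (simp add: phi_entry)
qed

lemma phi_add:
  assumes d: "d \<in> carrier R" and e: "e \<in> carrier R"
  shows "phi (d \<oplus> e) = phi d \<oplus>\<^bsub>mat_ring L n\<^esub> phi e"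
proof (rule mat_eqI[OF phi_extensional])
  show "phi d \<oplus>\<^bsub>mat_ring L n\<^esub> phi e \<in> extensional ({..<n} \<times> {..<n})"
    by (simp add: mat_ring_simps)
  fix i j assume ij: "i < n" "j < n"
  then show "phi (d \<oplus> e) (i, j) = (phi d \<oplus>\<^bsub>mat_ring L n\<^esub> phi e) (i, j)"
    using coord_add[of "Us ! i \<otimes> d" "Us ! i \<otimes> e" j] Us_closed[OF ij(1)] d e
    by (simp add: phi_entry mat_ring_simps r_distr)
qed

lemma phi_central:
  assumes z: "z \<in> ring_center R"
  shows "phi z = scalar_mat L n z"
proof (rule mat_eqI[OF phi_extensional])
  show "scalar_mat L n z \<in> extensional ({..<n} \<times> {..<n})" by (simp add: scalar_mat_def)
  fix i j assume ij: "i < n" "j < n"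
  have zC: "z \<in> C" "z \<in> carrier R" using z center_C C_closed by auto
  have "coord (Us ! i \<otimes> z) j = coord (z \<otimes> Us ! i) j"
    using ring_centerD(2)[OF z Us_closed[OF ij(1)]] by simp
  also have "\<dots> = z \<otimes> (if i = j then \<one> else \<zero>)"
    using coord_smult[OF zC(1) Us_closed[OF ij(1)] ij(2)] coord_basis[OF ij] by simp
  finally show "phi z (i, j) = scalar_mat L n z (i, j)"
    using ij zC by (simp add: phi_entry scalar_mat_def)
qed

lemma phi_ring_hom: "phi \<in> ring_hom R (mat_ring L n)"
proof (rule ring_hom_memI)
  have "phi \<one> = scalar_mat L n \<one>"
    by (rule phi_central[OF subringE(3)[OF ring_center_subring]])
  moreover have "scalar_mat L n \<one> = \<one>\<^bsub>mat_ring L n\<^esub>"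
    by (rule mat_eqI[where n = n]) (simp_all add: scalar_mat_def mat_ring_simps)
  ultimately show "phi \<one> = \<one>\<^bsub>mat_ring L n\<^esub>" by simp
qed (simp_all add: phi_closed phi_mult phi_add)

text \<open>The combination of the matrices \<open>phi b\<close> with scalars c is the matrix of
  \<open>op c\<close> on row vectors, since coordinates are \<open>C\<close>-linear on the left. The
  splitting condition thereby becomes a statement about the operators.\<close>

lemma phi_sum_entry:
  assumes c: "c \<in> B \<rightarrow> C" and ij: "i < n" "j < n"
  shows "(\<Oplus>\<^bsub>mat_ring L n\<^esub>b\<in>B. scalar_mat L n (c b) \<otimes>\<^bsub>mat_ring L n\<^esub> phi b) (i, j)
    = coord (op c (Us ! i)) j"
proof -
  interpret L: ring L by (rule ring_L)
  have cC: "c b \<in> C" "c b \<in> carrier R" if "b \<in> B" for b using c that C_closed by auto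
  have mem: "scalar_mat L n (c b) \<otimes>\<^bsub>mat_ring L n\<^esub> phi b \<in> carrier (mat_ring L n)" if "b \<in> B" for b
    using L.mat_mult_closed[OF L.scalar_mat_closed phi_closed] cC[OF that] B_closed[OF that] by simp
  have co: "coord (Us ! i \<otimes> b) j \<in> C" if "b \<in> B" for b
    using coord_props(1)[OF _ ij(2)] Us_closed[OF ij(1)] B_closed[OF that] by simp
  have "(\<Oplus>\<^bsub>mat_ring L n\<^esub>b\<in>B. scalar_mat L n (c b) \<otimes>\<^bsub>mat_ring L n\<^esub> phi b) (i, j)
      = (\<Oplus>\<^bsub>L\<^esub>b\<in>B. (scalar_mat L n (c b) \<otimes>\<^bsub>mat_ring L n\<^esub> phi b) (i, j))"
    using mem by (intro L.mat_ring_finsum_entry[OF finite_B _ ij]) auto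
  also have "\<dots> = (\<Oplus>\<^bsub>L\<^esub>b\<in>B. c b \<otimes> coord (Us ! i \<otimes> b) j)"
  proof (rule L.finsum_cong')
    fix b assume b: "b \<in> B"
    show "(scalar_mat L n (c b) \<otimes>\<^bsub>mat_ring L n\<^esub> phi b) (i, j) = c b \<otimes> coord (Us ! i \<otimes> b) j"
      using L.scalar_mat_mult_entry[OF _ phi_closed[OF B_closed[OF b]] ij, of "c b"] cC[OF b] ij
      by (simp add: phi_entry)
  qed (use cC co CE(6) in auto)
  also have "\<dots> = (\<Oplus>b\<in>B. c b \<otimes> coord (Us ! i \<otimes> b) j)"
    using cC co CE(6) by (intro finsum_subring[OF subfieldE(1)[OF C] finite_B]) auto
  also have "\<dots> = coord (\<Oplus>b\<in>B. c b \<otimes> (Us ! i \<otimes> b)) j"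
    using cC Us_closed[OF ij(1)] B_closed
    by (intro coord_linear_combination[OF finite_B _ _ ij(2), symmetric]) auto
  also have "(\<Oplus>b\<in>B. c b \<otimes> (Us ! i \<otimes> b)) = op c (Us ! i)"
    unfolding op_def using cC Us_closed[OF ij(1)] B_closed
    by (intro finsum_cong') (auto simp: m_assoc)
  finally show ?thesis .
qed

text \<open>A matrix equation prescribes the values of an operator on the basis \<open>Us\<close>:
  such an operator exists by interpolation, and its coefficients are unique by faithfulness. No
  dimension count enters.\<close>

lemma phi_basis_image:
  assumes A: "A \<in> carrier (mat_ring L n)"
  shows "\<exists>!c. c \<in> B \<rightarrow>\<^sub>E carrier L \<and>
    A = (\<Oplus>\<^bsub>mat_ring L n\<^esub>b\<in>B. scalar_mat L n (c b) \<otimes>\<^bsub>mat_ring L n\<^esub> phi b)"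
proof -
  interpret L: ring L by (rule ring_L)
  interpret M: abelian_monoid "mat_ring L n" by (rule L.abelian_monoid_mat_ring)
  let ?sum = "\<lambda>c. \<Oplus>\<^bsub>mat_ring L n\<^esub>b\<in>B. scalar_mat L n (c b) \<otimes>\<^bsub>mat_ring L n\<^esub> phi b"
  have AC: "A (i, j) \<in> C" if "i < n" "j < n" for i j using A that by (auto simp: mat_ring_simps)
  \<comment> \<open>The element whose coordinates are row i of the matrix, hence the value required
    at the i-th basis element.\<close>
  define a where "a i = (\<Oplus>j\<in>{..<n}. A (i, j) \<otimes> Us ! j)" for i
  have ac: "a i \<in> carrier R" if "i < n" for i
    unfolding a_def using AC[OF that] C_closed Us_closed by (intro finsum_closed) auto
  have a_coord: "coord (a i) j = A (i, j)" if "i < n" "j < n" for i j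
    using coord_eqI[of "\<lambda>j. A (i, j)" "a i" j] AC that by (simp add: a_def)
  have sum_ext: "?sum c \<in> extensional ({..<n} \<times> {..<n})" if c: "c \<in> B \<rightarrow> C" for c
  proof -
    have "?sum c \<in> carrier (mat_ring L n)"
      using c B_closed by (intro M.finsum_closed) (auto intro!: L.mat_mult_closed L.scalar_mat_closed phi_closed)
    then show ?thesis by (auto simp: mat_ring_simps PiE_iff)
  qed
  have char: "A = ?sum c \<longleftrightarrow> (\<forall>i<n. op c (Us ! i) = a i)" if c: "c \<in> B \<rightarrow> C" for c
  proof
    assume eq: "A = ?sum c"
    show "\<forall>i<n. op c (Us ! i) = a i"
    proof (intro allI impI)
      fix i assume i: "i < n"
      have opc: "op c (Us ! i) \<in> carrier R" by (rule op_closed[OF c Us_closed[OF i]])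
      have e: "coord (op c (Us ! i)) j = A (i, j)" if "j < n" for j
        using phi_sum_entry[OF c i that] eq by simp
      have "op c (Us ! i) = (\<Oplus>j\<in>{..<n}. coord (op c (Us ! i)) j \<otimes> Us ! j)"
        by (rule coord_props(2)[OF opc])
      also have "\<dots> = a i"
        unfolding a_def using e AC[OF i] C_closed Us_closed by (intro finsum_cong') auto
      finally show "op c (Us ! i) = a i" .
    qed
  next
    assume eq: "\<forall>i<n. op c (Us ! i) = a i"
    show "A = ?sum c"
    proof (rule mat_eqI[OF _ sum_ext[OF c]])
      show "A \<in> extensional ({..<n} \<times> {..<n})" using A by (auto simp: mat_ring_simps PiE_iff)
      show "A (i, j) = ?sum c (i, j)" if "i < n" "j < n" for i j
        using phi_sum_entry[OF c that] eq a_coord[OF that] that by simp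
    qed
  qed
  have "\<exists>c\<in>B \<rightarrow> C. \<forall>i<n. op c (Us ! i) = a i"
    by (rule op_interpolation[OF indep]) (rule ac)
  then obtain c where c: "c \<in> B \<rightarrow> C" "\<forall>i<n. op c (Us ! i) = a i" by blast
  have rc: "restrict c B \<in> B \<rightarrow> C" using c by auto
  have "op (restrict c B) x = op c x" if "x \<in> carrier R" for x
    unfolding op_def using op_term_closed[OF c(1) that] by (intro finsum_cong') auto
  then have "A = ?sum (restrict c B)" using char[OF rc] c(2) Us_closed by simp
  moreover have "restrict c B \<in> B \<rightarrow>\<^sub>E carrier L" using c(1) by auto
  ultimately have ex: "restrict c B \<in> B \<rightarrow>\<^sub>E carrier L \<and> A = ?sum (restrict c B)" by (rule conjI[rotated])
  have uniq: "c1 = c2" if c1: "c1 \<in> B \<rightarrow>\<^sub>E C" "A = ?sum c1" and c2: "c2 \<in> B \<rightarrow>\<^sub>E C" "A = ?sum c2" for c1 c2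
  proof (rule PiE_ext[OF c1(1) c2(1)])
    fix b assume b: "b \<in> B"
    have m: "c1 \<in> B \<rightarrow> C" "c2 \<in> B \<rightarrow> C" using c1 c2 by (simp_all add: PiE_iff Pi_iff)
    have "c1 b \<ominus> c2 b = \<zero>"
    proof (rule op_eq_zero_imp[OF coeff_diff_closed[OF m] _ b])
      fix i assume i: "i < n"
      have "op c1 (Us ! i) = a i" using char[OF m(1)] c1(2) i by blast
      moreover have "op c2 (Us ! i) = a i" using char[OF m(2)] c2(2) i by blast
      ultimately show "op (\<lambda>b. c1 b \<ominus> c2 b) (Us ! i) = \<zero>"
        using op_coeff_diff[OF m Us_closed[OF i]] ac[OF i] by (simp add: minus_eq r_neg)
    qed
    moreover have "c1 b \<in> carrier R" "c2 b \<in> carrier R" using m b C_closed by auto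
    ultimately show "c1 b = c2 b" by simp
  qed
  show ?thesis
  proof (rule ex1I[of _ "restrict c B"], rule ex)
    fix c' assume c': "c' \<in> B \<rightarrow>\<^sub>E carrier L \<and> A = ?sum c'"
    show "c' = restrict c B"
    proof (rule uniq)
      show "c' \<in> B \<rightarrow>\<^sub>E C" "restrict c B \<in> B \<rightarrow>\<^sub>E C" using c' ex by simp_all
      show "A = ?sum c'" using c' by (rule conjunct2)
      show "A = ?sum (restrict c B)" using ex by (rule conjunct2)
    qed
  qed
qed

end

text \<open>The field is a maximal subfield of \<open>R\<close>, with the inclusion of the center as
  \<iota>; its elements thus have the type demanded by \<open>reduced_norm\<close>. The basis over
  the center spans \<open>R\<close> also over the larger field and is thinned out to a left basis,
  whose length is the matrix size.\<close>

lemma exists_splitting: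
  fixes R :: "'d ring"
  assumes "division_algebra R B"
  shows "\<exists>(L :: 'd ring) \<iota> n \<phi>. splitting R L \<iota> n \<phi>"
proof -
  interpret division_algebra R B by fact
  obtain C where F: "subfield C R" "ring_center R \<subseteq> C"
    "\<And>x. \<lbrakk>x \<in> carrier R; \<And>c. c \<in> C \<Longrightarrow> c \<otimes>\<^bsub>R\<^esub> x = x \<otimes>\<^bsub>R\<^esub> c\<rbrakk> \<Longrightarrow> x \<in> C"
    using exists_self_centralizing_subfield by metis
  note CE = subringE[OF subfieldE(1)[OF F(1)]]
  obtain Bs where Bs: "set Bs = B" using finite_list[OF finite_B] by blast
  have Bc: "set Bs \<subseteq> carrier R" using Bs B_closed by blast
  have "x \<in> Span C Bs" if x: "x \<in> carrier R" for x
  proof -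
    obtain k where k: "\<And>b. b \<in> B \<Longrightarrow> k b \<in> ring_center R" "x = (\<Oplus>\<^bsub>R\<^esub>b\<in>B. k b \<otimes>\<^bsub>R\<^esub> b)"
      using B_coeffs[OF x] by blast
    have "additive_subgroup (Span C Bs) R"
      using Span_is_add_subgroup[OF F(1) Bc] by (rule additive_subgroup.intro)
    moreover have "k b \<otimes>\<^bsub>R\<^esub> b \<in> Span C Bs" if "b \<in> B" for b
      using Span_smult_closed[OF F(1) Bc, of "k b" b] k(1)[OF that] F(2) Span_base_incl[OF F(1) Bc] Bs that
      by blast
    ultimately show ?thesis
      unfolding k(2) using finite_B by (intro finsum_mem_subgroup) auto
  qed
  then have sp: "Span C Bs = carrier R" using Span_in_carrier[OF CE(1) Bc] by blast
  obtain Us where Us: "independent C Us" "Span C Us = Span C Bs"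
    using filter_base[OF F(1) Bc] by metis
  interpret maximal_subfield_basis R B C Us
  proof (intro maximal_subfield_basis.intro maximal_subfield_basis_axioms.intro)
    show "division_algebra R B" by fact
    show "subfield C R" "ring_center R \<subseteq> C" "independent C Us" "Span C Us = carrier R"
      using F(1,2) Us(1) trans[OF Us(2) sp] by - assumption
    show "x \<in> C" if "x \<in> carrier R" "\<And>c. c \<in> C \<Longrightarrow> c \<otimes>\<^bsub>R\<^esub> x = x \<otimes>\<^bsub>R\<^esub> c" for x
      using that by (rule F(3))
  qed
  have "splitting R (R\<lparr>carrier := C\<rparr>) (\<lambda>z. z) (length Us) phi"
    unfolding splitting_def
  proof (intro conjI ballI)
    show "field (R\<lparr>carrier := C\<rparr>)" using subfield_iff(2)[OF F(1)] .
    show "(\<lambda>z. z) \<in> ring_hom (R\<lparr>carrier := ring_center R\<rparr>) (R\<lparr>carrier := C\<rparr>)"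
      using F(2) by (intro ring_hom_memI) auto
    show "phi \<in> ring_hom R (mat_ring (R\<lparr>carrier := C\<rparr>) (length Us))" by (rule phi_ring_hom)
    show "phi z = scalar_mat (R\<lparr>carrier := C\<rparr>) (length Us) z" if "z \<in> ring_center R" for z
      using that by (rule phi_central)
    show "\<exists>B. module_basis R (ring_center R) B \<and>
        (\<forall>A \<in> carrier (mat_ring (R\<lparr>carrier := C\<rparr>) (length Us)).
           \<exists>!c. c \<in> B \<rightarrow>\<^sub>E carrier (R\<lparr>carrier := C\<rparr>) \<and>
             A = (\<Oplus>\<^bsub>mat_ring (R\<lparr>carrier := C\<rparr>) (length Us)\<^esub>b\<in>B.
               scalar_mat (R\<lparr>carrier := C\<rparr>) (length Us) (c b) \<otimes>\<^bsub>mat_ring (R\<lparr>carrier := C\<rparr>) (length Us)\<^esub> phi b))"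
      using basis phi_basis_image by blast
  qed
  then show ?thesis by blast
qed

section \<open>Determinant and reduced norm of the identity\<close>

lemma (in division_algebra) center_unit_or_zero:
  assumes "z \<in> ring_center R" "z \<noteq> \<zero>"
  shows "z \<in> Units R" "inv z \<in> ring_center R"
  using assms nonzero_unit ring_centerD ring_center_inv by blast+

text \<open>A permutation other than the identity moves some i, and the corresponding off-diagonal
  entry annihilates its whole product.\<close>

lemma mat_det_one:
  assumes "field L"
  shows "mat_det L n \<one>\<^bsub>mat_ring L n\<^esub> = \<one>\<^bsub>L\<^esub>"
proof -
  interpret field L by fact
  let ?I = "\<one>\<^bsub>mat_ring L n\<^esub>"
  have entry: "?I (i, j) = (if i = j then \<one>\<^bsub>L\<^esub> else \<zero>\<^bsub>L\<^esub>)" if "i < n" "j < n" for i j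
    using that by (simp add: mat_ring_simps)
  let ?f = "\<lambda>p. if evenperm p then (\<Otimes>\<^bsub>L\<^esub>i\<in>{..<n}. ?I (i, p i))
        else \<ominus>\<^bsub>L\<^esub> (\<Otimes>\<^bsub>L\<^esub>i\<in>{..<n}. ?I (i, p i))"
  have fid: "?f id = \<one>\<^bsub>L\<^esub>"
  proof -
    have "(\<Otimes>\<^bsub>L\<^esub>i\<in>{..<n}. ?I (i, i)) = (\<Otimes>\<^bsub>L\<^esub>i\<in>{..<n}. \<one>\<^bsub>L\<^esub>)"
      by (intro finprod_cong') (auto simp: entry)
    then show ?thesis by (simp add: evenperm_id)
  qed
  have "mat_det L n ?I = ?f id"
    unfolding mat_det_def
  proof (rule finsum_only_nonzero)
    show "finite {p. p permutes {..<n}}" by (rule finite_permutations) simp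
    show "id \<in> {p. p permutes {..<n}}" by (simp add: permutes_id)
    show "?f id \<in> carrier L" unfolding fid by simp
    fix p assume p: "p \<in> {p. p permutes {..<n}}" "p \<noteq> id"
    then obtain i where i: "p i \<noteq> i" by fastforce
    have pn: "p permutes {..<n}" using p by simp
    have "i < n" using i permutes_not_in[OF pn, of i] by auto
    have m: "k < n \<Longrightarrow> p k < n" for k using permutes_in_image[OF pn, of k] by auto
    have "(\<Otimes>\<^bsub>L\<^esub>k\<in>{..<n}. ?I (k, p k)) = (\<Otimes>\<^bsub>L\<^esub>k\<in>insert i ({..<n} - {i}). ?I (k, p k))"
      using \<open>i < n\<close> by (simp add: insert_absorb)
    also have "\<dots> = ?I (i, p i) \<otimes>\<^bsub>L\<^esub> (\<Otimes>\<^bsub>L\<^esub>k\<in>{..<n} - {i}. ?I (k, p k))"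
      using m \<open>i < n\<close> by (intro finprod_insert) (auto simp: entry)
    also have "\<dots> = \<zero>\<^bsub>L\<^esub>"
    proof -
      have "(\<Otimes>\<^bsub>L\<^esub>k\<in>{..<n} - {i}. ?I (k, p k)) \<in> carrier L"
        using m by (intro finprod_closed) (auto simp: entry)
      then show ?thesis using i m \<open>i < n\<close> by (simp add: entry)
    qed
    finally show "?f p = \<zero>\<^bsub>L\<^esub>" by simp
  qed
  then show ?thesis using fid by simp
qed

text \<open>A splitting sends 1 to the identity matrix, so 1 is a candidate as soon as one splitting
  exists. A second candidate may come from another splitting, whose \<iota> is injective since the
  center is a field.\<close>

lemma reduced_norm_one:
  fixes R :: "'d ring" (structure)
  assumes "division_algebra R B"
  shows "reduced_norm R \<one>\<^bsub>R\<^esub> = \<one>\<^bsub>R\<^esub>"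
proof -
  interpret division_algebra R B by fact
  note KE = subringE[OF ring_center_subring]
  have det: "mat_det L n (\<phi> \<one>) = \<iota> \<one>" if "splitting R L \<iota> n \<phi>" for L :: "'d ring" and \<iota> n \<phi>
  proof -
    have L: "field L" and \<iota>: "\<iota> \<in> ring_hom (R\<lparr>carrier := ring_center R\<rparr>) L" and \<phi>: "\<phi> \<in> ring_hom R (mat_ring L n)"
      using that by (simp_all add: splitting_def)
    show ?thesis using ring_hom_one[OF \<iota>] ring_hom_one[OF \<phi>] mat_det_one[OF L] by simp
  qed
  show ?thesis
    unfolding reduced_norm_def
  proof (rule the_equality)
    show "\<one> \<in> ring_center R \<and>
      (\<exists>(L :: 'd ring) \<iota> n \<phi>. splitting R L \<iota> n \<phi> \<and> mat_det L n (\<phi> \<one>) = \<iota> \<one>)"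
      using exists_splitting[OF assms] det KE(3) by blast
  next
    fix c assume "c \<in> ring_center R \<and>
      (\<exists>(L :: 'd ring) \<iota> n \<phi>. splitting R L \<iota> n \<phi> \<and> mat_det L n (\<phi> \<one>) = \<iota> c)"
    then obtain L :: "'d ring" and \<iota> n \<phi> where c: "c \<in> ring_center R" "splitting R L \<iota> n \<phi>" "\<iota> \<one> = \<iota> c"
      using det by metis
    have L: "field L" and \<iota>: "\<iota> \<in> ring_hom (R\<lparr>carrier := ring_center R\<rparr>) L"
      using c(2) by (simp_all add: splitting_def)
    interpret L: field L by (rule L)
    interpret K: ring "R\<lparr>carrier := ring_center R\<rparr>" by (rule subring_is_ring[OF ring_center_subring])
    interpret h: ring_hom_ring "R\<lparr>carrier := ring_center R\<rparr>" L \<iota>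
      using \<iota> by (intro ring_hom_ringI2 K.ring_axioms L.ring_axioms)
    have c1: "c \<in> carrier R" using c ring_centerD by blast
    \<comment> \<open>The map \<iota> sends d to 0; if d were nonzero it would be invertible in the
      center, giving 1 = 0 in the splitting field.\<close>
    define d where "d = \<one> \<oplus> \<ominus> c"
    have dK: "d \<in> ring_center R" using c KE by (simp add: d_def)
    have "\<iota> (d \<oplus> c) = \<iota> d \<oplus>\<^bsub>L\<^esub> \<iota> c" using ring_hom_add[OF \<iota>, of d c] dK c(1) by simp
    moreover have "d \<oplus> c = \<one>" using c1 by (simp add: d_def a_assoc l_neg)
    ultimately have "\<iota> d \<oplus>\<^bsub>L\<^esub> \<iota> c = \<zero>\<^bsub>L\<^esub> \<oplus>\<^bsub>L\<^esub> \<iota> c"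
      using c(3) ring_hom_closed[OF \<iota>, of c] c(1) by simp
    moreover have "\<iota> c \<in> carrier L" "\<iota> d \<in> carrier L"
      using ring_hom_closed[OF \<iota>, of c] ring_hom_closed[OF \<iota>, of d] c(1) dK by simp_all
    ultimately have d0: "\<iota> d = \<zero>\<^bsub>L\<^esub>"
      using L.add.right_cancel[of "\<iota> c" "\<iota> d" "\<zero>\<^bsub>L\<^esub>"] by simp
    have "d = \<zero>"
    proof (rule ccontr)
      assume d: "d \<noteq> \<zero>"
      note dU = center_unit_or_zero[OF dK d]
      have "\<one>\<^bsub>L\<^esub> = \<iota> (d \<otimes> inv d)" using ring_hom_one[OF \<iota>] dU by simp
      also have "\<dots> = \<iota> d \<otimes>\<^bsub>L\<^esub> \<iota> (inv d)" using ring_hom_mult[OF \<iota>, of d "inv d"] dK dU by simp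
      also have "\<dots> = \<zero>\<^bsub>L\<^esub>" using d0 ring_hom_closed[OF \<iota>, of "inv d"] dU by simp
      finally show False using L.one_not_zero by simp
    qed
    then show "c = \<one>" using c1 unfolding d_def by (metis minus_equality minus_minus one_closed a_inv_closed a_comm)
  qed
qed

section \<open>The quotient division ring\<close>

text \<open>In a power relation of least degree the constant term is nonzero, since otherwise x
  could be cancelled. Solving for that term exhibits an inverse.\<close>

lemma (in ring) finite_dimensional_domain_unit:
  assumes dom: "\<And>x y. \<lbrakk>x \<in> carrier R; y \<in> carrier R; x \<otimes> y = \<zero>\<rbrakk> \<Longrightarrow> x = \<zero> \<or> y = \<zero>"
    and K: "subfield K R" and Vs: "set Vs \<subseteq> carrier R" "carrier R \<subseteq> Span K Vs"
    and x: "x \<in> carrier R" "x \<noteq> \<zero>"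
  shows "x \<in> Units R"
proof -
  note KE = subringE[OF subfieldE(1)[OF K]]
  let ?rel = "\<lambda>N. \<exists>c. c \<in> UNIV \<rightarrow> K \<and> c N \<noteq> \<zero> \<and> (\<Oplus>i\<in>{..N::nat}. c i \<otimes> x [^] i) = \<zero>"
  define N where "N = (LEAST N. ?rel N)"
  have "\<exists>N. ?rel N" using exists_power_relation[OF K Vs(1) x(1)] Vs(2) x by blast
  then have "?rel N" unfolding N_def by (rule LeastI_ex)
  then obtain c where c: "c \<in> UNIV \<rightarrow> K" "c N \<noteq> \<zero>" "(\<Oplus>i\<in>{..N}. c i \<otimes> x [^] i) = \<zero>" by blast
  have minimal: "N \<le> n" if "?rel n" for n unfolding N_def using that by (rule Least_le)
  have cK: "c i \<in> K" for i using c(1) by auto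
  then have cc [simp]: "c i \<in> carrier R" for i using KE(1) by auto
  have "N \<noteq> 0" using c(2,3) by (auto intro: ccontr)
  then obtain M where M: "N = Suc M" by (cases N) auto
  \<comment> \<open>The relation with its constant term removed and one factor x split off on the
    right, so that yx = -c(0).\<close>
  define y where "y = (\<Oplus>i\<in>{..M}. c (Suc i) \<otimes> x [^] i)"
  have y: "y \<in> carrier R" unfolding y_def using x by (intro finsum_closed) auto
  have "(\<Oplus>i\<in>{..M}. c (Suc i) \<otimes> x [^] Suc i) = (\<Oplus>i\<in>{..M}. c (Suc i) \<otimes> x [^] i \<otimes> x)"
    using x by (intro finsum_cong') (auto simp: m_assoc)
  also have "\<dots> = y \<otimes> x" unfolding y_def using x by (intro finsum_ldistr[symmetric]) auto
  finally have rel: "y \<otimes> x \<oplus> c 0 = \<zero>"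
    using c(3) x unfolding M by (subst (asm) finsum_Suc2) auto
  have c0: "c 0 \<noteq> \<zero>"
  proof
    assume "c 0 = \<zero>"
    then have "y = \<zero>" using rel dom[OF y x(1)] x y by auto
    then have "?rel M" using cK c(2) M by (intro exI[of _ "\<lambda>i. c (Suc i)"]) (auto simp: y_def)
    then show False using minimal M by fastforce
  qed
  define e where "e = \<ominus> (c 0)"
  have e: "e \<in> K - {\<zero>}" using c0 KE(5) cK by (auto simp: e_def)
  have eU: "inv e \<in> carrier R" "inv e \<otimes> e = \<one>"
    using subfield_m_inv[OF K e] KE(1) by auto
  have yx: "y \<otimes> x = e" using rel y x unfolding e_def by (metis cc m_closed minus_equality)
  define l where "l = inv e \<otimes> y"
  have l: "l \<in> carrier R" "l \<otimes> x = \<one>" using eU y x yx by (auto simp: l_def m_assoc)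
  \<comment> \<open>The coefficients stand on the left, so only a left inverse l has been found;
    cancelling x in a domain makes it two-sided.\<close>
  have "(x \<otimes> l \<ominus> \<one>) \<otimes> x = \<zero>" using l x by (simp add: minus_eq l_distr m_assoc l_minus r_neg)
  then have "x \<otimes> l \<ominus> \<one> = \<zero>" using dom[of "x \<otimes> l \<ominus> \<one>" x] l x by auto
  then have "x \<otimes> l = \<one>" using l x by simp
  then show ?thesis using l x by (auto simp: Units_def)
qed

text \<open>The operations of \<open>quot_ring\<close> are unions over all pairs of representatives.
  Once the result is independent of the choice, such a union over nonempty classes is that common
  result.\<close>

lemma UN_pairs_const:
  assumes "(a, s) \<in> P" "(b, t) \<in> Q"
    and "\<And>a s b t. \<lbrakk>(a, s) \<in> P; (b, t) \<in> Q\<rbrakk> \<Longrightarrow> F a s b t = c"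
  shows "(\<Union>(a, s)\<in>P. \<Union>(b, t)\<in>Q. F a s b t) = c"
proof (rule UN_constant_eq[OF assms(1)], rule ballI)
  fix p assume "p \<in> P"
  then obtain a s where p: "p = (a, s)" "(a, s) \<in> P" by (cases p) auto
  have "\<forall>q\<in>Q. (case q of (b, t) \<Rightarrow> F a s b t) = c" using assms(3)[OF p(2)] by auto
  then show "(case p of (a, s) \<Rightarrow> \<Union>(b, t)\<in>Q. F a s b t) = c"
    using UN_constant_eq[OF assms(2), of "\<lambda>(b, t). F a s b t" c] by (simp only: p(1) prod.case)
qed

section \<open>Arithmetic of fractions with central denominators\<close>

context graded_division_ring
begin

abbreviation "Z \<equiv> ring_center E"
abbreviation "Q \<equiv> quot_ring E"

lemmas ZE = subringE[OF ring_center_subring]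

lemma Z_nonzeroD:
  assumes "s \<in> Z - {\<zero>}"
  shows "s \<in> carrier E" "s \<in> Z" "s \<noteq> \<zero>" "x \<in> carrier E \<Longrightarrow> s \<otimes> x = x \<otimes> s"
  using assms ring_centerD by auto

lemma Z_nonzero_mult: "\<lbrakk>s \<in> Z - {\<zero>}; t \<in> Z - {\<zero>}\<rbrakk> \<Longrightarrow> s \<otimes> t \<in> Z - {\<zero>}"
  using ZE(6)[of s t] integral[of s t] ring_centerD(1) by blast

lemma one_Z_nonzero: "\<one> \<in> Z - {\<zero>}"
  using ZE(3) one_not_zero by simp

lemma cancel_right:
  assumes "x \<in> carrier E" "y \<in> carrier E" "s \<in> Z - {\<zero>}" "x \<otimes> s = y \<otimes> s"
  shows "x = y"
proof -
  note s = Z_nonzeroD(1)[OF assms(3)] Z_nonzeroD(3)[OF assms(3)]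
  have "(x \<ominus> y) \<otimes> s = x \<otimes> s \<ominus> y \<otimes> s" using assms(1,2) s by (simp add: minus_eq l_distr l_minus)
  also have "\<dots> = \<zero>" using assms(1,2) s unfolding assms(4) by (simp add: minus_eq r_neg)
  finally have "x \<ominus> y = \<zero>" using integral[of "x \<ominus> y" s] assms(1,2) s by auto
  then show ?thesis using assms(1,2) by simp
qed

lemma mem_frac_iff:
  "(b, t) \<in> frac E a s \<longleftrightarrow> b \<in> carrier E \<and> t \<in> Z - {\<zero>} \<and> a \<otimes> t = b \<otimes> s"
  by (simp add: frac_def)

text \<open>Equality of classes amounts to transitivity of the defining relation, in which the
  middle denominator s is central and can be cancelled because \<open>E\<close> has no zero
  divisors.\<close>

lemma frac_eq_iff:
  assumes a: "a \<in> carrier E" and b: "b \<in> carrier E" and s: "s \<in> Z - {\<zero>}" and t: "t \<in> Z - {\<zero>}"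
  shows "frac E a s = frac E b t \<longleftrightarrow> a \<otimes> t = b \<otimes> s"
proof
  assume "frac E a s = frac E b t"
  moreover have "(b, t) \<in> frac E b t" using b t by (simp add: mem_frac_iff)
  ultimately have "(b, t) \<in> frac E a s" by simp
  then show "a \<otimes> t = b \<otimes> s" by (simp add: mem_frac_iff)
next
  have sub: "frac E a s \<subseteq> frac E b t" if a: "a \<in> carrier E" and b: "b \<in> carrier E"
    and s: "s \<in> Z - {\<zero>}" and t: "t \<in> Z - {\<zero>}" and eq: "a \<otimes> t = b \<otimes> s" for a b s t
  proof
    fix p assume p: "p \<in> frac E a s"
    obtain c u where cu: "p = (c, u)" by (cases p)
    then have c: "c \<in> carrier E" "u \<in> Z - {\<zero>}" "a \<otimes> u = c \<otimes> s" using p by (simp_all add: mem_frac_iff)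
    note m = Z_nonzeroD(1)[OF s] Z_nonzeroD(1)[OF t] Z_nonzeroD(1)[OF c(2)]
    have "b \<otimes> u \<otimes> s = b \<otimes> s \<otimes> u" using Z_nonzeroD(4)[OF s m(3)] b m by (simp add: m_assoc)
    also have "\<dots> = a \<otimes> t \<otimes> u" using eq by simp
    also have "\<dots> = a \<otimes> u \<otimes> t" using Z_nonzeroD(4)[OF t m(3)] a m by (simp add: m_assoc)
    also have "\<dots> = c \<otimes> s \<otimes> t" using c by simp
    also have "\<dots> = c \<otimes> t \<otimes> s" using Z_nonzeroD(4)[OF s m(2)] c m by (simp add: m_assoc)
    finally have "b \<otimes> u = c \<otimes> t" using cancel_right[OF _ _ s] b c m by simp
    then show "p \<in> frac E b t" using cu c by (simp add: mem_frac_iff)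
  qed
  assume eq: "a \<otimes> t = b \<otimes> s"
  show "frac E a s = frac E b t"
    using sub[OF a b s t eq] sub[OF b a t s eq[symmetric]] by blast
qed

lemma frac_expand:
  assumes "a \<in> carrier E" "s \<in> Z - {\<zero>}" "t \<in> Z - {\<zero>}"
  shows "frac E (a \<otimes> t) (s \<otimes> t) = frac E a s" "frac E (a \<otimes> t) (t \<otimes> s) = frac E a s"
proof -
  note m = Z_nonzeroD(1)[OF assms(2)] Z_nonzeroD(1)[OF assms(3)]
  have st: "t \<otimes> s = s \<otimes> t" by (rule Z_nonzeroD(4)[OF assms(3) m(1)])
  show 1: "frac E (a \<otimes> t) (s \<otimes> t) = frac E a s"
    using assms m st Z_nonzero_mult by (subst frac_eq_iff) (auto simp: m_assoc)
  show "frac E (a \<otimes> t) (t \<otimes> s) = frac E a s" using 1 st by simp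
qed

lemma frac_closed: "\<lbrakk>a \<in> carrier E; s \<in> Z - {\<zero>}\<rbrakk> \<Longrightarrow> frac E a s \<in> carrier Q"
  by (auto simp: quot_ring_def)

lemma Q_cases:
  assumes "p \<in> carrier Q"
  obtains a s where "a \<in> carrier E" "s \<in> Z - {\<zero>}" "p = frac E a s"
  using assms by (auto simp: quot_ring_def)

lemma frac_mult:
  assumes a: "a \<in> carrier E" and b: "b \<in> carrier E" and s: "s \<in> Z - {\<zero>}" and t: "t \<in> Z - {\<zero>}"
  shows "frac E a s \<otimes>\<^bsub>Q\<^esub> frac E b t = frac E (a \<otimes> b) (s \<otimes> t)"
proof -
  have eq: "frac E (a' \<otimes> b') (s' \<otimes> t') = frac E (a \<otimes> b) (s \<otimes> t)"
    if "(a', s') \<in> frac E a s" "(b', t') \<in> frac E b t" for a' s' b' t'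
  proof -
    have p: "a' \<in> carrier E" "s' \<in> Z - {\<zero>}" "a \<otimes> s' = a' \<otimes> s" "b' \<in> carrier E" "t' \<in> Z - {\<zero>}" "b \<otimes> t' = b' \<otimes> t"
      using that by (simp_all add: mem_frac_iff)
    note m = Z_nonzeroD(1)[OF s] Z_nonzeroD(1)[OF t] Z_nonzeroD(1)[OF p(2)] Z_nonzeroD(1)[OF p(5)]
    have "(a' \<otimes> b') \<otimes> (s \<otimes> t) = a' \<otimes> (b' \<otimes> s) \<otimes> t" using p m by (simp add: m_assoc)
    also have "b' \<otimes> s = s \<otimes> b'" using Z_nonzeroD(4)[OF s p(4)] by simp
    also have "a' \<otimes> (s \<otimes> b') \<otimes> t = (a' \<otimes> s) \<otimes> (b' \<otimes> t)" using p m by (simp add: m_assoc)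
    also have "\<dots> = (a \<otimes> s') \<otimes> (b \<otimes> t')" using p by simp
    also have "\<dots> = a \<otimes> (s' \<otimes> b) \<otimes> t'" using a b m by (simp add: m_assoc)
    also have "s' \<otimes> b = b \<otimes> s'" by (rule Z_nonzeroD(4)[OF p(2) b])
    finally have "(a' \<otimes> b') \<otimes> (s \<otimes> t) = (a \<otimes> b) \<otimes> (s' \<otimes> t')" using a b m by (simp add: m_assoc)
    then show ?thesis using a b p s t Z_nonzero_mult by (subst frac_eq_iff) auto
  qed
  have "(a, s) \<in> frac E a s" "(b, t) \<in> frac E b t" using assms by (simp_all add: mem_frac_iff)
  then have "(\<Union>(a, s)\<in>frac E a s. \<Union>(b, t)\<in>frac E b t. frac E (a \<otimes> b) (s \<otimes> t)) = frac E (a \<otimes> b) (s \<otimes> t)"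
    using eq by (rule UN_pairs_const)
  then show ?thesis by (simp add: quot_ring_def)
qed

lemma frac_add:
  assumes a: "a \<in> carrier E" and b: "b \<in> carrier E" and s: "s \<in> Z - {\<zero>}" and t: "t \<in> Z - {\<zero>}"
  shows "frac E a s \<oplus>\<^bsub>Q\<^esub> frac E b t = frac E (a \<otimes> t \<oplus> b \<otimes> s) (s \<otimes> t)"
proof -
  have eq: "frac E (a' \<otimes> t' \<oplus> b' \<otimes> s') (s' \<otimes> t') = frac E (a \<otimes> t \<oplus> b \<otimes> s) (s \<otimes> t)"
    if "(a', s') \<in> frac E a s" "(b', t') \<in> frac E b t" for a' s' b' t'
  proof -
    have p: "a' \<in> carrier E" "s' \<in> Z - {\<zero>}" "a \<otimes> s' = a' \<otimes> s" "b' \<in> carrier E" "t' \<in> Z - {\<zero>}" "b \<otimes> t' = b' \<otimes> t"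
      using that by (simp_all add: mem_frac_iff)
    note m = Z_nonzeroD(1)[OF s] Z_nonzeroD(1)[OF t] Z_nonzeroD(1)[OF p(2)] Z_nonzeroD(1)[OF p(5)]
    have 1: "a' \<otimes> t' \<otimes> (s \<otimes> t) = a \<otimes> t \<otimes> (s' \<otimes> t')"
    proof -
      have "a' \<otimes> t' \<otimes> (s \<otimes> t) = a' \<otimes> (t' \<otimes> (s \<otimes> t))" using p m by (simp add: m_assoc)
      also have "t' \<otimes> (s \<otimes> t) = (s \<otimes> t) \<otimes> t'" using m by (intro Z_nonzeroD(4)[OF p(5)]) simp
      also have "a' \<otimes> ((s \<otimes> t) \<otimes> t') = (a' \<otimes> s) \<otimes> t \<otimes> t'" using p m by (simp add: m_assoc)
      also have "a' \<otimes> s = a \<otimes> s'" using p by simp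
      also have "a \<otimes> s' \<otimes> t \<otimes> t' = a \<otimes> (s' \<otimes> t) \<otimes> t'" using a m by (simp add: m_assoc)
      also have "s' \<otimes> t = t \<otimes> s'" by (rule Z_nonzeroD(4)[OF p(2) m(2)])
      finally show ?thesis using a m by (simp add: m_assoc)
    qed
    have 2: "b' \<otimes> s' \<otimes> (s \<otimes> t) = b \<otimes> s \<otimes> (s' \<otimes> t')"
    proof -
      have "b' \<otimes> s' \<otimes> (s \<otimes> t) = b' \<otimes> ((s' \<otimes> s) \<otimes> t)" using p m by (simp add: m_assoc)
      also have "(s' \<otimes> s) \<otimes> t = t \<otimes> (s' \<otimes> s)" using m Z_nonzeroD(4)[OF t, of "s' \<otimes> s"] by simp
      also have "b' \<otimes> (t \<otimes> (s' \<otimes> s)) = (b' \<otimes> t) \<otimes> (s' \<otimes> s)" using p m by (simp add: m_assoc)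
      also have "b' \<otimes> t = b \<otimes> t'" using p by simp
      also have "b \<otimes> t' \<otimes> (s' \<otimes> s) = b \<otimes> (t' \<otimes> (s' \<otimes> s))" using b m by (simp add: m_assoc)
      also have "t' \<otimes> (s' \<otimes> s) = (s' \<otimes> s) \<otimes> t'" using m by (intro Z_nonzeroD(4)[OF p(5)]) simp
      also have "s' \<otimes> s = s \<otimes> s'" by (rule Z_nonzeroD(4)[OF p(2) m(1)])
      finally show ?thesis using b m by (simp add: m_assoc)
    qed
    have "(a' \<otimes> t' \<oplus> b' \<otimes> s') \<otimes> (s \<otimes> t) = a' \<otimes> t' \<otimes> (s \<otimes> t) \<oplus> b' \<otimes> s' \<otimes> (s \<otimes> t)"
      using p m by (intro l_distr) auto
    also have "\<dots> = a \<otimes> t \<otimes> (s' \<otimes> t') \<oplus> b \<otimes> s \<otimes> (s' \<otimes> t')" unfolding 1 2 ..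
    also have "\<dots> = (a \<otimes> t \<oplus> b \<otimes> s) \<otimes> (s' \<otimes> t')"
      using a b m by (intro l_distr[symmetric]) auto
    finally show ?thesis using a b p m Z_nonzero_mult[OF s t] Z_nonzero_mult[OF p(2,5)]
      by (subst frac_eq_iff) auto
  qed
  have "(a, s) \<in> frac E a s" "(b, t) \<in> frac E b t" using assms by (simp_all add: mem_frac_iff)
  then have "(\<Union>(a, s)\<in>frac E a s. \<Union>(b, t)\<in>frac E b t. frac E (a \<otimes> t \<oplus> b \<otimes> s) (s \<otimes> t))
      = frac E (a \<otimes> t \<oplus> b \<otimes> s) (s \<otimes> t)"
    using eq by (rule UN_pairs_const)
  then show ?thesis by (simp add: quot_ring_def)
qed

lemma frac_add_same:
  assumes a: "a \<in> carrier E" and b: "b \<in> carrier E" and s: "s \<in> Z - {\<zero>}"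
  shows "frac E a s \<oplus>\<^bsub>Q\<^esub> frac E b s = frac E (a \<oplus> b) s"
proof -
  have sc: "s \<in> carrier E" using s Z_nonzeroD by blast
  have "frac E a s \<oplus>\<^bsub>Q\<^esub> frac E b s = frac E ((a \<oplus> b) \<otimes> s) (s \<otimes> s)"
    using frac_add[OF a b s s] a b sc by (simp add: l_distr)
  then show ?thesis using frac_expand(1)[of "a \<oplus> b" s s] a b s by simp
qed

lemma Q_one: "\<one>\<^bsub>Q\<^esub> = frac E \<one> \<one>" and Q_zero: "\<zero>\<^bsub>Q\<^esub> = frac E \<zero> \<one>"
  by (simp_all add: quot_ring_def)

lemma frac_eq_zero_iff:
  assumes "a \<in> carrier E" "s \<in> Z - {\<zero>}"
  shows "frac E a s = \<zero>\<^bsub>Q\<^esub> \<longleftrightarrow> a = \<zero>"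
  unfolding Q_zero using assms Z_nonzeroD(1) one_Z_nonzero by (subst frac_eq_iff) auto

text \<open>Over one denominator, fractions are added by adding numerators. The additive axioms,
  distributivity and the comparison of basis expansions thus become statements in
  \<open>E\<close>.\<close>

lemma common_denominator:
  assumes "finite I" "\<And>i. i \<in> I \<Longrightarrow> q i \<in> carrier Q"
  shows "\<exists>u\<in>Z - {\<zero>}. \<forall>i\<in>I. \<exists>a\<in>carrier E. q i = frac E a u"
  using assms
proof (induction I rule: finite_induct)
  case empty
  then show ?case using one_Z_nonzero by blast
next
  case (insert i I)
  then obtain u where u: "u \<in> Z - {\<zero>}" "\<forall>i\<in>I. \<exists>a\<in>carrier E. q i = frac E a u" by auto
  obtain b t where b: "b \<in> carrier E" "t \<in> Z - {\<zero>}" "q i = frac E b t"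
    by (rule Q_cases[OF insert.prems[OF insertI1]])
  have "\<exists>a\<in>carrier E. q j = frac E a (u \<otimes> t)" if "j \<in> insert i I" for j
  proof (cases "j = i")
    case True
    have "q i = frac E (b \<otimes> u) (u \<otimes> t)" using frac_expand(2)[OF b(1,2) u(1)] b(3) by simp
    then show ?thesis using True b u Z_nonzeroD(1) by blast
  next
    case False
    then have "j \<in> I" using that by simp
    from bspec[OF u(2) this] obtain a where a: "a \<in> carrier E" "q j = frac E a u" by (rule bexE)
    then have "q j = frac E (a \<otimes> t) (u \<otimes> t)" using frac_expand(1)[OF a(1) u(1) b(2)] by simp
    then show ?thesis using a b Z_nonzeroD(1) by blast
  qed
  then show ?case using Z_nonzero_mult[OF u(1) b(2)] by blast
qed

lemma common_denominator3:
  assumes "p \<in> carrier Q" "q \<in> carrier Q" "r \<in> carrier Q"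
  obtains a b c u where "a \<in> carrier E" "b \<in> carrier E" "c \<in> carrier E" "u \<in> Z - {\<zero>}"
    "p = frac E a u" "q = frac E b u" "r = frac E c u"
proof -
  have "\<exists>u\<in>Z - {\<zero>}. \<forall>i\<in>{p, q, r}. \<exists>a\<in>carrier E. i = frac E a u"
    using assms by (intro common_denominator) auto
  then obtain u where u: "u \<in> Z - {\<zero>}" "\<exists>a\<in>carrier E. p = frac E a u"
    "\<exists>a\<in>carrier E. q = frac E a u" "\<exists>a\<in>carrier E. r = frac E a u" by auto
  from u(2) obtain a where a: "a \<in> carrier E" "p = frac E a u" by (rule bexE)
  from u(3) obtain b where b: "b \<in> carrier E" "q = frac E b u" by (rule bexE)
  from u(4) obtain c where c: "c \<in> carrier E" "r = frac E c u" by (rule bexE)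
  show ?thesis by (rule that[OF a(1) b(1) c(1) u(1) a(2) b(2) c(2)])
qed

lemma ring_Q: "ring Q"
proof (rule ringI)
  show "abelian_group Q"
  proof (rule abelian_groupI)
    fix p q r assume pqr: "p \<in> carrier Q" "q \<in> carrier Q" "r \<in> carrier Q"
    obtain a b c u where abc: "a \<in> carrier E" "b \<in> carrier E" "c \<in> carrier E" "u \<in> Z - {\<zero>}"
      "p = frac E a u" "q = frac E b u" "r = frac E c u"
      using common_denominator3[OF pqr] .
    show "p \<oplus>\<^bsub>Q\<^esub> q \<oplus>\<^bsub>Q\<^esub> r = p \<oplus>\<^bsub>Q\<^esub> (q \<oplus>\<^bsub>Q\<^esub> r)"
      using abc(1-4) by (simp add: abc(5-7) frac_add_same a_assoc)
  next
    fix p q assume pq: "p \<in> carrier Q" "q \<in> carrier Q"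
    obtain a b c u where abc: "a \<in> carrier E" "b \<in> carrier E" "c \<in> carrier E" "u \<in> Z - {\<zero>}"
      "p = frac E a u" "q = frac E b u" "p = frac E c u"
      using common_denominator3[OF pq pq(1)] .
    show "p \<oplus>\<^bsub>Q\<^esub> q = q \<oplus>\<^bsub>Q\<^esub> p"
      using abc(1-4) by (simp add: abc(5,6) frac_add_same a_comm)
    show "p \<oplus>\<^bsub>Q\<^esub> q \<in> carrier Q"
      using abc(1-4) by (simp add: abc(5,6) frac_add_same frac_closed)
  next
    show "\<zero>\<^bsub>Q\<^esub> \<in> carrier Q" unfolding Q_zero using one_Z_nonzero by (intro frac_closed) auto
  next
    fix p assume "p \<in> carrier Q"
    then obtain a s where a: "a \<in> carrier E" "s \<in> Z - {\<zero>}" "p = frac E a s" by (rule Q_cases)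
    have z: "\<zero>\<^bsub>Q\<^esub> = frac E \<zero> s" using frac_eq_zero_iff[OF zero_closed a(2)] by simp
    show "\<zero>\<^bsub>Q\<^esub> \<oplus>\<^bsub>Q\<^esub> p = p" unfolding z a(3) using a by (simp add: frac_add_same)
    have "frac E (\<ominus> a) s \<oplus>\<^bsub>Q\<^esub> p = \<zero>\<^bsub>Q\<^esub>"
      unfolding z a(3) using a by (simp add: frac_add_same l_neg)
    then show "\<exists>q\<in>carrier Q. q \<oplus>\<^bsub>Q\<^esub> p = \<zero>\<^bsub>Q\<^esub>" using a frac_closed a_inv_closed by blast
  qed
  show "monoid Q"
  proof (rule monoidI)
    show "\<one>\<^bsub>Q\<^esub> \<in> carrier Q" unfolding Q_one using one_Z_nonzero by (intro frac_closed) auto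
  next
    fix p q r assume pqr: "p \<in> carrier Q" "q \<in> carrier Q" "r \<in> carrier Q"
    obtain a s where p: "a \<in> carrier E" "s \<in> Z - {\<zero>}" "p = frac E a s" by (rule Q_cases[OF pqr(1)])
    obtain b t where q: "b \<in> carrier E" "t \<in> Z - {\<zero>}" "q = frac E b t" by (rule Q_cases[OF pqr(2)])
    obtain c u where r: "c \<in> carrier E" "u \<in> Z - {\<zero>}" "r = frac E c u" by (rule Q_cases[OF pqr(3)])
    show "p \<otimes>\<^bsub>Q\<^esub> q \<otimes>\<^bsub>Q\<^esub> r = p \<otimes>\<^bsub>Q\<^esub> (q \<otimes>\<^bsub>Q\<^esub> r)"
      unfolding p(3) q(3) r(3)
      using p(1,2) q(1,2) r(1,2) Z_nonzero_mult Z_nonzeroD(1)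
      by (simp add: frac_mult m_assoc del: Diff_iff)
  next
    fix p q assume pq: "p \<in> carrier Q" "q \<in> carrier Q"
    obtain a s where p: "a \<in> carrier E" "s \<in> Z - {\<zero>}" "p = frac E a s" by (rule Q_cases[OF pq(1)])
    obtain b t where q: "b \<in> carrier E" "t \<in> Z - {\<zero>}" "q = frac E b t" by (rule Q_cases[OF pq(2)])
    show "p \<otimes>\<^bsub>Q\<^esub> q \<in> carrier Q"
      unfolding p(3) q(3) frac_mult[OF p(1) q(1) p(2) q(2)]
      using p q Z_nonzero_mult by (intro frac_closed) auto
  next
    fix p assume "p \<in> carrier Q"
    then obtain a s where a: "a \<in> carrier E" "s \<in> Z - {\<zero>}" "p = frac E a s" by (rule Q_cases)
    show "\<one>\<^bsub>Q\<^esub> \<otimes>\<^bsub>Q\<^esub> p = p" "p \<otimes>\<^bsub>Q\<^esub> \<one>\<^bsub>Q\<^esub> = p"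
      unfolding a(3) Q_one frac_mult[OF a(1) one_closed a(2) one_Z_nonzero]
        frac_mult[OF one_closed a(1) one_Z_nonzero a(2)]
      using a(1) Z_nonzeroD(1)[OF a(2)] by simp_all
  qed
  fix p q r assume pqr: "p \<in> carrier Q" "q \<in> carrier Q" "r \<in> carrier Q"
  obtain a b c u where abc: "a \<in> carrier E" "b \<in> carrier E" "c \<in> carrier E" "u \<in> Z - {\<zero>}"
    "p = frac E a u" "q = frac E b u" "r = frac E c u"
    using common_denominator3[OF pqr] .
  note uu = Z_nonzero_mult[OF abc(4) abc(4)]
  show "(p \<oplus>\<^bsub>Q\<^esub> q) \<otimes>\<^bsub>Q\<^esub> r = p \<otimes>\<^bsub>Q\<^esub> r \<oplus>\<^bsub>Q\<^esub> q \<otimes>\<^bsub>Q\<^esub> r"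
    using abc(1-4) uu by (simp add: abc(5-7) frac_add_same frac_mult l_distr del: Diff_iff)
  show "r \<otimes>\<^bsub>Q\<^esub> (p \<oplus>\<^bsub>Q\<^esub> q) = r \<otimes>\<^bsub>Q\<^esub> p \<oplus>\<^bsub>Q\<^esub> r \<otimes>\<^bsub>Q\<^esub> q"
    using abc(1-4) uu by (simp add: abc(5-7) frac_add_same frac_mult r_distr del: Diff_iff)
qed

text \<open>Testing against the fractions x/1 detects noncentral numerators, while central
  denominators never obstruct. The center of \<open>Q\<close> therefore consists of the fractions of
  T.\<close>

lemma frac_central_iff:
  assumes a: "a \<in> carrier E" and s: "s \<in> Z - {\<zero>}"
  shows "frac E a s \<in> ring_center Q \<longleftrightarrow> a \<in> Z"
proof
  assume c: "frac E a s \<in> ring_center Q"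
  have sc: "s \<in> carrier E" using s Z_nonzeroD by blast
  have "a \<otimes> x = x \<otimes> a" if x: "x \<in> carrier E" for x
  proof -
    have "frac E x \<one> \<in> carrier Q" by (rule frac_closed[OF x one_Z_nonzero])
    then have "frac E a s \<otimes>\<^bsub>Q\<^esub> frac E x \<one> = frac E x \<one> \<otimes>\<^bsub>Q\<^esub> frac E a s"
      using c by (simp add: ring_center_def)
    then have "frac E (a \<otimes> x) s = frac E (x \<otimes> a) s"
      using frac_mult[OF a x s one_Z_nonzero] frac_mult[OF x a one_Z_nonzero s] sc by simp
    then have "a \<otimes> x \<otimes> s = x \<otimes> a \<otimes> s" using a x s by (simp add: frac_eq_iff del: Diff_iff)
    then show ?thesis using cancel_right[OF _ _ s] a x by simp
  qed
  then show "a \<in> Z" using a by (simp add: ring_center_def)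
next
  assume aZ: "a \<in> Z"
  show "frac E a s \<in> ring_center Q"
    unfolding ring_center_def
  proof (intro CollectI conjI ballI)
    show "frac E a s \<in> carrier Q" by (rule frac_closed[OF a s])
    fix p assume "p \<in> carrier Q"
    then obtain b t where b: "b \<in> carrier E" "t \<in> Z - {\<zero>}" "p = frac E b t" by (rule Q_cases)
    show "frac E a s \<otimes>\<^bsub>Q\<^esub> p = p \<otimes>\<^bsub>Q\<^esub> frac E a s"
      unfolding b(3) frac_mult[OF a b(1) s b(2)] frac_mult[OF b(1) a b(2) s]
      using ring_centerD(2)[OF aZ b(1)] Z_nonzeroD(4)[OF s Z_nonzeroD(1)[OF b(2)]] by simp
  qed
qed

lemma Q_integral:
  assumes "p \<in> carrier Q" "q \<in> carrier Q" "p \<otimes>\<^bsub>Q\<^esub> q = \<zero>\<^bsub>Q\<^esub>"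
  shows "p = \<zero>\<^bsub>Q\<^esub> \<or> q = \<zero>\<^bsub>Q\<^esub>"
proof -
  obtain a s where p: "a \<in> carrier E" "s \<in> Z - {\<zero>}" "p = frac E a s" by (rule Q_cases[OF assms(1)])
  obtain b t where q: "b \<in> carrier E" "t \<in> Z - {\<zero>}" "q = frac E b t" by (rule Q_cases[OF assms(2)])
  have "a \<otimes> b = \<zero>"
    using assms(3) frac_eq_zero_iff[of "a \<otimes> b" "s \<otimes> t"] Z_nonzero_mult[OF p(2) q(2)] p(1) q(1)
    unfolding p(3) q(3) frac_mult[OF p(1) q(1) p(2) q(2)] by simp
  then have "a = \<zero> \<or> b = \<zero>" using integral p q by blast
  then show ?thesis using p q frac_eq_zero_iff by auto
qed

lemma Q_one_not_zero: "\<one>\<^bsub>Q\<^esub> \<noteq> \<zero>\<^bsub>Q\<^esub>"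
  unfolding Q_one using frac_eq_zero_iff[OF one_closed one_Z_nonzero] one_not_zero by simp

lemma Q_center_subfield: "subfield (ring_center Q) Q"
proof -
  interpret Q: ring Q by (rule ring_Q)
  show ?thesis
  proof (rule Q.subfield_of_commuting_invertible[OF Q.ring_center_subring _ _ Q_one_not_zero])
    show "x \<otimes>\<^bsub>Q\<^esub> y = y \<otimes>\<^bsub>Q\<^esub> x" if "x \<in> ring_center Q" "y \<in> ring_center Q" for x y
      using Q.ring_centerD(2)[OF that(1) Q.ring_centerD(1)[OF that(2)]] .
    fix p assume p: "p \<in> ring_center Q" "p \<noteq> \<zero>\<^bsub>Q\<^esub>"
    have pc: "p \<in> carrier Q" using p Q.ring_centerD by blast
    then obtain a s where a: "a \<in> carrier E" "s \<in> Z - {\<zero>}" "p = frac E a s" by (rule Q_cases)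
    have aZ: "a \<in> Z - {\<zero>}" using p a frac_central_iff[OF a(1,2)] frac_eq_zero_iff[OF a(1,2)] by simp
    have sc: "s \<in> carrier E" using a Z_nonzeroD by blast
    \<comment> \<open>The inverse of a/s, admissible as a fraction because the numerator a has been
      recognised as central and nonzero.\<close>
    define q where "q = frac E s a"
    have qc: "q \<in> carrier Q" unfolding q_def by (rule frac_closed[OF sc aZ])
    have "frac E (a \<otimes> s) (s \<otimes> a) = frac E \<one> \<one>"
      using Z_nonzeroD(4)[OF aZ sc] Z_nonzero_mult[OF a(2) aZ] a(1) sc one_Z_nonzero
      by (subst frac_eq_iff) auto
    then have "p \<otimes>\<^bsub>Q\<^esub> q = \<one>\<^bsub>Q\<^esub>" unfolding a(3) q_def Q_one frac_mult[OF a(1) sc a(2) aZ] .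
    moreover have "q \<otimes>\<^bsub>Q\<^esub> p = p \<otimes>\<^bsub>Q\<^esub> q" using Q.ring_centerD(2)[OF p(1) qc] by (rule sym)
    ultimately have pU: "p \<in> Units Q" using pc qc by (auto simp: Units_def)
    then show "p \<in> Units Q \<and> inv\<^bsub>Q\<^esub> p \<in> ring_center Q" using Q.ring_center_inv p by blast
  qed
qed

lemma frac_finsum:
  assumes "finite I" "\<And>i. i \<in> I \<Longrightarrow> f i \<in> carrier E" "u \<in> Z - {\<zero>}"
  shows "(\<Oplus>\<^bsub>Q\<^esub>i\<in>I. frac E (f i) u) = frac E (\<Oplus>i\<in>I. f i) u"
  using assms(1,2)
proof (induction I rule: finite_induct)
  interpret Q: ring Q by (rule ring_Q)
  case empty
  then show ?case using frac_eq_zero_iff[OF zero_closed assms(3)] by simp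
next
  interpret Q: ring Q by (rule ring_Q)
  case (insert i I)
  have fi: "f i \<in> carrier E" "f \<in> I \<rightarrow> carrier E" using insert.prems by auto
  have "(\<Oplus>\<^bsub>Q\<^esub>i\<in>insert i I. frac E (f i) u) = frac E (f i) u \<oplus>\<^bsub>Q\<^esub> (\<Oplus>\<^bsub>Q\<^esub>i\<in>I. frac E (f i) u)"
    using insert.hyps insert.prems frac_closed[OF _ assms(3)] by (intro Q.finsum_insert) auto
  also have "\<dots> = frac E (f i) u \<oplus>\<^bsub>Q\<^esub> frac E (\<Oplus>i\<in>I. f i) u" using insert by simp
  also have "\<dots> = frac E (f i \<oplus> (\<Oplus>i\<in>I. f i)) u"
    using fi assms(3) by (intro frac_add_same) auto
  also have "f i \<oplus> (\<Oplus>i\<in>I. f i) = (\<Oplus>i\<in>insert i I. f i)"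
    using insert.hyps fi by simp
  finally show ?case .
qed

text \<open>A basis of \<open>E\<close> over T stays a basis after inverting the nonzero elements of
  T. Existence divides an expansion of the numerator by the denominator; uniqueness clears
  denominators and returns to \<open>E\<close>.\<close>

lemma Q_module_basis:
  assumes B: "module_basis E Z B"
  shows "module_basis Q (ring_center Q) ((\<lambda>b. frac E b \<one>) ` B)"
proof -
  interpret Q: ring Q by (rule ring_Q)
  let ?j = "\<lambda>b. frac E b \<one>"
  have fin: "finite B" and Bc: "b \<in> carrier E" if "b \<in> B" for b
    using B that by (auto simp: module_basis_def)
  have finB: "finite B" using B by (simp add: module_basis_def)
  have inj: "inj_on ?j B"
  proof (rule inj_onI)
    fix b b' assume "b \<in> B" "b' \<in> B" "?j b = ?j b'"
    then show "b = b'" using frac_eq_iff[OF Bc Bc one_Z_nonzero one_Z_nonzero, of b b'] Bc by simp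
  qed
  have jc: "?j b \<in> carrier Q" if "b \<in> B" for b using frac_closed[OF Bc[OF that] one_Z_nonzero] .
  have reindex: "(\<Oplus>\<^bsub>Q\<^esub>\<beta>\<in>?j ` B. c \<beta> \<otimes>\<^bsub>Q\<^esub> \<beta>) = (\<Oplus>\<^bsub>Q\<^esub>b\<in>B. c (?j b) \<otimes>\<^bsub>Q\<^esub> ?j b)"
    if "\<And>b. b \<in> B \<Longrightarrow> c (?j b) \<in> carrier Q" for c
    using that jc by (intro Q.finsum_reindex[OF _ inj]) auto
  have sum: "(\<Oplus>\<^bsub>Q\<^esub>b\<in>B. frac E (z b) u \<otimes>\<^bsub>Q\<^esub> ?j b) = frac E (\<Oplus>b\<in>B. z b \<otimes> b) u"
    if z: "\<And>b. b \<in> B \<Longrightarrow> z b \<in> carrier E" and u: "u \<in> Z - {\<zero>}" for z u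
  proof -
    have uc: "u \<in> carrier E" using u Z_nonzeroD by blast
    have "(\<Oplus>\<^bsub>Q\<^esub>b\<in>B. frac E (z b) u \<otimes>\<^bsub>Q\<^esub> ?j b) = (\<Oplus>\<^bsub>Q\<^esub>b\<in>B. frac E (z b \<otimes> b) u)"
    proof (rule Q.finsum_cong'[OF refl])
      show "(\<lambda>b. frac E (z b \<otimes> b) u) \<in> B \<rightarrow> carrier Q" using z Bc u frac_closed by auto
      fix b assume b: "b \<in> B"
      show "frac E (z b) u \<otimes>\<^bsub>Q\<^esub> ?j b = frac E (z b \<otimes> b) u"
        using frac_mult[OF z[OF b] Bc[OF b] u one_Z_nonzero] uc by simp
    qed
    also have "\<dots> = frac E (\<Oplus>b\<in>B. z b \<otimes> b) u"
      using z Bc u finB by (intro frac_finsum) auto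
    finally show ?thesis .
  qed
  show ?thesis
    unfolding module_basis_def
  proof (intro conjI ballI)
    show "finite (?j ` B)" using finB by simp
    show "?j ` B \<subseteq> carrier Q" using jc by blast
    fix p assume "p \<in> carrier Q"
    then obtain a s where a: "a \<in> carrier E" "s \<in> Z - {\<zero>}" "p = frac E a s" by (rule Q_cases)
    obtain z where z: "z \<in> B \<rightarrow>\<^sub>E Z" "a = (\<Oplus>b\<in>B. z b \<otimes> b)"
      using B a(1) unfolding module_basis_def by blast
    have zZ: "z b \<in> Z" "z b \<in> carrier E" if "b \<in> B" for b
      using PiE_mem[OF z(1) that] ring_centerD by auto
    \<comment> \<open>Coefficient functions live on the image of the basis, so each image is traced
      back to its basis element; this is unambiguous by \<open>inj\<close>.\<close>
    define k where "k = (\<lambda>\<beta>\<in>?j ` B. frac E (z (inv_into B ?j \<beta>)) s)"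
    have kj: "k (?j b) = frac E (z b) s" if "b \<in> B" for b
      using that inv_into_f_f[OF inj that] by (simp add: k_def)
    have kC: "k \<in> ?j ` B \<rightarrow>\<^sub>E ring_center Q"
    proof (rule PiE_I)
      fix \<beta> assume "\<beta> \<in> ?j ` B"
      then obtain b where "b \<in> B" "\<beta> = ?j b" by blast
      then show "k \<beta> \<in> ring_center Q" using kj zZ frac_central_iff[OF _ a(2)] by simp
    qed (simp add: k_def)
    have "(\<Oplus>\<^bsub>Q\<^esub>\<beta>\<in>?j ` B. k \<beta> \<otimes>\<^bsub>Q\<^esub> \<beta>) = (\<Oplus>\<^bsub>Q\<^esub>b\<in>B. k (?j b) \<otimes>\<^bsub>Q\<^esub> ?j b)"
      using kj zZ frac_closed a(2) by (intro reindex) auto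
    also have "\<dots> = (\<Oplus>\<^bsub>Q\<^esub>b\<in>B. frac E (z b) s \<otimes>\<^bsub>Q\<^esub> ?j b)"
      using kj zZ frac_closed[OF _ a(2)] jc by (intro Q.finsum_cong') auto
    also have "\<dots> = p" using sum[OF zZ(2) a(2)] z(2) a(3) by simp
    finally have ksum: "p = (\<Oplus>\<^bsub>Q\<^esub>\<beta>\<in>?j ` B. k \<beta> \<otimes>\<^bsub>Q\<^esub> \<beta>)" by simp
    have uniq: "c1 = c2" if c1: "c1 \<in> ?j ` B \<rightarrow>\<^sub>E ring_center Q" "p = (\<Oplus>\<^bsub>Q\<^esub>\<beta>\<in>?j ` B. c1 \<beta> \<otimes>\<^bsub>Q\<^esub> \<beta>)"
      and c2: "c2 \<in> ?j ` B \<rightarrow>\<^sub>E ring_center Q" "p = (\<Oplus>\<^bsub>Q\<^esub>\<beta>\<in>?j ` B. c2 \<beta> \<otimes>\<^bsub>Q\<^esub> \<beta>)" for c1 c2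
    proof -
      have m: "c1 (?j b) \<in> ring_center Q" "c2 (?j b) \<in> ring_center Q" if "b \<in> B" for b
        using PiE_mem[OF c1(1)] PiE_mem[OF c2(1)] that by blast+
      then have mc: "c1 (?j b) \<in> carrier Q" "c2 (?j b) \<in> carrier Q" if "b \<in> B" for b
        using that Q.ring_centerD by blast+
      \<comment> \<open>One denominator for all coefficients of both expansions, so that comparing
        the two sums means comparing numerators.\<close>
      have "\<exists>u\<in>Z - {\<zero>}. \<forall>q\<in>(c1 \<circ> ?j) ` B \<union> (c2 \<circ> ?j) ` B. \<exists>a\<in>carrier E. q = frac E a u"
        using finB mc by (intro common_denominator) auto
      then obtain u where u: "u \<in> Z - {\<zero>}" and den: "\<forall>q\<in>(c1 \<circ> ?j) ` B \<union> (c2 \<circ> ?j) ` B. \<exists>a\<in>carrier E. q = frac E a u"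
        by (rule bexE)
      have ex: "\<exists>a\<in>carrier E. c1 (?j b) = frac E a u" "\<exists>a\<in>carrier E. c2 (?j b) = frac E a u" if "b \<in> B" for b
        using den that by simp_all
      obtain z1 z2 where z12: "\<And>b. b \<in> B \<Longrightarrow> z1 b \<in> carrier E \<and> c1 (?j b) = frac E (z1 b) u"
        "\<And>b. b \<in> B \<Longrightarrow> z2 b \<in> carrier E \<and> c2 (?j b) = frac E (z2 b) u"
        using ex by metis
      have zZ: "z1 b \<in> Z" "z2 b \<in> Z" if "b \<in> B" for b
        using z12[OF that] m[OF that] frac_central_iff[OF _ u] by auto
      have eval: "p = frac E (\<Oplus>b\<in>B. w b \<otimes> b) u"
        if "\<And>b. b \<in> B \<Longrightarrow> w b \<in> carrier E \<and> c (?j b) = frac E (w b) u"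
          "p = (\<Oplus>\<^bsub>Q\<^esub>\<beta>\<in>?j ` B. c \<beta> \<otimes>\<^bsub>Q\<^esub> \<beta>)" for c w
      proof -
        have "p = (\<Oplus>\<^bsub>Q\<^esub>b\<in>B. c (?j b) \<otimes>\<^bsub>Q\<^esub> ?j b)"
          unfolding that(2) using that(1) frac_closed[OF _ u] by (intro reindex) auto
        also have "\<dots> = (\<Oplus>\<^bsub>Q\<^esub>b\<in>B. frac E (w b) u \<otimes>\<^bsub>Q\<^esub> ?j b)"
          using that(1) frac_closed[OF _ u] jc by (intro Q.finsum_cong') auto
        also have "\<dots> = frac E (\<Oplus>b\<in>B. w b \<otimes> b) u" using that(1) by (intro sum[OF _ u]) auto
        finally show ?thesis .
      qed
      define y1 y2 where "y1 = (\<Oplus>b\<in>B. z1 b \<otimes> b)" and "y2 = (\<Oplus>b\<in>B. z2 b \<otimes> b)"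
      have yc: "y1 \<in> carrier E" "y2 \<in> carrier E"
        unfolding y1_def y2_def using z12 Bc by (auto intro!: finsum_closed)
      have "frac E y1 u = frac E y2 u"
        unfolding y1_def y2_def using eval[OF z12(1) c1(2)] eval[OF z12(2) c2(2)] by simp
      then have "y1 \<otimes> u = y2 \<otimes> u" using frac_eq_iff[OF yc u u] by simp
      then have y12: "y1 = y2" by (rule cancel_right[OF yc u])
      have "y1 = (\<Oplus>b\<in>B. restrict z1 B b \<otimes> b)" "y2 = (\<Oplus>b\<in>B. restrict z2 B b \<otimes> b)"
        using z12 Bc by (auto simp: y1_def y2_def intro!: finsum_cong')
      then have r: "y1 = (\<Oplus>b\<in>B. restrict z1 B b \<otimes> b)" "y1 = (\<Oplus>b\<in>B. restrict z2 B b \<otimes> b)"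
        unfolding y12 by simp_all
      have "\<exists>!c. c \<in> B \<rightarrow>\<^sub>E Z \<and> y1 = (\<Oplus>b\<in>B. c b \<otimes> b)"
        using B yc(1) unfolding module_basis_def by blast
      moreover have "restrict z1 B \<in> B \<rightarrow>\<^sub>E Z" "restrict z2 B \<in> B \<rightarrow>\<^sub>E Z" using zZ by auto
      ultimately have eq: "restrict z1 B = restrict z2 B" using r by blast
      show "c1 = c2"
      proof (rule PiE_ext[OF c1(1) c2(1)])
        fix \<beta> assume "\<beta> \<in> ?j ` B"
        then obtain b where b: "b \<in> B" "\<beta> = ?j b" by blast
        have "z1 b = z2 b" using fun_cong[OF eq, of b] b by simp
        then show "c1 \<beta> = c2 \<beta>" using z12 b by simp
      qed
    qed
    show "\<exists>!c. c \<in> ?j ` B \<rightarrow>\<^sub>E ring_center Q \<and> p = (\<Oplus>\<^bsub>Q\<^esub>\<beta>\<in>?j ` B. c \<beta> \<otimes>\<^bsub>Q\<^esub> \<beta>)"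
    proof (rule ex1I[of _ k], rule conjI[OF kC ksum])
      fix c assume c: "c \<in> ?j ` B \<rightarrow>\<^sub>E ring_center Q \<and> p = (\<Oplus>\<^bsub>Q\<^esub>\<beta>\<in>?j ` B. c \<beta> \<otimes>\<^bsub>Q\<^esub> \<beta>)"
      show "c = k" by (rule uniq[OF conjunct1[OF c] conjunct2[OF c] kC ksum])
    qed
  qed
qed

text \<open>The ring of fractions has no zero divisors and is finite-dimensional over its center,
  which is a field; this makes every nonzero element invertible.\<close>

lemma Q_division_algebra:
  assumes B: "module_basis E Z B"
  shows "division_algebra Q ((\<lambda>b. frac E b \<one>) ` B)"
proof -
  interpret Q: ring Q by (rule ring_Q)
  let ?B = "(\<lambda>b. frac E b \<one>) ` B"
  note basis = Q_module_basis[OF B]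
  have fin: "finite ?B" and Bc: "?B \<subseteq> carrier Q" using basis by (simp_all add: module_basis_def)
  obtain Vs where Vs: "set Vs = ?B" using finite_list[OF fin] by blast
  note V = Bc[unfolded Vs[symmetric]]
  have "p \<in> Q.Span (ring_center Q) Vs" if "p \<in> carrier Q" for p
  proof -
    have "\<forall>p\<in>carrier Q. \<exists>!c. c \<in> ?B \<rightarrow>\<^sub>E ring_center Q \<and> p = (\<Oplus>\<^bsub>Q\<^esub>\<beta>\<in>?B. c \<beta> \<otimes>\<^bsub>Q\<^esub> \<beta>)"
      by (rule conjunct2[OF conjunct2[OF basis[unfolded module_basis_def]]])
    from ex1_implies_ex[OF bspec[OF this that]]
    obtain c where "c \<in> ?B \<rightarrow>\<^sub>E ring_center Q \<and> p = (\<Oplus>\<^bsub>Q\<^esub>\<beta>\<in>?B. c \<beta> \<otimes>\<^bsub>Q\<^esub> \<beta>)" ..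
    note c = conjunct1[OF this] conjunct2[OF this]
    have "additive_subgroup (Q.Span (ring_center Q) Vs) Q"
      using Q.Span_is_add_subgroup[OF Q_center_subfield V] by (rule additive_subgroup.intro)
    moreover have "c \<beta> \<otimes>\<^bsub>Q\<^esub> \<beta> \<in> Q.Span (ring_center Q) Vs" if "\<beta> \<in> ?B" for \<beta>
    proof -
      have "\<beta> \<in> Q.Span (ring_center Q) Vs"
        using Q.Span_base_incl[OF Q_center_subfield V] Vs that by blast
      then show ?thesis
        by (rule Q.Span_smult_closed[OF Q_center_subfield V PiE_mem[OF c(1) that]])
    qed
    ultimately show ?thesis unfolding c(2) using fin by (intro Q.finsum_mem_subgroup) auto
  qed
  then have span: "carrier Q \<subseteq> Q.Span (ring_center Q) Vs" by blast
  show ?thesis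
  proof (intro division_algebra.intro ring_Q division_algebra_axioms.intro Q_one_not_zero basis)
    fix p assume "p \<in> carrier Q" "p \<noteq> \<zero>\<^bsub>Q\<^esub>"
    with Q_integral show "p \<in> Units Q"
      by (rule Q.finite_dimensional_domain_unit[OF _ Q_center_subfield V span])
  qed
qed

end

section \<open>The reduced norm of the identity\<close>

lemma (in graded_division_ring) Nrd_one:
  assumes "module_basis E (ring_center E) B"
  shows "Nrd E \<one> = \<one>"
proof -
  have red: "reduced_norm Q \<one>\<^bsub>Q\<^esub> = \<one>\<^bsub>Q\<^esub>"
    by (rule reduced_norm_one[OF Q_division_algebra[OF assms]])
  show ?thesis
    unfolding Nrd_def
  proof (rule the_equality)
    show "\<one> \<in> Z \<and> frac E \<one> \<one> = reduced_norm Q (frac E \<one> \<one>)"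
      using red one_Z_nonzero unfolding Q_one by simp
  next
    fix t assume t: "t \<in> Z \<and> frac E t \<one> = reduced_norm Q (frac E \<one> \<one>)"
    then have tc: "t \<in> carrier E" using ring_centerD by blast
    have "frac E t \<one> = frac E \<one> \<one>" using t red unfolding Q_one by simp
    then show "t = \<one>" using frac_eq_iff[OF tc one_closed one_Z_nonzero one_Z_nonzero] tc by simp
  qed
qed

section \<open>The totally ramified case\<close>

context graded_division_involution
begin

lemma grade_set_center_subgroup:
  shows "\<one>\<^bsub>\<Gamma>\<^esub> \<in> grade_set E \<Gamma> grad Z"
    and "\<lbrakk>\<gamma> \<in> grade_set E \<Gamma> grad Z; \<delta> \<in> grade_set E \<Gamma> grad Z\<rbrakk> \<Longrightarrow> \<gamma> \<otimes>\<^bsub>\<Gamma>\<^esub> \<delta> \<in> grade_set E \<Gamma> grad Z"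
    and "\<gamma> \<in> grade_set E \<Gamma> grad Z \<Longrightarrow> inv\<^bsub>\<Gamma>\<^esub> \<gamma> \<in> grade_set E \<Gamma> grad Z"
proof -
  have intro: "\<gamma> \<in> grade_set E \<Gamma> grad Z" if "\<gamma> \<in> carrier \<Gamma>" "z \<in> Z - {\<zero>}" "z \<in> grad \<gamma>" for \<gamma> z
    using that by (auto simp: grade_set_def)
  have elim: "\<exists>z\<in>Z - {\<zero>}. z \<in> grad \<gamma> \<and> \<gamma> \<in> carrier \<Gamma>" if "\<gamma> \<in> grade_set E \<Gamma> grad Z" for \<gamma>
    using that grad_zero[of \<gamma>] ZE(2) by (auto simp: grade_set_def)
  show "\<one>\<^bsub>\<Gamma>\<^esub> \<in> grade_set E \<Gamma> grad Z" using intro one_Z_nonzero one_mem_grad by blast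
  show "\<gamma> \<otimes>\<^bsub>\<Gamma>\<^esub> \<delta> \<in> grade_set E \<Gamma> grad Z" if "\<gamma> \<in> grade_set E \<Gamma> grad Z" "\<delta> \<in> grade_set E \<Gamma> grad Z"
    using elim[OF that(1)] elim[OF that(2)] intro Z_nonzero_mult grad_mult grp.m_closed by meson
  show "inv\<^bsub>\<Gamma>\<^esub> \<gamma> \<in> grade_set E \<Gamma> grad Z" if g: "\<gamma> \<in> grade_set E \<Gamma> grad Z"
  proof -
    obtain z where z: "z \<in> Z - {\<zero>}" "z \<in> grad \<gamma>" "\<gamma> \<in> carrier \<Gamma>" using elim[OF g] by blast
    have zU: "z \<in> Units E" using homogeneous_unit z by blast
    have "inv z \<in> Z" using ring_center_inv z zU by blast
    moreover have "inv z \<noteq> \<zero>" using zU zero_not_unit Units_inv_Units by metis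
    ultimately show ?thesis using intro[of "inv\<^bsub>\<Gamma>\<^esub> \<gamma>" "inv z"] inv_homogeneous[OF zU z(3,2)] z(3) by simp
  qed
qed

text \<open>If every degree of T were a degree of R, all cosets would coincide, and the index would
  be 1 instead of 2.\<close>

lemma exists_central_degree_not_fixed:
  assumes "center_totally_ramified E \<Gamma> grad \<tau>"
  shows "\<exists>\<epsilon>\<in>grade_set E \<Gamma> grad Z. \<epsilon> \<notin> grade_set E \<Gamma> grad (fixed_center E \<tau>)"
proof (rule ccontr)
  let ?H = "grade_set E \<Gamma> grad Z"
  let ?G = "\<Gamma>\<lparr>carrier := ?H\<rparr>"
  assume "\<not> ?thesis"
  then have "?H \<subseteq> grade_set E \<Gamma> grad (fixed_center E \<tau>)" by blast
  moreover have "grade_set E \<Gamma> grad (fixed_center E \<tau>) \<subseteq> ?H"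
  proof
    fix \<gamma> assume g: "\<gamma> \<in> grade_set E \<Gamma> grad (fixed_center E \<tau>)"
    have "\<zero> \<in> fixed_center E \<tau>" using ZE(2) tau_zero by (simp add: fixed_center_def)
    then show "\<gamma> \<in> ?H" using g grad_zero[of \<gamma>] by (auto simp: grade_set_def fixed_center_def)
  qed
  ultimately have eq: "grade_set E \<Gamma> grad (fixed_center E \<tau>) = ?H" by blast
  have Hc: "\<gamma> \<in> carrier \<Gamma>" if "\<gamma> \<in> ?H" for \<gamma> using that by (simp add: grade_set_def)
  have coset: "?H #>\<^bsub>?G\<^esub> a = ?H" if a: "a \<in> ?H" for a
  proof
    show "?H #>\<^bsub>?G\<^esub> a \<subseteq> ?H" using grade_set_center_subgroup(2) a by (auto simp: r_coset_def)
    show "?H \<subseteq> ?H #>\<^bsub>?G\<^esub> a"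
    proof
      fix h assume h: "h \<in> ?H"
      have "h = h \<otimes>\<^bsub>\<Gamma>\<^esub> inv\<^bsub>\<Gamma>\<^esub> a \<otimes>\<^bsub>\<Gamma>\<^esub> a" using Hc[OF h] Hc[OF a] by (simp add: grp.m_assoc)
      moreover have "h \<otimes>\<^bsub>\<Gamma>\<^esub> inv\<^bsub>\<Gamma>\<^esub> a \<in> ?H" using grade_set_center_subgroup(2,3) h a by blast
      ultimately show "h \<in> ?H #>\<^bsub>?G\<^esub> a" by (auto simp: r_coset_def)
    qed
  qed
  have "rcosets\<^bsub>?G\<^esub> ?H = {?H}"
    using coset grade_set_center_subgroup(1) by (auto simp: RCOSETS_def)
  then show False using assms unfolding center_totally_ramified_def eq by simp
qed

lemma totally_ramified_skew_element:
  assumes "center_totally_ramified E \<Gamma> grad \<tau>"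
  obtains t \<epsilon> where "t \<in> Z" "\<epsilon> \<in> carrier \<Gamma>" "t \<in> grad \<epsilon>" "t \<noteq> \<zero>" "\<tau> t = \<ominus> t" "\<ominus> t \<noteq> t"
    "\<And>z. z \<in> Z \<inter> grad \<one>\<^bsub>\<Gamma>\<^esub> \<Longrightarrow> \<tau> z = z"
proof -
  obtain \<epsilon> where \<epsilon>: "\<epsilon> \<in> grade_set E \<Gamma> grad Z" "\<epsilon> \<notin> grade_set E \<Gamma> grad (fixed_center E \<tau>)"
    using exists_central_degree_not_fixed[OF assms] by blast
  have \<epsilon>c: "\<epsilon> \<in> carrier \<Gamma>" using \<epsilon> by (simp add: grade_set_def)
  obtain t where t: "t \<in> Z" "t \<in> grad \<epsilon>" "t \<noteq> \<zero>"
    using \<epsilon>(1) grad_zero[OF \<epsilon>c] ZE(2) by (auto simp: grade_set_def)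
  have nofix: "z = \<zero>" if "z \<in> Z" "z \<in> grad \<epsilon>" "\<tau> z = z" for z
    using \<epsilon>(2) \<epsilon>c that by (auto simp: grade_set_def fixed_center_def)
  \<comment> \<open>The element z + \<tau> z is central, fixed and of degree \<epsilon>, a degree in
    which R is zero.\<close>
  have skew: "\<tau> z = \<ominus> z" if z: "z \<in> Z" "z \<in> grad \<epsilon>" for z
  proof -
    have zc: "z \<in> carrier E" "\<tau> z \<in> carrier E" using z ring_centerD inv_closed by auto
    have "z \<oplus> \<tau> z = \<zero>"
      using nofix[of "z \<oplus> \<tau> z"] ZE(7)[OF z(1) tau_central[OF z(1)]]
        grad_add[OF \<epsilon>c z(2) tau_grad[OF \<epsilon>c z(2)]] symmetrize(1)[OF zc(1)] by blast
    then show ?thesis using zc by (metis a_comm minus_equality)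
  qed
  have tU: "t \<in> Units E" and tc: "t \<in> carrier E" using homogeneous_unit[OF \<epsilon>c t(2,3)] by auto
  show ?thesis
  proof (rule that[OF t(1) \<epsilon>c t(2,3) skew[OF t(1,2)]])
    \<comment> \<open>If -t = t, then t would be fixed by \<tau> and hence zero. This is where
      characteristic 2 is excluded.\<close>
    show "\<ominus> t \<noteq> t" using nofix[OF t(1,2)] skew[OF t(1,2)] t(3) by auto
    fix z assume z: "z \<in> Z \<inter> grad \<one>\<^bsub>\<Gamma>\<^esub>"
    have zc: "z \<in> carrier E" "\<tau> z \<in> carrier E" using z ring_centerD inv_closed by auto
    \<comment> \<open>Multiplication by t moves z to the degree where \<tau> is -1. Both z t and t
      are skew, so the signs cancel and t can be removed.\<close>
    have "z \<otimes> t \<in> grad \<epsilon>" using grad_mult[OF _ \<epsilon>c _ t(2), of "\<one>\<^bsub>\<Gamma>\<^esub>" z] z \<epsilon>c by simp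
    then have "\<tau> (z \<otimes> t) = \<ominus> (z \<otimes> t)" using skew[of "z \<otimes> t"] ZE(6)[of z t] z t by blast
    moreover have "\<tau> (z \<otimes> t) = \<ominus> (\<tau> z \<otimes> t)"
      using inv_mult[OF zc(1) tc] skew[OF t(1,2)] ring_centerD(2)[OF t(1) zc(2)] tc zc
      by (simp add: l_minus)
    ultimately have "\<tau> z \<otimes> t = z \<otimes> t"
      using zc tc by (metis m_closed minus_minus)
    then show "\<tau> z = z" using cancel_right[OF zc(2,1)] t by simp
  qed
qed

end

text \<open>The quotient is computed directly from its record: its elements are the cosets of the
  subgroup by elements of \<open>Sigma'_unitary E \<tau>\<close>, and each of them is the full unit
  group.\<close>

lemma SK1_unitary_trivial:
  assumes "monoid E" and Sigma: "Sigma_unitary E \<tau> = Units E" and one: "\<one>\<^bsub>E\<^esub> \<in> Sigma'_unitary E \<tau>"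
  shows "trivial_group (SK1_unitary E \<tau>)"
proof -
  interpret monoid E by fact
  interpret U: group "units_of E" by (rule units_group)
  let ?G = "(units_of E)\<lparr>carrier := Sigma'_unitary E \<tau>\<rparr>"
  have coset: "Units E #>\<^bsub>?G\<^esub> a = Units E" if a: "a \<in> Units E" for a
  proof
    show "Units E #>\<^bsub>?G\<^esub> a \<subseteq> Units E" using a by (auto simp: r_coset_def units_of_mult)
    show "Units E \<subseteq> Units E #>\<^bsub>?G\<^esub> a"
    proof
      fix h assume h: "h \<in> Units E"
      have "h = h \<otimes>\<^bsub>E\<^esub> inv\<^bsub>E\<^esub> a \<otimes>\<^bsub>E\<^esub> a" using a h by (simp add: m_assoc Units_closed)
      moreover have "h \<otimes>\<^bsub>E\<^esub> inv\<^bsub>E\<^esub> a \<in> Units E" using a h by simp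
      ultimately show "h \<in> Units E #>\<^bsub>?G\<^esub> a" by (auto simp: r_coset_def units_of_mult)
    qed
  qed
  have carr: "carrier (SK1_unitary E \<tau>) = {Units E}"
    using coset one by (auto simp: SK1_unitary_def FactGroup_def RCOSETS_def Sigma Sigma'_unitary_def)
  have unit: "\<one>\<^bsub>SK1_unitary E \<tau>\<^esub> = Units E"
    by (simp add: SK1_unitary_def FactGroup_def Sigma)
  have mult: "Units E \<otimes>\<^bsub>SK1_unitary E \<tau>\<^esub> Units E = Units E"
  proof -
    have "Units E <#>\<^bsub>?G\<^esub> Units E = (\<Union>a\<in>Units E. Units E #>\<^bsub>?G\<^esub> a)"
      by (auto simp: set_mult_def r_coset_def)
    also have "\<dots> = Units E" using coset by auto
    finally show ?thesis by (simp add: SK1_unitary_def FactGroup_def)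
  qed
  have "group (SK1_unitary E \<tau>)"
    by (rule groupI) (auto simp: carr unit mult)
  then show ?thesis by (simp add: trivial_group_def carr unit)
qed

theorem proposition4p5:
  fixes E :: "('a, 'm) ring_scheme"
    and \<Gamma> :: "('g, 'n) monoid_scheme"
    and grad :: "'g \<Rightarrow> 'a set"
    and \<tau> :: "'a \<Rightarrow> 'a"
  assumes "graded_division_ring E \<Gamma> grad"
    and "graded_fin_dim E \<Gamma> grad (ring_center E)"
    and "unitary_graded_involution E \<Gamma> grad \<tau>"
    and "carrier E \<noteq> ring_center E"
    and "center_totally_ramified E \<Gamma> grad \<tau>"
  shows "Sigma_unitary E \<tau> = Units E \<and> trivial_group (SK1_unitary E \<tau>)"
proof -
  interpret graded_division_ring E \<Gamma> grad by fact
  interpret graded_division_involution E \<Gamma> grad \<tau>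
    using assms(1) unitary_graded_involution.axioms(1)[OF assms(3)]
    by (rule graded_division_involution.intro)
  have Sigma: "Sigma_unitary E \<tau> = Units E"
  proof (rule totally_ramified_skew_element[OF assms(5)])
    fix t \<epsilon>
    assume t: "t \<in> ring_center E" "\<epsilon> \<in> carrier \<Gamma>" "t \<in> grad \<epsilon>" "t \<noteq> \<zero>\<^bsub>E\<^esub>"
      "\<tau> t = \<ominus>\<^bsub>E\<^esub> t" "\<ominus>\<^bsub>E\<^esub> t \<noteq> t"
      and fixed: "\<And>z. z \<in> ring_center E \<inter> grad \<one>\<^bsub>\<Gamma>\<^esub> \<Longrightarrow> \<tau> z = z"
    show ?thesis by (rule Sigma_eq_Units[OF t fixed assms(2,4)])
  qed
  obtain B where "module_basis E (ring_center E) B" using assms(2) by (auto simp: graded_fin_dim_def)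
  then have "Nrd E \<one>\<^bsub>E\<^esub> = \<one>\<^bsub>E\<^esub>" by (rule Nrd_one)
  moreover have "\<one>\<^bsub>E\<^esub> \<in> fixed_center E \<tau>" using ZE(3) inv_one by (simp add: fixed_center_def)
  then have "\<one>\<^bsub>E\<^esub> \<in> Units (E\<lparr>carrier := fixed_center E \<tau>\<rparr>)"
    by (auto simp: Units_def intro!: bexI[of _ "\<one>\<^bsub>E\<^esub>"])
  ultimately have "\<one>\<^bsub>E\<^esub> \<in> Sigma'_unitary E \<tau>" by (simp add: Sigma'_unitary_def)
  then show ?thesis using Sigma SK1_unitary_trivial[OF monoid_axioms] by blast
qed

end
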